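(* Let $n\geq 3$ and let $\mathrm{Out}(F_n)$ be the outer automorphism group of the free group $F_n$ of rank $n$. Then $\Phi(\mathrm{Out}(F_n))=\Phi_f(\mathrm{Out}(F_n))=1$.
   Context: For a group $G$, a maximal subgroup is a proper subgroup maximal with respect to inclusion among proper subgroups. The Frattini subgroup $\Phi(G)$ is the intersection of all maximal subgroups of $G$ if such exist, and $\Phi(G)=G$ otherwise. $\Phi_f(G)$ is the intersection of all maximal subgroups of finite index in $G$ (taken to be $G$ if there are none). *)

theory Defs
  imports "HOL-Algebra.Bij" "HOL-Algebra.Coset"
begin

text \<open>A letter is a pair (i, b): generator x_i (b = True) or its inverse (b = False).\<close>

type_synonym letter = "nat \<times> bool"

definition letter_inv :: "letter \<Rightarrow> letter" where
  "letter_inv a = (fst a, \<not> snd a)"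

fun reduced :: "letter list \<Rightarrow> bool" where
  "reduced [] = True"
| "reduced [a] = True"
| "reduced (a # b # w) = (b \<noteq> letter_inv a \<and> reduced (b # w))"

fun cancel_cons :: "letter \<Rightarrow> letter list \<Rightarrow> letter list" where
  "cancel_cons a [] = [a]"
| "cancel_cons a (b # w) = (if b = letter_inv a then w else a # b # w)"

definition reduce :: "letter list \<Rightarrow> letter list" where
  "reduce w = foldr cancel_cons w []"

definition free_group :: "nat \<Rightarrow> letter list monoid" where
  "free_group n =
    \<lparr>carrier = {w. reduced w \<and> (\<forall>a \<in> set w. fst a < n)},
     mult = (\<lambda>u v. reduce (u @ v)),
     one = []\<rparr>"

definition inner_auto :: "('a, 'b) monoid_scheme \<Rightarrow> ('a \<Rightarrow> 'a) set" where
  "inner_auto G =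
     {(\<lambda>x \<in> carrier G. g \<otimes>\<^bsub>G\<^esub> x \<otimes>\<^bsub>G\<^esub> inv\<^bsub>G\<^esub> g) | g. g \<in> carrier G}"

definition OutGroup :: "('a, 'b) monoid_scheme \<Rightarrow> ('a \<Rightarrow> 'a) set monoid" where
  "OutGroup G = AutoGroup G Mod inner_auto G"

definition maximal_subgroup :: "'a set \<Rightarrow> ('a, 'b) monoid_scheme \<Rightarrow> bool" where
  "maximal_subgroup H G \<longleftrightarrow> subgroup H G \<and> H \<noteq> carrier G \<and>
     (\<forall>K. subgroup K G \<and> H \<subseteq> K \<and> K \<noteq> carrier G \<longrightarrow> K = H)"

definition Frattini :: "('a, 'b) monoid_scheme \<Rightarrow> 'a set" where
  "Frattini G =
     (if \<exists>H. maximal_subgroup H G then \<Inter>{H. maximal_subgroup H G} else carrier G)"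

definition Frattini_f :: "('a, 'b) monoid_scheme \<Rightarrow> 'a set" where
  "Frattini_f G =
     (if \<exists>H. maximal_subgroup H G \<and> finite (rcosets\<^bsub>G\<^esub> H)
      then \<Inter>{H. maximal_subgroup H G \<and> finite (rcosets\<^bsub>G\<^esub> H)} else carrier G)"

end

theory Submission
  imports Defs "HOL-Combinatorics.Transposition" "HOL-Computational_Algebra.Polynomial"
    "HOL-Computational_Algebra.Primes" "HOL-Number_Theory.Cong"
begin

text \<open>
  It suffices to find, for every non-inner automorphism of \<open>F\<^sub>n\<close>, a maximal subgroup of finite index of
  the automorphism group that contains all inner automorphisms but not the given one.
  If \<open>K\<close> is a normal subgroup with finite simple quotient that contains a basis element \<open>x\<^sub>l\<close>, then its
  stabiliser is maximal: a strictly larger subgroup contains a transvection \<open>x\<^sub>l \<mapsto> x\<^sub>l g\<close> with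
  \<open>g\<close> outside \<open>K\<close>, hence by simplicity all of them, hence every Nielsen generator.
  Any representation in \<open>SL\<^sub>2(\<int>)\<close> sending \<open>x\<^sub>0\<close>, \<open>x\<^sub>1\<close> to opposite unipotents yields such kernels
  in \<open>PSL\<^sub>2(p)\<close> for all large \<open>p\<close>, because the image of the remaining basis element is matched by a
  word in \<open>x\<^sub>0\<close>, \<open>x\<^sub>1\<close>.
  An automorphism \<open>\<phi>\<close> preserving all these kernels sends \<open>x\<^sub>0\<close> to an element of trace at most \<open>2\<close> in
  absolute value, and letting the representation vary polynomially shows that \<open>\<phi>(x\<^sub>0)\<close> is conjugate to
  \<open>x\<^sub>0\<close> or its inverse. The same holds for every basis element, and comparing \<open>x\<^sub>i\<close>, \<open>x\<^sub>i x\<^sub>j\<close> and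
  \<open>x\<^sub>0 x\<^sub>1 x\<^sub>2\<close> forces \<open>\<phi>\<close> to be inner.
\<close>

section \<open>Free groups\<close>

text \<open>Two obstacles shape the argument. A stabiliser is shown to be maximal only when a basis
  element lies in the kernel, which a given representation need not satisfy. As the intersection of
  the relevant maximal subgroups is normal in the automorphism group, the representation may be
  precomposed with a transvection that kills the third basis element modulo \<open>p\<close>; hence
  three generators, two to fill SL_2(p) and one to spare. Secondly, kernels do not see directly that
  an element is unipotent. They do see a relation: modulo \<open>p\<close> a unipotent is conjugate
  to its fourth power. Since \<open>p\<close> may be chosen after the traces involved, the resulting
  congruence is an equality of integers, and it fails for traces beyond 2. The final comparison
  needs a word of three letters: inverting every generator sends x_i x_j to a conjugate of its
  inverse, but sends x_0 x_1 x_2 to a word whose cyclic order differs from that of the inverse. In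
  rank two this automorphism gives the central element -1 of Out(F_2) = GL_2(Z).\<close>

lemma letter_inv_simps [simp]:
  "letter_inv (letter_inv a) = a" "letter_inv a \<noteq> a" "a \<noteq> letter_inv a"
  "fst (letter_inv a) = fst a" "snd (letter_inv a) = (\<not> snd a)"
  by (auto simp: letter_inv_def prod_eq_iff)

lemma letter_cases: "fst a = fst b \<Longrightarrow> a = b \<or> a = letter_inv b"
  by (auto simp: letter_inv_def prod_eq_iff)

lemma reduced_iff: "reduced w \<longleftrightarrow> successively (\<lambda>a b. b \<noteq> letter_inv a) w"
  by (induction w rule: reduced.induct) auto

lemma reduced_append_iff:
  "reduced (u @ v) \<longleftrightarrow> reduced u \<and> reduced v \<and> (u = [] \<or> v = [] \<or> hd v \<noteq> letter_inv (last u))"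
  by (auto simp: reduced_iff successively_append_iff)

lemma reduced_Cons_iff: "reduced (a # v) \<longleftrightarrow> reduced v \<and> (v = [] \<or> hd v \<noteq> letter_inv a)"
  by (cases v) auto

definition winv :: "letter list \<Rightarrow> letter list" where
  "winv w = rev (map letter_inv w)"

lemma winv_simps [simp]:
  "winv [] = []" "winv (a # w) = winv w @ [letter_inv a]" "winv (u @ v) = winv v @ winv u"
  "winv (winv w) = w" "length (winv w) = length w" "winv w = [] \<longleftrightarrow> w = []"
  by (auto simp: winv_def rev_map comp_def)

lemma hd_winv: "w \<noteq> [] \<Longrightarrow> hd (winv w) = letter_inv (last w)"
  by (simp add: winv_def hd_rev last_map)

lemma last_winv: "w \<noteq> [] \<Longrightarrow> last (winv w) = letter_inv (hd w)"
  by (simp add: winv_def last_rev hd_map)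

lemma fst_set_winv [simp]: "fst ` set (winv w) = fst ` set w"
  by (force simp: winv_def image_image)

lemma reduced_winv [simp]: "reduced (winv w) \<longleftrightarrow> reduced w"
proof -
  have "reduced (winv w)" if "reduced w" for w
    using that
    by (induction w) (auto simp: reduced_append_iff reduced_Cons_iff last_winv)
  then show ?thesis by (metis winv_simps(4))
qed

lemma reduced_cancel_cons: "reduced w \<Longrightarrow> reduced (cancel_cons a w)"
  by (cases w) (auto simp: reduced_Cons_iff)

text \<open>A letter acts on reduced words by prepending and cancelling; reducedness makes opposite
  letters act as mutually inverse permutations. This is van der Waerden's argument, which gives
  associativity without a confluence proof.\<close>

lemma cancel_cons_inv: "reduced w \<Longrightarrow> cancel_cons a (cancel_cons (letter_inv a) w) = w"
  by (cases w; cases "tl w") auto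

lemma cancel_cons_reduced: "reduced (a # w) \<Longrightarrow> cancel_cons a w = a # w"
  by (cases w) auto

lemma set_cancel_cons: "set (cancel_cons a w) \<subseteq> insert a (set w)"
  by (cases w) auto

lemma reduced_foldr_cancel: "reduced w \<Longrightarrow> reduced (foldr cancel_cons u w)"
  by (induction u) (auto simp: reduced_cancel_cons)

lemma reduced_reduce [simp]: "reduced (reduce w)"
  by (simp add: reduce_def reduced_foldr_cancel)

lemma reduce_id: "reduced w \<Longrightarrow> reduce w = w"
  by (induction w) (auto simp: reduce_def reduced_Cons_iff cancel_cons_reduced)

lemma set_reduce: "set (reduce w) \<subseteq> set w"
proof (induction w)
  case (Cons a w)
  then show ?case using set_cancel_cons[of a "reduce w"] by (auto simp: reduce_def)
qed (simp add: reduce_def)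

lemma foldr_cancel_cons:
  assumes "reduced v" "reduced w"
  shows "foldr cancel_cons (cancel_cons a v) w = cancel_cons a (foldr cancel_cons v w)"
  using assms by (cases v) (auto simp: cancel_cons_inv reduced_foldr_cancel)

text \<open>The action of a word on reduced words depends only on its reduced form: associativity in
  disguise.\<close>

lemma foldr_reduce: "reduced w \<Longrightarrow> foldr cancel_cons (reduce u) w = foldr cancel_cons u w"
  by (induction u) (auto simp: reduce_def foldr_cancel_cons reduced_foldr_cancel)

lemma reduce_append: "reduce (u @ v) = foldr cancel_cons u (reduce v)"
  by (simp add: reduce_def)

lemma reduce_append_reduce [simp]:
  "reduce (reduce u @ v) = reduce (u @ v)" "reduce (u @ reduce v) = reduce (u @ v)"
  by (simp_all add: reduce_append foldr_reduce reduce_id)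

lemma reduce_cancel: "reduce (u @ a # letter_inv a # v) = reduce (u @ v)"
proof -
  have "reduce (a # letter_inv a # v) = reduce v"
    using cancel_cons_inv[of "reduce v" a] by (simp add: reduce_def reduced_foldr_cancel)
  then show ?thesis by (simp only: reduce_append)
qed

lemma reduce_winv_append: "reduce (a @ p @ winv p @ b) = reduce (a @ b)"
proof (induction p arbitrary: a b rule: rev_induct)
  case (snoc x p)
  then show ?case using reduce_cancel[of "a @ p" x "winv p @ b"] by simp
qed simp

text \<open>The last letter of \<open>u\<close> either survives, and \<open>p\<close> is empty, or
  is removed together with the first letter of \<open>v\<close>.\<close>

lemma reduced_cancellation:
  assumes "reduced u" "reduced v"
  obtains a p b where "u = a @ p" "v = winv p @ b" "reduced (a @ b)"
proof -
  have "\<exists>a p b. u = a @ p \<and> v = winv p @ b \<and> reduced (a @ b)"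
    using assms
  proof (induction u arbitrary: v rule: rev_induct)
    case (snoc x u)
    show ?case
    proof (cases "v \<noteq> [] \<and> hd v = letter_inv x")
      case True
      then obtain v' where v: "v = letter_inv x # v'" by (cases v) auto
      have "reduced u" "reduced v'" using snoc.prems v by (auto simp: reduced_append_iff reduced_Cons_iff)
      then obtain a p b where "u = a @ p" "v' = winv p @ b" "reduced (a @ b)"
        using snoc.IH by blast
      then have "u @ [x] = a @ (p @ [x]) \<and> v = winv (p @ [x]) @ b \<and> reduced (a @ b)"
        using v by simp
      then show ?thesis by blast
    next
      case False
      then have "u @ [x] = (u @ [x]) @ [] \<and> v = winv [] @ v \<and> reduced ((u @ [x]) @ v)"
        using snoc.prems by (auto simp: reduced_append_iff reduced_Cons_iff)
      then show ?thesis by blast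
    qed
  qed auto
  then show thesis using that by blast
qed

lemma free_group_simps:
  "w \<in> carrier (free_group n) \<longleftrightarrow> reduced w \<and> fst ` set w \<subseteq> {..<n}"
  "u \<otimes>\<^bsub>free_group n\<^esub> v = reduce (u @ v)"
  "\<one>\<^bsub>free_group n\<^esub> = []"
  by (auto simp: free_group_def)

lemma fst_set_reduce: "fst ` set (reduce w) \<subseteq> fst ` set w"
  using set_reduce by blast

lemma reduce_winv_self: "reduce (winv w @ w) = []"
  using reduce_winv_append[of "[]" "winv w" "[]"] by (simp add: reduce_def)

lemma group_free_group: "group (free_group n)"
proof (rule groupI)
  fix x y assume "x \<in> carrier (free_group n)" "y \<in> carrier (free_group n)"
  then show "x \<otimes>\<^bsub>free_group n\<^esub> y \<in> carrier (free_group n)"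
    using fst_set_reduce[of "x @ y"] unfolding free_group_simps set_append image_Un
    by (meson Un_least order_trans reduced_reduce)
next
  fix x assume "x \<in> carrier (free_group n)"
  then show "\<exists>y\<in>carrier (free_group n). y \<otimes>\<^bsub>free_group n\<^esub> x = \<one>\<^bsub>free_group n\<^esub>"
    by (intro bexI[of _ "winv x"]) (auto simp: free_group_simps reduce_winv_self)
qed (auto simp: free_group_simps reduce_id)

section \<open>Evaluation of words in a group and the universal property\<close>

definition letter_val :: "('a, 'b) monoid_scheme \<Rightarrow> (nat \<Rightarrow> 'a) \<Rightarrow> letter \<Rightarrow> 'a" where
  "letter_val H f a = (if snd a then f (fst a) else inv\<^bsub>H\<^esub> f (fst a))"

definition word_val :: "('a, 'b) monoid_scheme \<Rightarrow> (nat \<Rightarrow> 'a) \<Rightarrow> letter list \<Rightarrow> 'a" where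
  "word_val H f w = foldr (\<lambda>a x. letter_val H f a \<otimes>\<^bsub>H\<^esub> x) w \<one>\<^bsub>H\<^esub>"

lemma word_val_simps [simp]:
  "word_val H f [] = \<one>\<^bsub>H\<^esub>" "word_val H f (a # w) = letter_val H f a \<otimes>\<^bsub>H\<^esub> word_val H f w"
  by (simp_all add: word_val_def)

context group
begin

lemma letter_val_closed: "f (fst a) \<in> carrier G \<Longrightarrow> letter_val G f a \<in> carrier G"
  by (simp add: letter_val_def)

lemma letter_val_inv: "f (fst a) \<in> carrier G \<Longrightarrow> letter_val G f (letter_inv a) = inv letter_val G f a"
  by (simp add: letter_val_def)

lemma word_val_closed: "f ` fst ` set w \<subseteq> carrier G \<Longrightarrow> word_val G f w \<in> carrier G"
  by (induction w) (auto simp: letter_val_closed)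

lemma word_val_append:
  "f ` fst ` set u \<subseteq> carrier G \<Longrightarrow> f ` fst ` set v \<subseteq> carrier G \<Longrightarrow>
    word_val G f (u @ v) = word_val G f u \<otimes> word_val G f v"
  by (induction u) (auto simp: letter_val_closed word_val_closed m_assoc)

lemma word_val_cancel_cons:
  assumes "f (fst a) \<in> carrier G" "f ` fst ` set w \<subseteq> carrier G"
  shows "word_val G f (cancel_cons a w) = letter_val G f a \<otimes> word_val G f w"
proof (cases w)
  case (Cons b v)
  then show ?thesis using assms
    by (auto simp: letter_val_inv letter_val_closed word_val_closed m_assoc[symmetric])
qed simp

lemma word_val_reduce:
  "f ` fst ` set w \<subseteq> carrier G \<Longrightarrow> word_val G f (reduce w) = word_val G f w"
proof (induction w)
  case (Cons a w)
  have "f ` fst ` set (reduce w) \<subseteq> carrier G" using Cons.prems fst_set_reduce[of w] by auto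
  then show ?case using Cons word_val_cancel_cons[of f a "reduce w"]
    by (simp add: reduce_def)
qed (simp add: reduce_def)

text \<open>Existence half of the universal property; reduction is harmless because evaluation sends
  cancelling pairs to 1.\<close>

lemma word_val_hom:
  assumes "f \<in> {..<n} \<rightarrow> carrier G"
  shows "word_val G f \<in> hom (free_group n) G"
proof (rule homI)
  fix x assume "x \<in> carrier (free_group n)"
  then show "word_val G f x \<in> carrier G" using assms
    by (intro word_val_closed) (auto simp: free_group_simps)
next
  fix x y assume "x \<in> carrier (free_group n)" "y \<in> carrier (free_group n)"
  then have "f ` fst ` set x \<subseteq> carrier G" "f ` fst ` set y \<subseteq> carrier G"
    using assms by (auto simp: free_group_simps)
  then show "word_val G f (x \<otimes>\<^bsub>free_group n\<^esub> y) = word_val G f x \<otimes> word_val G f y"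
    by (simp add: free_group_simps word_val_reduce word_val_append image_Un)
qed

end

definition gen :: "nat \<Rightarrow> letter list" where
  "gen i = [(i, True)]"

lemma inv_free_group: "w \<in> carrier (free_group n) \<Longrightarrow> inv\<^bsub>free_group n\<^esub> w = winv w"
  by (rule group.inv_equality[OF group_free_group])
     (auto simp: free_group_simps reduce_winv_self)

locale free_group_rank =
  fixes n :: nat
begin

abbreviation F :: "letter list monoid" where "F \<equiv> free_group n"

sublocale F: group F by (rule group_free_group)

abbreviation fmult (infixl "\<cdot>" 70) where "u \<cdot> v \<equiv> u \<otimes>\<^bsub>F\<^esub> v"
abbreviation finv ("inv\<^sub>F _" [81] 80) where "inv\<^sub>F u \<equiv> inv\<^bsub>F\<^esub> u"

lemma gen_closed [simp]: "i < n \<Longrightarrow> gen i \<in> carrier F"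
  by (simp add: gen_def free_group_simps)

lemma letter_closed: "fst a < n \<Longrightarrow> [a] \<in> carrier F"
  by (simp add: free_group_simps)

lemma Cons_eq_mult: "a # w \<in> carrier F \<Longrightarrow> a # w = [a] \<cdot> w"
  by (auto simp: free_group_simps reduce_id)

lemma Cons_closed: "a # w \<in> carrier F \<Longrightarrow> fst a < n \<and> w \<in> carrier F"
  by (auto simp: free_group_simps reduced_Cons_iff)

lemma append_eq_mult: "u @ v \<in> carrier F \<Longrightarrow> u @ v = u \<cdot> v"
  by (auto simp: free_group_simps reduce_id)

lemma append_closed: "u @ v \<in> carrier F \<Longrightarrow> u \<in> carrier F \<and> v \<in> carrier F"
  by (auto simp: free_group_simps reduced_append_iff)

lemma winv_closed [simp]: "winv w \<in> carrier F \<longleftrightarrow> w \<in> carrier F"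
  by (simp add: free_group_simps)

lemma hom_letter:
  assumes "group H" "h \<in> hom F H" "fst a < n"
  shows "h [a] = letter_val H (\<lambda>i. h (gen i)) a"
proof -
  interpret h: group_hom F H h using assms by (simp add: group_hom_def group_hom_axioms_def group_free_group)
  have "gen (fst a) \<in> carrier F" using assms(3) by (simp add: gen_def free_group_simps)
  then show ?thesis using h.hom_inv[of "gen (fst a)"]
    by (cases a) (auto simp: letter_val_def inv_free_group gen_def letter_inv_def)
qed

lemma hom_word_val:
  assumes "group H" "h \<in> hom F H" "w \<in> carrier F"
  shows "h w = word_val H (\<lambda>i. h (gen i)) w"
  using assms(3)
proof (induction w)
  case Nil
  then show ?case using hom_one[OF assms(2) group_free_group assms(1)] by (simp add: free_group_simps)
next
  case (Cons a w)
  have "h (a # w) = h [a] \<otimes>\<^bsub>H\<^esub> h w"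
    using Cons.prems Cons_closed[OF Cons.prems] Cons_eq_mult[OF Cons.prems] assms(2)
    by (metis hom_mult letter_closed)
  then show ?case using Cons Cons_closed[OF Cons.prems] hom_letter[OF assms(1,2), of a] by simp
qed

text \<open>Only generators occurring in the word are compared; this local form makes a transvection
  fix every word that avoids its index.\<close>

lemma hom_eq_on_word:
  assumes "group H" "h \<in> hom F H" "k \<in> hom F H" "w \<in> carrier F"
    and "\<And>i. i \<in> fst ` set w \<Longrightarrow> h (gen i) = k (gen i)"
  shows "h w = k w"
proof -
  have "word_val H (\<lambda>i. h (gen i)) w = word_val H (\<lambda>i. k (gen i)) w"
    using assms(5) by (induction w) (auto simp: letter_val_def)
  then show ?thesis using assms hom_word_val by metis
qed

lemma hom_eqI:
  assumes "group H" "h \<in> hom F H" "k \<in> hom F H" "w \<in> carrier F"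
    and "\<And>i. i < n \<Longrightarrow> h (gen i) = k (gen i)"
  shows "h w = k w"
  by (rule hom_eq_on_word[OF assms(1-4)], rule assms(5)) (use assms(4) in \<open>auto simp: free_group_simps\<close>)

lemma word_val_gen [simp]:
  assumes "group H" "f \<in> {..<n} \<rightarrow> carrier H" "i < n"
  shows "word_val H f (gen i) = f i"
  using assms by (auto simp: gen_def letter_val_def group.is_monoid monoid.r_one Pi_def)

lemma id_hom: "(\<lambda>w. w) \<in> hom F F"
  by (simp add: hom_def)

end

section \<open>Automorphisms\<close>

context group
begin

lemma autoD:
  assumes "\<psi> \<in> auto G"
  shows "\<psi> \<in> hom G G" "bij_betw \<psi> (carrier G) (carrier G)" "\<psi> \<in> extensional (carrier G)"
    "\<And>x. x \<in> carrier G \<Longrightarrow> \<psi> x \<in> carrier G"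
    "\<And>x y. x \<in> carrier G \<Longrightarrow> y \<in> carrier G \<Longrightarrow> \<psi> (x \<otimes> y) = \<psi> x \<otimes> \<psi> y"
    "\<psi> \<one> = \<one>" "\<And>x. x \<in> carrier G \<Longrightarrow> \<psi> (inv x) = inv (\<psi> x)"
proof -
  show h: "\<psi> \<in> hom G G" "bij_betw \<psi> (carrier G) (carrier G)" "\<psi> \<in> extensional (carrier G)"
    using assms by (auto simp: auto_def Bij_def)
  interpret \<psi>: group_hom G G \<psi> using h(1) by unfold_locales
  show "\<And>x. x \<in> carrier G \<Longrightarrow> \<psi> x \<in> carrier G"
    "\<And>x y. x \<in> carrier G \<Longrightarrow> y \<in> carrier G \<Longrightarrow> \<psi> (x \<otimes> y) = \<psi> x \<otimes> \<psi> y"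
    "\<psi> \<one> = \<one>" "\<And>x. x \<in> carrier G \<Longrightarrow> \<psi> (inv x) = inv (\<psi> x)" by simp_all
qed

lemma autoI:
  assumes "\<psi> \<in> hom G G" "\<psi> \<in> extensional (carrier G)" "\<chi> \<in> carrier G \<rightarrow> carrier G"
    and "\<And>x. x \<in> carrier G \<Longrightarrow> \<chi> (\<psi> x) = x" "\<And>x. x \<in> carrier G \<Longrightarrow> \<psi> (\<chi> x) = x"
  shows "\<psi> \<in> auto G"
  using assms by (auto simp: auto_def Bij_def hom_def intro!: bij_betw_byWitness[of _ \<chi>])

lemma carrier_AutoGroup [simp]: "carrier (AutoGroup G) = auto G"
  by (simp add: AutoGroup_def)

lemma AutoGroup_mult:
  "\<psi> \<in> auto G \<Longrightarrow> \<chi> \<in> auto G \<Longrightarrow> x \<in> carrier G \<Longrightarrow> (\<psi> \<otimes>\<^bsub>AutoGroup G\<^esub> \<chi>) x = \<psi> (\<chi> x)"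
  by (simp add: AutoGroup_def BijGroup_def auto_def compose_def)

lemma AutoGroup_one: "x \<in> carrier G \<Longrightarrow> \<one>\<^bsub>AutoGroup G\<^esub> x = x"
  by (simp add: AutoGroup_def BijGroup_def)

lemma AutoGroup_inv:
  assumes "\<psi> \<in> auto G" "x \<in> carrier G"
  shows "\<psi> ((inv\<^bsub>AutoGroup G\<^esub> \<psi>) x) = x" "(inv\<^bsub>AutoGroup G\<^esub> \<psi>) (\<psi> x) = x"
proof -
  interpret A: group "AutoGroup G" by (rule AutoGroup)
  have i: "inv\<^bsub>AutoGroup G\<^esub> \<psi> \<in> auto G" using assms A.inv_closed by simp
  show "\<psi> ((inv\<^bsub>AutoGroup G\<^esub> \<psi>) x) = x"
    using AutoGroup_mult[OF assms(1) i assms(2)] A.r_inv assms AutoGroup_one by simp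
  show "(inv\<^bsub>AutoGroup G\<^esub> \<psi>) (\<psi> x) = x"
    using AutoGroup_mult[OF i assms(1) assms(2)] A.l_inv assms AutoGroup_one by simp
qed

lemma auto_eqI:
  assumes "\<psi> \<in> auto G" "\<chi> \<in> auto G" "\<And>x. x \<in> carrier G \<Longrightarrow> \<psi> x = \<chi> x"
  shows "\<psi> = \<chi>"
  using assms autoD(3) by (meson extensionalityI)

end

context free_group_rank
begin

abbreviation A :: "(letter list \<Rightarrow> letter list) monoid" where "A \<equiv> AutoGroup F"

sublocale A: group A by (rule F.AutoGroup)

abbreviation amult (infixl "\<odot>" 70) where "\<phi> \<odot> \<psi> \<equiv> \<phi> \<otimes>\<^bsub>A\<^esub> \<psi>"
abbreviation ainv ("inv\<^sub>A _" [81] 80) where "inv\<^sub>A \<phi> \<equiv> inv\<^bsub>A\<^esub> \<phi>"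

lemma aut_eqI:
  assumes "\<psi> \<in> auto F" "\<chi> \<in> auto F" "\<And>i. i < n \<Longrightarrow> \<psi> (gen i) = \<chi> (gen i)"
  shows "\<psi> = \<chi>"
proof (rule F.auto_eqI[OF assms(1,2)])
  fix w assume "w \<in> carrier F"
  then show "\<psi> w = \<chi> w"
    by (rule hom_eqI[OF group_free_group F.autoD(1)[OF assms(1)] F.autoD(1)[OF assms(2)]]) (rule assms(3))
qed

lemma aut_closed [simp]:
  "\<psi> \<in> auto F \<Longrightarrow> \<chi> \<in> auto F \<Longrightarrow> \<psi> \<odot> \<chi> \<in> auto F" "\<psi> \<in> auto F \<Longrightarrow> inv\<^sub>A \<psi> \<in> auto F"
  using A.m_closed A.inv_closed by auto

section \<open>Endomorphisms prescribed on the basis; elementary automorphisms\<close>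

definition ext :: "(nat \<Rightarrow> letter list) \<Rightarrow> letter list \<Rightarrow> letter list" where
  "ext f = (\<lambda>w \<in> carrier F. word_val F f w)"

lemma ext_hom: "f \<in> {..<n} \<rightarrow> carrier F \<Longrightarrow> ext f \<in> hom F F"
  using F.word_val_hom[of f n] by (auto simp: ext_def hom_def)

lemma ext_gen [simp]: "f \<in> {..<n} \<rightarrow> carrier F \<Longrightarrow> i < n \<Longrightarrow> ext f (gen i) = f i"
  by (simp add: ext_def word_val_gen group_free_group)

lemma ext_fixes:
  assumes "f \<in> {..<n} \<rightarrow> carrier F" "w \<in> carrier F" "\<And>i. i \<in> fst ` set w \<Longrightarrow> f i = gen i"
  shows "ext f w = w"
  by (rule hom_eq_on_word[OF group_free_group ext_hom[OF assms(1)] id_hom assms(2)])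
     (use assms in \<open>auto simp: free_group_simps intro!: trans[OF ext_gen]\<close>)

lemma ext_auto:
  assumes f: "f \<in> {..<n} \<rightarrow> carrier F" and g: "g \<in> {..<n} \<rightarrow> carrier F"
    and "\<And>i. i < n \<Longrightarrow> ext g (f i) = gen i" "\<And>i. i < n \<Longrightarrow> ext f (g i) = gen i"
  shows "ext f \<in> auto F"
proof (rule F.autoI[OF ext_hom[OF f]])
  show "ext f \<in> extensional (carrier F)" by (simp add: ext_def)
  show gc: "ext g \<in> carrier F \<rightarrow> carrier F" using ext_hom[OF g] by (simp add: hom_def)
  have fc: "ext f \<in> carrier F \<rightarrow> carrier F" using ext_hom[OF f] by (simp add: hom_def)
  have *: "(\<lambda>w. ext g (ext f w)) \<in> hom F F" "(\<lambda>w. ext f (ext g w)) \<in> hom F F"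
    using ext_hom[OF f] ext_hom[OF g] by (auto simp: hom_def Pi_def)
  show "ext g (ext f x) = x" if "x \<in> carrier F" for x
    by (rule hom_eqI[OF group_free_group *(1) id_hom that]) (use assms in auto)
  show "ext f (ext g x) = x" if "x \<in> carrier F" for x
    by (rule hom_eqI[OF group_free_group *(2) id_hom that]) (use assms in auto)
qed

text \<open>Membership in the free factor generated by the basis elements other than the
  i-th.\<close>

definition avoids :: "nat \<Rightarrow> letter list \<Rightarrow> bool" where
  "avoids i w \<longleftrightarrow> w \<in> carrier F \<and> i \<notin> fst ` set w"

lemma avoidsD: "avoids i w \<Longrightarrow> w \<in> carrier F" by (simp add: avoids_def)

lemma avoids_mult: "avoids i u \<Longrightarrow> avoids i v \<Longrightarrow> avoids i (u \<cdot> v)"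
proof -
  assume *: "avoids i u" "avoids i v"
  then have "u \<cdot> v \<in> carrier F" by (simp add: avoids_def)
  moreover have "i \<notin> fst ` set (u \<cdot> v)" using * fst_set_reduce[of "u @ v"]
    unfolding free_group_simps avoids_def by auto
  ultimately show ?thesis by (simp add: avoids_def)
qed

lemma avoids_inv: "avoids i u \<Longrightarrow> avoids i (inv\<^sub>F u)"
  by (simp add: avoids_def inv_free_group)

lemma avoids_one [simp]: "avoids i []" "avoids i \<one>\<^bsub>F\<^esub>"
  by (simp_all add: avoids_def free_group_simps)

lemma avoids_letter: "fst a < n \<Longrightarrow> fst a \<noteq> i \<Longrightarrow> avoids i [a]"
  by (simp add: avoids_def free_group_simps)

lemma avoids_gen: "j < n \<Longrightarrow> j \<noteq> i \<Longrightarrow> avoids i (gen j)"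
  by (simp add: gen_def avoids_letter)

text \<open>Multipliers on both sides cover the one-sided Nielsen moves as well as the partial
  conjugations of \<open>x_i\<close> needed later.\<close>

definition transv :: "nat \<Rightarrow> letter list \<Rightarrow> letter list \<Rightarrow> letter list \<Rightarrow> letter list" where
  "transv i g h = ext (gen(i := g \<cdot> gen i \<cdot> h))"

lemma transv_fun: "i < n \<Longrightarrow> avoids i g \<Longrightarrow> avoids i h \<Longrightarrow> gen(i := g \<cdot> gen i \<cdot> h) \<in> {..<n} \<rightarrow> carrier F"
  by (simp add: avoidsD)

lemma transv_fixes:
  assumes "i < n" "avoids i g" "avoids i h" "avoids i w"
  shows "transv i g h w = w"
  unfolding transv_def
  by (rule ext_fixes[OF transv_fun]) (use assms in \<open>auto simp: avoids_def\<close>)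

lemma transv_gen:
  assumes "i < n" "avoids i g" "avoids i h"
  shows "transv i g h (gen i) = g \<cdot> gen i \<cdot> h"
  unfolding transv_def using ext_gen[OF transv_fun[OF assms] assms(1)] by simp

lemma transv_gen_other:
  assumes "i < n" "avoids i g" "avoids i h" "j < n" "j \<noteq> i"
  shows "transv i g h (gen j) = gen j"
  using assms by (simp add: transv_fixes avoids_gen)

lemma transv_auto:
  assumes "i < n" "avoids i g" "avoids i h"
  shows "transv i g h \<in> auto F"
proof -
  note i = avoids_inv[OF assms(2)] avoids_inv[OF assms(3)]
  note c = avoidsD[OF assms(2)] avoidsD[OF assms(3)]
  have 1: "transv i u v (inv\<^sub>F u \<cdot> gen i \<cdot> inv\<^sub>F v) = gen i"
    if "avoids i u" "avoids i v" for u v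
  proof -
    note [simp] = avoidsD[OF that(1)] avoidsD[OF that(2)]
    note m = hom_mult[OF ext_hom[OF transv_fun[OF assms(1) that]]]
    have "transv i u v (inv\<^sub>F u \<cdot> gen i \<cdot> inv\<^sub>F v) = inv\<^sub>F u \<cdot> (u \<cdot> gen i \<cdot> v) \<cdot> inv\<^sub>F v"
      using assms(1) transv_fixes[OF assms(1) that avoids_inv[OF that(1)]]
        transv_fixes[OF assms(1) that avoids_inv[OF that(2)]] transv_gen[OF assms(1) that]
      by (simp add: transv_def m)
    also have "\<dots> = gen i" using assms(1) by (simp add: F.m_assoc F.inv_solve_left')
    finally show ?thesis .
  qed
  show ?thesis unfolding transv_def
  proof (rule ext_auto)
    show "gen(i := g \<cdot> gen i \<cdot> h) \<in> {..<n} \<rightarrow> carrier F" using assms transv_fun by blast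
    show "gen(i := inv\<^sub>F g \<cdot> gen i \<cdot> inv\<^sub>F h) \<in> {..<n} \<rightarrow> carrier F"
      using assms transv_fun i by blast
    fix j assume "j < n"
    show "ext (gen(i := inv\<^sub>F g \<cdot> gen i \<cdot> inv\<^sub>F h)) ((gen(i := g \<cdot> gen i \<cdot> h)) j) = gen j"
      using 1[OF i] transv_gen_other[OF assms(1) i] \<open>j < n\<close> c by (auto simp: transv_def)
    show "ext (gen(i := g \<cdot> gen i \<cdot> h)) ((gen(i := inv\<^sub>F g \<cdot> gen i \<cdot> inv\<^sub>F h)) j) = gen j"
      using 1[OF assms(2,3)] transv_gen_other[OF assms(1-3)] \<open>j < n\<close> by (auto simp: transv_def)
  qed
qed

definition flip :: "nat \<Rightarrow> letter list \<Rightarrow> letter list" where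
  "flip i = ext (gen(i := inv\<^sub>F gen i))"

lemma flip_gen: "i < n \<Longrightarrow> j < n \<Longrightarrow> flip i (gen j) = (if j = i then inv\<^sub>F gen i else gen j)"
  unfolding flip_def by (subst ext_gen) (auto simp: Pi_def)

lemma flip_auto:
  assumes "i < n"
  shows "flip i \<in> auto F"
  unfolding flip_def
proof (rule ext_auto)
  have *: "gen(i := inv\<^sub>F gen i) \<in> {..<n} \<rightarrow> carrier F" using assms by (auto simp: Pi_def)
  then show "gen(i := inv\<^sub>F gen i) \<in> {..<n} \<rightarrow> carrier F" .
  fix j assume "j < n"
  interpret f: group_hom F F "flip i"
    using ext_hom[OF *] by (simp add: flip_def group_hom_def group_hom_axioms_def group_free_group)
  show "ext (gen(i := inv\<^sub>F gen i)) ((gen(i := inv\<^sub>F gen i)) j) = gen j"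
    using flip_gen[OF assms] \<open>j < n\<close> assms by (auto simp flip: flip_def)
  then show "ext (gen(i := inv\<^sub>F gen i)) ((gen(i := inv\<^sub>F gen i)) j) = gen j" .
qed (use assms in \<open>auto simp: Pi_def\<close>)

definition swap :: "nat \<Rightarrow> nat \<Rightarrow> letter list \<Rightarrow> letter list" where
  "swap i j = ext (gen \<circ> Transposition.transpose i j)"

lemma swap_fun: "i < n \<Longrightarrow> j < n \<Longrightarrow> gen \<circ> Transposition.transpose i j \<in> {..<n} \<rightarrow> carrier F"
  by (auto simp: Transposition.transpose_def)

lemma swap_gen: "i < n \<Longrightarrow> j < n \<Longrightarrow> k < n \<Longrightarrow> swap i j (gen k) = gen (Transposition.transpose i j k)"
  unfolding swap_def by (subst ext_gen[OF swap_fun]) auto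

lemma swap_auto:
  assumes "i < n" "j < n"
  shows "swap i j \<in> auto F"
proof -
  have *: "gen \<circ> Transposition.transpose i j \<in> {..<n} \<rightarrow> carrier F" using swap_fun[OF assms] .
  have "swap i j ((gen \<circ> Transposition.transpose i j) k) = gen k" if "k < n" for k
    using swap_gen[OF assms, of "Transposition.transpose i j k"] assms that
    by (auto simp: Transposition.transpose_def)
  then show ?thesis unfolding swap_def using ext_auto[OF * *] by blast
qed

lemma swap_swap: "i < n \<Longrightarrow> j < n \<Longrightarrow> w \<in> carrier F \<Longrightarrow> swap i j (swap i j w) = w"
proof -
  assume *: "i < n" "j < n" "w \<in> carrier F"
  note s = F.autoD[OF swap_auto[OF *(1,2)]]
  have "(\<lambda>w. swap i j (swap i j w)) \<in> hom F F" using s by (auto simp: hom_def)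
  then show ?thesis
  proof (rule hom_eqI[OF group_free_group _ id_hom *(3)])
    fix k assume "k < n"
    then show "swap i j (swap i j (gen k)) = gen k"
      using swap_gen[OF *(1,2), of "Transposition.transpose i j k"] swap_gen[OF *(1,2), of k] *
      by (auto simp: Transposition.transpose_def)
  qed
qed

end

section \<open>Generators of the automorphism group\<close>

text \<open>Free groups have no involutions: the outer letters of such a word are mutually inverse
  and can be stripped, until a letter equal to its own inverse or a cancelling pair would
  remain.\<close>

lemma winv_fixed_eq_Nil: "reduced m \<Longrightarrow> winv m = m \<Longrightarrow> m = []"
proof (induction "length m" arbitrary: m rule: less_induct)
  case less
  show ?case
  proof (rule ccontr)
    assume "m \<noteq> []"
    then obtain x m1 where m: "m = x # m1" by (cases m) auto
    have "m1 \<noteq> []" using less.prems(2) m by auto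
    then obtain m' y where m1: "m1 = m' @ [y]" by (metis rev_exhaust)
    have y: "y = letter_inv x" and w: "winv m' = m'" using less.prems(2) by (auto simp: m m1)
    have "reduced m'" using less.prems(1) by (auto simp: m m1 reduced_append_iff reduced_Cons_iff)
    then have "m' = []" using less.hyps[of m'] w by (simp add: m m1)
    then show False using less.prems(1) y by (simp add: m m1)
  qed
qed

text \<open>If more than half of \<open>y\<close> cancelled in its square, the cancelled suffix
  \<open>p\<close> and the prefix \<open>winv p\<close> would overlap in a nonempty self-inverse
  word.\<close>

lemma length_square_ge:
  assumes "reduced y"
  shows "length y \<le> length (reduce (y @ y))"
proof -
  obtain a p b where y: "y = a @ p" "y = winv p @ b" and r: "reduced (a @ b)"
    using reduced_cancellation[OF assms assms] .
  have e: "reduce (y @ y) = a @ b"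
  proof -
    have "y @ y = a @ p @ winv p @ b" using y by (metis append.assoc)
    then show ?thesis using reduce_winv_append[of a p b] r by (simp add: reduce_id)
  qed
  have "length y = length a + length p" "length y = length p + length b"
    using arg_cong[OF y(1), of length] arg_cong[OF y(2), of length] by simp_all
  then have l: "length a = length b" by simp
  show ?thesis
  proof (rule ccontr)
    assume "\<not> ?thesis"
    then have "length a < length p" using e l \<open>length y = length a + length p\<close> by simp
    have "winv p @ b = a @ p" using y by simp
    then obtain m where "winv p = a @ m \<and> m @ b = p \<or> winv p @ m = a \<and> b = m @ p"
      by (auto simp: append_eq_append_conv2)
    moreover have "winv p @ m \<noteq> a" for m
      using \<open>length a < length p\<close> by (metis length_append not_add_less1 winv_simps(5))
    ultimately have m: "winv p = a @ m" "p = m @ b" by auto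
    have "p = winv m @ winv a" using arg_cong[OF m(1), of winv] by simp
    then have "winv m @ winv a = m @ b" using m(2) by simp
    then have "winv m = m" by (simp add: append_eq_append_conv)
    moreover have "reduced m" using assms y(1) m(2) by (auto simp: reduced_append_iff)
    ultimately have "m = []" using winv_fixed_eq_Nil by blast
    then show False using m l \<open>length a < length p\<close> by simp
  qed
qed

section \<open>Cancellation lengths and the tie-breaking rank\<close>

definition canc :: "letter list \<Rightarrow> letter list \<Rightarrow> nat" where
  "canc u v = (length u + length v - length (reduce (u @ v))) div 2"

lemma canc_props:
  assumes "reduced u" "reduced v"
  shows "u = take (length u - canc u v) u @ winv (take (canc u v) v)"
    "reduce (u @ v) = take (length u - canc u v) u @ drop (canc u v) v"
    "canc u v \<le> length u" "canc u v \<le> length v"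
    "length (reduce (u @ v)) = length u + length v - 2 * canc u v"
proof -
  obtain a p b where y: "u = a @ p" "v = winv p @ b" and r: "reduced (a @ b)"
    using reduced_cancellation[OF assms] .
  have e: "reduce (u @ v) = a @ b"
    using reduce_winv_append[of a p b] y r by (simp add: reduce_id)
  then have c: "canc u v = length p" using y by (simp add: canc_def)
  show "u = take (length u - canc u v) u @ winv (take (canc u v) v)"
    "reduce (u @ v) = take (length u - canc u v) u @ drop (canc u v) v"
    "canc u v \<le> length u" "canc u v \<le> length v"
    "length (reduce (u @ v)) = length u + length v - 2 * canc u v"
    unfolding c using y e by simp_all
qed

text \<open>Words are read as numerals in base \<open>2 n\<close>, so that on words of equal length the code is an
  injective lexicographic rank.\<close>

definition letter_code :: "letter \<Rightarrow> nat" where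
  "letter_code a = 2 * fst a + (if snd a then 1 else 0)"

lemma letter_code_less: "fst a < n \<Longrightarrow> letter_code a < 2 * n"
  by (auto simp: letter_code_def)

lemma letter_code_inj: "letter_code a = letter_code b \<Longrightarrow> a = b"
  unfolding letter_code_def by (rule prod_eqI) (auto split: if_splits; presburger)+

definition word_code :: "nat \<Rightarrow> letter list \<Rightarrow> nat" where
  "word_code n w = foldl (\<lambda>c a. c * (2 * n) + letter_code a) 0 w"

lemma word_code_simps [simp]:
  "word_code n [] = 0" "word_code n (w @ [a]) = word_code n w * (2 * n) + letter_code a"
  by (simp_all add: word_code_def)

lemma word_code_append: "word_code n (p @ r) = word_code n p * (2 * n) ^ length r + word_code n r"
proof (induction r rule: rev_induct)
  case (snoc x r)
  have "word_code n (p @ r @ [x]) = word_code n ((p @ r) @ [x])" by simp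
  also have "\<dots> = word_code n p * (2 * n) ^ length (r @ [x]) + word_code n (r @ [x])"
    by (simp only: word_code_simps snoc.IH) (simp add: algebra_simps)
  finally show ?case .
qed simp

lemma word_code_inj:
  "length p = length q \<Longrightarrow> fst ` set p \<subseteq> {..<n} \<Longrightarrow> fst ` set q \<subseteq> {..<n} \<Longrightarrow>
    word_code n p = word_code n q \<Longrightarrow> p = q"
proof (induction p arbitrary: q rule: rev_induct)
  case (snoc x p)
  then obtain q' y where q: "q = q' @ [y]" by (metis append_is_Nil_conv length_0_conv list.discI rev_exhaust)
  have l: "letter_code x < 2 * n" "letter_code y < 2 * n"
    using snoc.prems q letter_code_less by auto
  have e: "word_code n p * (2 * n) + letter_code x = word_code n q' * (2 * n) + letter_code y"
    using snoc.prems(4) q by simp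
  have "letter_code x = letter_code y" using arg_cong[OF e, of "\<lambda>k. k mod (2 * n)"] l by simp
  moreover from this have "word_code n p = word_code n q'" using e l by simp
  ultimately show ?case using snoc q letter_code_inj by auto
qed simp

definition half :: "letter list \<Rightarrow> letter list" where
  "half w = take ((length w + 1) div 2) w"

text \<open>Counting the initial halves of a word and of its inverse makes the weight independent of
  orientation; it replaces Nielsen's well-ordering of pairs of half words.\<close>

definition weight :: "nat \<Rightarrow> letter list \<Rightarrow> nat" where
  "weight n w = word_code n (half w) + word_code n (half (winv w))"

lemma weight_winv [simp]: "weight n (winv w) = weight n w"
  by (simp add: weight_def)

text \<open>The replaced prefix is at most half of the word, so it lies inside the first half and
  outside the initial half of the inverse.\<close>

lemma weight_less:
  assumes "length p = length q" "2 * length q \<le> length (q @ c)" "word_code n p < word_code n q" "n > 0"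
  shows "weight n (p @ c) < weight n (q @ c)"
proof -
  define h where "h = (length (q @ c) + 1) div 2"
  have h: "length q \<le> h" "h \<le> length c" using assms(2) by (auto simp: h_def)
  have 1: "half (p @ c) = p @ take (h - length q) c" "half (q @ c) = q @ take (h - length q) c"
    using h assms(1) by (auto simp: half_def h_def)
  have 2: "half (winv (p @ c)) = take h (winv c)" "half (winv (q @ c)) = take h (winv c)"
    using h assms(1) by (auto simp: half_def h_def add.commute)
  show ?thesis unfolding weight_def 1 2 word_code_append using assms(3,4) by simp
qed

context free_group_rank
begin

definition total :: "(letter list \<Rightarrow> nat) \<Rightarrow> (letter list \<Rightarrow> letter list) \<Rightarrow> nat" where
  "total m \<phi> = (\<Sum>i<n. m (\<phi> (gen i)))"

text \<open>The weight breaks the ties in which exactly half of a word cancels on either side.\<close>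

definition nielsen_minimal :: "(letter list \<Rightarrow> letter list) \<Rightarrow> bool" where
  "nielsen_minimal \<phi> \<longleftrightarrow> \<phi> \<in> auto F \<and>
    (\<forall>i g h. i < n \<longrightarrow> avoids i g \<longrightarrow> avoids i h \<longrightarrow>
      (\<phi> \<odot> transv i g h, \<phi>) \<notin> measures [total length, total (weight n)])"

lemma aut_letter:
  assumes "\<phi> \<in> auto F" "fst a < n"
  shows "\<phi> [a] = (if snd a then \<phi> (gen (fst a)) else winv (\<phi> (gen (fst a))))"
  using hom_letter[OF group_free_group F.autoD(1)[OF assms(1)] assms(2)] assms
  by (simp add: letter_val_def inv_free_group F.autoD)

lemma aut_letter_inv:
  assumes "\<phi> \<in> auto F" "fst a < n"
  shows "\<phi> [letter_inv a] = winv (\<phi> [a])"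
  using aut_letter[OF assms] aut_letter[OF assms(1), of "letter_inv a"] assms(2) by simp

lemma aut_apply: "\<phi> \<in> auto F \<Longrightarrow> w \<in> carrier F \<Longrightarrow> \<phi> w \<in> carrier F"
  using F.autoD(4) .

lemma aut_inj: "\<phi> \<in> auto F \<Longrightarrow> u \<in> carrier F \<Longrightarrow> v \<in> carrier F \<Longrightarrow> \<phi> u = \<phi> v \<Longrightarrow> u = v"
  using F.autoD(2) by (meson bij_betw_imp_inj_on inj_onD)

lemma aut_eq_Nil: "\<phi> \<in> auto F \<Longrightarrow> u \<in> carrier F \<Longrightarrow> \<phi> u = [] \<Longrightarrow> u = []"
  using aut_inj[of \<phi> u "[]"] F.autoD(6)[of \<phi>] by (simp add: free_group_simps)

lemma aut_letter_ne: "\<phi> \<in> auto F \<Longrightarrow> fst a < n \<Longrightarrow> \<phi> [a] \<noteq> []"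
  using aut_eq_Nil[of \<phi> "[a]"] letter_closed by blast

lemma reduced_closed: "w \<in> carrier F \<Longrightarrow> reduced w"
  by (simp add: free_group_simps)

text \<open>For a positive letter the move is x_i to x_i b; for a negative one it is x_i to b^{-1}
  x_i, read on the inverse.\<close>

lemma elementary_step:
  assumes "\<phi> \<in> auto F" "fst a < n" "fst b < n" "fst b \<noteq> fst a"
  obtains g h where "avoids (fst a) g" "avoids (fst a) h"
    "(\<phi> \<odot> transv (fst a) g h) [a] = \<phi> [a] \<cdot> \<phi> [b]"
    "\<And>j. j < n \<Longrightarrow> j \<noteq> fst a \<Longrightarrow> (\<phi> \<odot> transv (fst a) g h) (gen j) = \<phi> (gen j)"
proof -
  define i where "i = fst a"
  have i: "i < n" using assms i_def by simp
  have b: "avoids i [b]" "avoids i [letter_inv b]" using assms by (auto simp: i_def avoids_letter)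
  note one = avoids_one(1)[of i]
  note D = F.autoD[OF assms(1)]
  have c: "[b] \<in> carrier F" "[letter_inv b] \<in> carrier F" using b avoidsD by auto
  have other: "(\<phi> \<odot> transv i g h) (gen j) = \<phi> (gen j)"
    if "avoids i g" "avoids i h" "j < n" "j \<noteq> i" for g h j
    using that assms(1) transv_auto[OF i that(1,2)] transv_gen_other[OF i that(1,2)]
    by (simp add: F.AutoGroup_mult)
  show thesis
  proof (cases "snd a")
    case True
    have [simp]: "[a] = gen i" using True by (simp add: gen_def i_def prod_eq_iff)
    have "[] \<cdot> gen i = gen i" using F.l_one[of "gen i"] i by (simp add: free_group_simps(3))
    then have "(\<phi> \<odot> transv i [] [b]) [a] = \<phi> (gen i \<cdot> [b])"
      using i assms(1) transv_auto[OF i one b(1)] transv_gen[OF i one b(1)] c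
      by (simp add: F.AutoGroup_mult)
    then show thesis using that[of "[]" "[b]"] one b(1) other i c D i_def by simp
  next
    case False
    have a: "[a] = inv\<^sub>F gen i" using False i
      by (simp add: gen_def i_def prod_eq_iff inv_free_group letter_closed letter_inv_def)
    let ?\<psi> = "\<phi> \<odot> transv i [letter_inv b] []"
    have \<psi>: "?\<psi> \<in> auto F" using assms(1) transv_auto[OF i b(2) one] by simp
    have "?\<psi> [a] = inv\<^sub>F ?\<psi> (gen i)" using F.autoD(7)[OF \<psi>] i a by simp
    also have "?\<psi> (gen i) = \<phi> ([letter_inv b] \<cdot> gen i)"
      using i assms(1) transv_auto[OF i b(2) one] transv_gen[OF i b(2) one] c
      using F.r_one[of "[letter_inv b] \<cdot> gen i"]
      by (simp add: F.AutoGroup_mult free_group_simps(3))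
    also have "inv\<^sub>F \<dots> = \<phi> [a] \<cdot> \<phi> [b]"
      using D c i a by (simp add: F.inv_mult_group flip: D(7))
        (simp add: inv_free_group)
    finally show thesis using that[of "[letter_inv b]" "[]"] one b(2) other i_def by simp
  qed
qed

text \<open>Only the summand of index \<open>fst a\<close> changes, so minimality of a sum becomes
  an inequality for one word. The measures must be invariant under inversion because
  \<open>a\<close> may be negative.\<close>

lemma nielsen_minimal_step:
  assumes "nielsen_minimal \<phi>" "fst a < n" "fst b < n" "fst b \<noteq> fst a"
  shows "length (\<phi> [a]) \<le> length (\<phi> [a] \<cdot> \<phi> [b])"
    "length (\<phi> [a]) = length (\<phi> [a] \<cdot> \<phi> [b]) \<Longrightarrow> weight n (\<phi> [a]) \<le> weight n (\<phi> [a] \<cdot> \<phi> [b])"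
proof -
  have \<phi>: "\<phi> \<in> auto F" using assms(1) by (simp add: nielsen_minimal_def)
  obtain g h where gh: "avoids (fst a) g" "avoids (fst a) h"
    and eq: "(\<phi> \<odot> transv (fst a) g h) [a] = \<phi> [a] \<cdot> \<phi> [b]"
    "\<And>j. j < n \<Longrightarrow> j \<noteq> fst a \<Longrightarrow> (\<phi> \<odot> transv (fst a) g h) (gen j) = \<phi> (gen j)"
    using elementary_step[OF \<phi> assms(2-4)] by blast
  let ?\<psi> = "\<phi> \<odot> transv (fst a) g h"
  have \<psi>: "?\<psi> \<in> auto F" using \<phi> transv_auto[OF assms(2) gh] by simp
  have tot: "total m ?\<psi> + m (\<phi> [a]) = total m \<phi> + m (\<phi> [a] \<cdot> \<phi> [b])"
    if "\<And>w. m (winv w) = m w" for m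
  proof -
    have s: "total m \<chi> = m (\<chi> (gen (fst a))) + (\<Sum>i\<in>{..<n} - {fst a}. m (\<chi> (gen i)))" for \<chi>
      unfolding total_def by (rule sum.remove) (use assms in auto)
    have "m (\<chi> (gen (fst a))) = m (\<chi> [a])" if "\<chi> \<in> auto F" for \<chi>
      using aut_letter[OF that assms(2)] \<open>\<And>w. m (winv w) = m w\<close> by simp
    moreover have "(\<Sum>i\<in>{..<n} - {fst a}. m (?\<psi> (gen i))) = (\<Sum>i\<in>{..<n} - {fst a}. m (\<phi> (gen i)))"
      using eq(2) by (intro sum.cong) auto
    ultimately show ?thesis using s[of \<phi>] s[of ?\<psi>] \<phi> \<psi> eq(1) by simp
  qed
  have nl: "(?\<psi>, \<phi>) \<notin> measures [total length, total (weight n)]"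
    using assms gh by (auto simp: nielsen_minimal_def)
  show "length (\<phi> [a]) \<le> length (\<phi> [a] \<cdot> \<phi> [b])"
    using nl tot[of length] by auto
  show "weight n (\<phi> [a]) \<le> weight n (\<phi> [a] \<cdot> \<phi> [b])" if "length (\<phi> [a]) = length (\<phi> [a] \<cdot> \<phi> [b])"
    using nl tot[of length] tot[of "weight n"] that by auto
qed

text \<open>The product is no shorter than either factor, and each cancellation costs two letters.
  The second factor is handled by the move on inverse letters; equal letters need the bound for
  squares, since no elementary move squares a generator.\<close>

lemma nielsen_canc_le:
  assumes "nielsen_minimal \<phi>" "fst a < n" "fst b < n" "b \<noteq> letter_inv a"
  shows "2 * canc (\<phi> [a]) (\<phi> [b]) \<le> length (\<phi> [a])" "2 * canc (\<phi> [a]) (\<phi> [b]) \<le> length (\<phi> [b])"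
proof -
  have \<phi>: "\<phi> \<in> auto F" using assms(1) by (simp add: nielsen_minimal_def)
  have c: "\<phi> [a] \<in> carrier F" "\<phi> [b] \<in> carrier F" using \<phi> assms aut_apply letter_closed by auto
  note r = c[THEN reduced_closed]
  have "length (\<phi> [a]) \<le> length (\<phi> [a] \<cdot> \<phi> [b]) \<and> length (\<phi> [b]) \<le> length (\<phi> [a] \<cdot> \<phi> [b])"
  proof (cases "fst a = fst b")
    case True
    then have "a = b" using assms(4) letter_cases by metis
    then show ?thesis using length_square_ge[OF r(1)] by (simp add: free_group_simps)
  next
    case False
    have "\<phi> [letter_inv b] \<cdot> \<phi> [letter_inv a] = winv (\<phi> [a] \<cdot> \<phi> [b])"
      using aut_letter_inv[OF \<phi>] assms c F.inv_mult_group[OF c] by (simp add: inv_free_group)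
    then show ?thesis
      using nielsen_minimal_step(1)[OF assms(1), of a b]
        nielsen_minimal_step(1)[OF assms(1), of "letter_inv b" "letter_inv a"]
        aut_letter_inv[OF \<phi>] assms False by (auto simp: aut_letter_inv)
  qed
  then show "2 * canc (\<phi> [a]) (\<phi> [b]) \<le> length (\<phi> [a])" "2 * canc (\<phi> [a]) (\<phi> [b]) \<le> length (\<phi> [b])"
    using canc_props(3,4,5)[OF r] by (auto simp: free_group_simps)
qed

text \<open>If nothing of the middle word survived, both half-length bounds would be attained and
  the middle word would be \<open>p\<close> times the inverse of \<open>q\<close> with halves of
  equal length. Multiplying a neighbour by it exchanges \<open>p\<close> and \<open>q\<close> at no
  cost in length, so one of the two exchanges would lower the weight.\<close>

lemma nielsen_canc_sum:
  assumes min: "nielsen_minimal \<phi>" and "fst a < n" "fst b < n" "fst c < n"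
    and ab: "b \<noteq> letter_inv a" and bc: "c \<noteq> letter_inv b"
  shows "canc (\<phi> [a]) (\<phi> [b]) + canc (\<phi> [b]) (\<phi> [c]) < length (\<phi> [b])"
proof (rule ccontr)
  assume neg: "\<not> ?thesis"
  have \<phi>: "\<phi> \<in> auto F" using min by (simp add: nielsen_minimal_def)
  have cl: "\<phi> [a] \<in> carrier F" "\<phi> [b] \<in> carrier F" "\<phi> [c] \<in> carrier F"
    using \<phi> assms aut_apply letter_closed by auto
  note r = cl[THEN reduced_closed]
  define k where "k = canc (\<phi> [a]) (\<phi> [b])"
  note le = nielsen_canc_le[OF min assms(2,3) ab] nielsen_canc_le[OF min assms(3,4) bc]
  have k: "canc (\<phi> [b]) (\<phi> [c]) = k" "length (\<phi> [b]) = 2 * k"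
    using neg le by (auto simp: k_def)
  define p where "p = take k (\<phi> [b])"
  define q where "q = take k (\<phi> [c])"
  define x where "x = take (length (\<phi> [a]) - k) (\<phi> [a])"
  define z where "z = drop k (\<phi> [c])"
  have kc: "2 * k \<le> length (\<phi> [c])" "2 * k \<le> length (\<phi> [a])" using le k k_def by auto
  have lp: "length p = k" "length q = k" using k kc by (auto simp: p_def q_def)
  have a: "\<phi> [a] = x @ winv p" "\<phi> [a] \<cdot> \<phi> [b] = x @ drop k (\<phi> [b])"
    using canc_props[OF r(1,2)] by (auto simp: p_def x_def k_def free_group_simps)
  have b: "\<phi> [b] = p @ winv q" "\<phi> [b] \<cdot> \<phi> [c] = p @ z"
    using canc_props[OF r(2,3)] k by (auto simp: p_def q_def z_def free_group_simps)
  have b': "drop k (\<phi> [b]) = winv q" using b lp by simp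
  have c: "\<phi> [c] = q @ z" by (simp add: q_def z_def)
  have "p \<noteq> q"
  proof
    assume "p = q"
    moreover have "p \<noteq> []" using aut_letter_ne[OF \<phi> assms(3)] k lp by auto
    ultimately show False using r(2) b(1) by (auto simp: reduced_append_iff hd_winv)
  qed
  have pq: "fst ` set p \<subseteq> {..<n}" "fst ` set q \<subseteq> {..<n}"
    using cl by (auto simp: p_def q_def free_group_simps dest!: in_set_takeD)
  have n: "n > 0" using assms by auto
  \<comment> \<open>If \<open>p\<close> is smaller, the prefix \<open>q\<close> of the right
    neighbour is replaced; if \<open>q\<close> is smaller, the tail \<open>winv p\<close> of the
    left one.\<close>
  consider "word_code n p < word_code n q" | "word_code n q < word_code n p"
    using word_code_inj[OF _ pq] lp \<open>p \<noteq> q\<close> by force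
  then show False
  proof cases
    case 1
    have "fst b \<noteq> fst c"
    proof
      assume "fst b = fst c"
      then have "c = b" using bc letter_cases by metis
      then show False using b(1) c lp \<open>p \<noteq> q\<close> by simp
    qed
    \<comment> \<open>The move is read on inverse letters, because elementary steps multiply on the
      right.\<close>
    have e: "\<phi> [letter_inv c] \<cdot> \<phi> [letter_inv b] = winv (p @ z)"
    proof -
      have "winv (p @ z) = inv\<^sub>F (\<phi> [b] \<cdot> \<phi> [c])"
        using inv_free_group[OF F.m_closed[OF cl(2,3)]] b(2) by simp
      then show ?thesis
        using aut_letter_inv[OF \<phi>] assms cl F.inv_mult_group[OF cl(2,3)] inv_free_group by simp
    qed
    have "weight n (q @ z) \<le> weight n (p @ z)"
      using nielsen_minimal_step(2)[OF min, of "letter_inv c" "letter_inv b"] \<open>fst b \<noteq> fst c\<close> assms e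
        aut_letter_inv[OF \<phi>, of c] c lp weight_winv
      by (metis length_append letter_inv_simps(4) winv_simps(5))
    then show False using weight_less[of p q z n] 1 lp kc c n by simp
  next
    case 2
    have "fst a \<noteq> fst b"
    proof
      assume "fst a = fst b"
      then have "a = b" using ab letter_cases by metis
      then have "x @ winv p = p @ winv q" using a(1) b(1) by simp
      then show False using lp \<open>p \<noteq> q\<close> by (metis append_eq_append_conv winv_simps(4,5))
    qed
    then have "weight n (x @ winv p) \<le> weight n (x @ winv q)"
      using nielsen_minimal_step(2)[OF min assms(2,3)] a b' lp by simp
    then have "weight n (p @ winv x) \<le> weight n (q @ winv x)"
      by (metis weight_winv winv_simps(3,4))
    then show False using weight_less[of q p "winv x" n] 2 lp kc n a(1) by simp
  qed
qed

text \<open>Every letter of \<open>v\<close> contributes at least one surviving letter, since the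
  cancellations on its two sides together do not exhaust its image.\<close>

lemma nielsen_minimal_length:
  assumes min: "nielsen_minimal \<phi>" and "v \<in> carrier F"
  shows "length v \<le> length (\<phi> v)"
proof -
  have \<phi>: "\<phi> \<in> auto F" using min by (simp add: nielsen_minimal_def)
  define k where "k v b = (if v = [] then 0 else canc (\<phi> [last v]) (\<phi> [b]))" for v b
  \<comment> \<open>\<open>k v b\<close> counts what the image of \<open>b\<close> has lost on its
    left. The rest of that image is kept apart from the secured part \<open>P\<close>, because its
    end may still cancel.\<close>
  have main: "\<exists>P. \<phi> (v @ [b]) = P @ drop (k v b) (\<phi> [b]) \<and> length v \<le> length P"
    if "v @ [b] \<in> carrier F" for v b
    using that
  proof (induction v arbitrary: b rule: rev_induct)
    case Nil
    then show ?case by (auto simp: k_def)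
  next
    case (snoc b v c)
    have cl: "v @ [b] \<in> carrier F" and vbc: "(v @ [b]) @ [c] \<in> carrier F"
      using snoc.prems append_closed by blast+
    have idx: "fst b < n" "fst c < n" and bc: "c \<noteq> letter_inv b"
      using vbc by (auto simp: free_group_simps reduced_append_iff)
    have cl': "\<phi> [b] \<in> carrier F" "\<phi> [c] \<in> carrier F" using \<phi> idx aut_apply letter_closed by auto
    note r = cl'[THEN reduced_closed]
    obtain P where P: "\<phi> (v @ [b]) = P @ drop (k v b) (\<phi> [b])" "length v \<le> length P"
      using snoc.IH[OF cl] by blast
    define m where "m = canc (\<phi> [b]) (\<phi> [c])"
    have "k v b + m < length (\<phi> [b])"
    proof (cases "v = []")
      case True
      then show ?thesis
        using nielsen_canc_le(1)[OF min idx bc] aut_letter_ne[OF \<phi> idx(1)]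
        by (cases m) (auto simp: k_def m_def)
    next
      case False
      then have "last v \<in> set v" by simp
      then have "fst (last v) < n" "b \<noteq> letter_inv (last v)"
        using cl False by (auto simp: free_group_simps reduced_append_iff simp del: last_in_set)
      then show ?thesis using nielsen_canc_sum[OF min _ idx _ bc] False by (simp add: k_def m_def)
    qed
    \<comment> \<open>The middle of the image of \<open>b\<close>, untouched from both sides; being
      nonempty it separates the two cancellations and keeps the concatenation reduced.\<close>
    define M where "M = drop (k v b) (take (length (\<phi> [b]) - m) (\<phi> [b]))"
    have M: "M \<noteq> []" using \<open>k v b + m < length (\<phi> [b])\<close> by (simp add: M_def)
    have b: "drop (k v b) (\<phi> [b]) = M @ winv (take m (\<phi> [c]))"
    proof -
      have "\<phi> [b] = take (length (\<phi> [b]) - m) (\<phi> [b]) @ winv (take m (\<phi> [c]))"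
        using canc_props(1)[OF r] by (simp add: m_def)
      then have "drop (k v b) (\<phi> [b]) =
          drop (k v b) (take (length (\<phi> [b]) - m) (\<phi> [b]) @ winv (take m (\<phi> [c])))" by simp
      then show ?thesis using \<open>k v b + m < length (\<phi> [b])\<close> by (simp add: M_def)
    qed
    have bcm: "reduce (\<phi> [b] @ \<phi> [c]) = take (length (\<phi> [b]) - m) (\<phi> [b]) @ drop m (\<phi> [c])"
      using canc_props(2)[OF r] by (simp add: m_def)
    have "take (length (\<phi> [b]) - m) (\<phi> [b]) = take (k v b) (\<phi> [b]) @ M"
      using \<open>k v b + m < length (\<phi> [b])\<close> unfolding M_def
      by (metis append_take_drop_id less_diff_conv min.absorb1 order_less_imp_le take_take)
    then have "reduced (take (k v b) (\<phi> [b]) @ (M @ drop m (\<phi> [c])))"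
      using bcm by (metis append.assoc reduced_reduce)
    then have r1: "reduced (M @ drop m (\<phi> [c]))" by (simp only: reduced_append_iff)
    have "reduced ((P @ M) @ winv (take m (\<phi> [c])))"
      using P(1) b reduced_closed[OF aut_apply[OF \<phi> cl]] by simp
    then have r2: "reduced (P @ M)" by (simp only: reduced_append_iff)
    have r3: "reduced (P @ M @ drop m (\<phi> [c]))"
      using r1 r2 M by (auto simp: reduced_append_iff)
    have "\<phi> (v @ [b] @ [c]) = \<phi> (v @ [b]) \<cdot> \<phi> [c]"
      using append_eq_mult[OF vbc] append_closed[OF vbc] F.autoD(5)[OF \<phi>] by simp
    also have "\<dots> = reduce ((P @ M) @ winv (take m (\<phi> [c])) @ take m (\<phi> [c]) @ drop m (\<phi> [c]))"
      by (simp add: P(1) b free_group_simps)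
    also have "\<dots> = P @ M @ drop m (\<phi> [c])"
      using reduce_winv_append[of "P @ M" "winv (take m (\<phi> [c]))" "drop m (\<phi> [c])"] r3
      by (simp add: reduce_id)
    finally have "\<phi> ((v @ [b]) @ [c]) = (P @ M) @ drop (k (v @ [b]) c) (\<phi> [c])"
      by (simp add: k_def m_def)
    moreover have "length (v @ [b]) \<le> length (P @ M)" using P(2) M by (cases M) auto
    ultimately show ?case by blast
  qed
  show ?thesis
  proof (cases v rule: rev_exhaust)
    case (snoc u b)
    obtain P where P: "\<phi> v = P @ drop (k u b) (\<phi> [b])" "length u \<le> length P"
      using main[of u b] assms(2) snoc by blast
    have b: "fst b < n" using assms(2) snoc by (auto simp: free_group_simps)
    have "k u b < length (\<phi> [b])"
    proof (cases "u = []")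
      case True
      then show ?thesis using aut_letter_ne[OF \<phi> b] by (simp add: k_def)
    next
      case False
      then have "last u \<in> set u" by simp
      then have "fst (last u) < n" "b \<noteq> letter_inv (last u)"
        using assms(2) snoc False by (auto simp: free_group_simps reduced_append_iff simp del: last_in_set)
      then have "2 * k u b \<le> length (\<phi> [b])"
        using nielsen_canc_le(2)[OF min _ b] False by (simp add: k_def)
      then show ?thesis using aut_letter_ne[OF \<phi> b] by (cases "\<phi> [b]") auto
    qed
    then show ?thesis using P snoc by simp
  qed simp
qed

text \<open>Induction on the number of moved basis elements: precomposing with a flip and a swap
  brings the letter mapped to \<open>x_i\<close> to position \<open>i\<close> and disturbs only an
  element that was moved already.\<close>

lemma signed_permutation_in_subgroup:
  assumes L: "subgroup L A" and flip: "\<And>i. i < n \<Longrightarrow> flip i \<in> L"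
    and swap: "\<And>i j. i < n \<Longrightarrow> j < n \<Longrightarrow> swap i j \<in> L"
    and "\<psi> \<in> auto F" "\<And>i. i < n \<Longrightarrow> \<exists>a. fst a < n \<and> \<psi> [a] = gen i"
  shows "\<psi> \<in> L"
  using assms(4,5)
proof (induction "card {i. i < n \<and> \<psi> (gen i) \<noteq> gen i}" arbitrary: \<psi> rule: less_induct)
  case less
  interpret L: subgroup L A by fact
  show ?case
  proof (cases "\<exists>i<n. \<psi> (gen i) \<noteq> gen i")
    case False
    then have "\<psi> = \<one>\<^bsub>A\<^esub>"
      using less.prems(1) A.one_closed by (intro aut_eqI) (auto simp: F.AutoGroup_one)
    then show ?thesis by simp
  next
    case True
    then obtain i where i: "i < n" "\<psi> (gen i) \<noteq> gen i" by blast
    obtain a where a: "fst a < n" "\<psi> [a] = gen i" using less.prems(2) i by blast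
    define j where "j = fst a"
    have j: "j < n" using a j_def by simp
    define f where "f = (if snd a then \<one>\<^bsub>A\<^esub> else flip j)"
    have f: "f \<in> L" "f \<in> auto F" using flip flip_auto j A.one_closed by (auto simp: f_def)
    have fa: "f (gen j) = [a]" and fo: "\<And>k. k < n \<Longrightarrow> k \<noteq> j \<Longrightarrow> f (gen k) = gen k"
      using flip_gen[OF j] inv_free_group[OF gen_closed[OF j]] F.AutoGroup_one[OF gen_closed] j
      by (cases a, auto simp: f_def j_def gen_def letter_inv_def)+
    define \<chi> where "\<chi> = \<psi> \<odot> (f \<odot> swap i j)"
    have s: "f \<odot> swap i j \<in> L" "f \<odot> swap i j \<in> auto F"
      using f swap i j swap_auto by auto
    have \<chi>: "\<chi> \<in> auto F" using less.prems(1) s by (simp add: \<chi>_def)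
    have \<chi>w: "\<chi> w = \<psi> (f (swap i j w))" if "w \<in> carrier F" for w
      using that s f less.prems(1) swap_auto[OF i(1) j] F.autoD(4)
      by (simp add: \<chi>_def F.AutoGroup_mult)
    have \<chi>gen: "\<chi> (gen k) = \<psi> (f (gen (Transposition.transpose i j k)))" if "k < n" for k
      using \<chi>w that swap_gen[OF i(1) j] by simp
    have 1: "\<chi> (gen i) = gen i" using \<chi>gen[OF i(1)] fa a by simp
    have 2: "\<chi> (gen k) = \<psi> (gen k)" if "k < n" "k \<noteq> i" "k \<noteq> j" for k
      using \<chi>gen[OF that(1)] fo that by simp
    have 3: "\<psi> (gen j) \<noteq> gen j" if "j \<noteq> i"
    proof
      assume e: "\<psi> (gen j) = gen j"
      have "\<psi> [a] = (if snd a then gen j else winv (gen j))"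
        using aut_letter[OF less.prems(1) a(1)] e by (simp add: j_def)
      then show False using a(2) that by (auto simp: gen_def letter_inv_def split: if_splits)
    qed
    have "{k. k < n \<and> \<chi> (gen k) \<noteq> gen k} \<subset> {k. k < n \<and> \<psi> (gen k) \<noteq> gen k}"
    proof
      show "{k. k < n \<and> \<chi> (gen k) \<noteq> gen k} \<subseteq> {k. k < n \<and> \<psi> (gen k) \<noteq> gen k}"
        using 1 2 3 by auto metis
      show "{k. k < n \<and> \<chi> (gen k) \<noteq> gen k} \<noteq> {k. k < n \<and> \<psi> (gen k) \<noteq> gen k}"
        using 1 i by blast
    qed
    then have lt: "card {k. k < n \<and> \<chi> (gen k) \<noteq> gen k} < card {k. k < n \<and> \<psi> (gen k) \<noteq> gen k}"
      by (intro psubset_card_mono) auto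
    have "\<exists>b. fst b < n \<and> \<chi> [b] = gen k" if k: "k < n" for k
    proof -
      obtain b where b: "fst b < n" "\<psi> [b] = gen k" using less.prems(2) k by blast
      have "\<exists>d. fst d < n \<and> f (swap i j [d]) = [b]"
      proof -
        define d0 where "d0 = (if fst b = j \<and> \<not> snd a then letter_inv b else b)"
        define d where "d = (Transposition.transpose i j (fst d0), snd d0)"
        have d: "fst d < n" "fst d0 < n" using b i j by (auto simp: d_def d0_def Transposition.transpose_def)
        have sd: "swap i j [d] = [d0]"
          using aut_letter[OF swap_auto[OF i(1) j] d(1)] swap_gen[OF i(1) j d(1)]
          by (cases "snd d0") (auto simp: d_def gen_def letter_inv_def prod_eq_iff)
        have "f [d0] = [b]"
          using aut_letter[OF f(2) d(2)] fa fo[of "fst d0"] d(2) b j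
          by (cases b; cases a) (auto simp: d0_def f_def j_def gen_def letter_inv_def)
        then show ?thesis using sd d by (intro exI[of _ d]) simp
      qed
      then obtain d where "fst d < n" "f (swap i j [d]) = [b]" by blast
      then show ?thesis using \<chi>w[of "[d]"] b letter_closed[of d] by (intro exI[of _ d]) simp
    qed
    then have "\<chi> \<in> L" using less.hyps[OF lt \<chi>] by blast
    moreover have "\<psi> = \<chi> \<odot> inv\<^sub>A (f \<odot> swap i j)"
      using less.prems(1) s unfolding \<chi>_def by (subst A.m_assoc) auto
    ultimately show ?thesis using s(1) by simp
  qed
qed

text \<open>In the coset of an automorphism modulo \<open>L\<close>, take an element minimal for
  total length, then for total weight. It never shortens a word, so the preimage of each basis
  element is a single letter and the element is a signed permutation.\<close>

theorem nielsen_generators: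
  assumes L: "subgroup L A" and flip: "\<And>i. i < n \<Longrightarrow> flip i \<in> L"
    and swap: "\<And>i j. i < n \<Longrightarrow> j < n \<Longrightarrow> swap i j \<in> L"
    and transv: "\<And>i g h. i < n \<Longrightarrow> avoids i g \<Longrightarrow> avoids i h \<Longrightarrow> transv i g h \<in> L"
  shows "L = auto F"
proof
  interpret L: subgroup L A by fact
  show "L \<subseteq> auto F" using L.subset by simp
  show "auto F \<subseteq> L"
  proof
    fix \<phi>0 assume \<phi>0: "\<phi>0 \<in> auto F"
    let ?Q = "{\<phi>0 \<odot> t | t. t \<in> L}"
    have Q: "\<phi>0 \<odot> \<one>\<^bsub>A\<^esub> \<in> ?Q" using L.one_closed by blast
    obtain \<phi> where "\<phi> \<in> ?Q"
      and min: "\<And>y. (y, \<phi>) \<in> measures [total length, total (weight n)] \<Longrightarrow> y \<notin> ?Q"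
      by (rule wfE_min[OF wf_measures[of "[total length, total (weight n)]"] Q]) blast
    then obtain t where t: "\<phi> = \<phi>0 \<odot> t" "t \<in> L" by blast
    have ta: "t \<in> auto F" using t L.subset by auto
    have \<phi>: "\<phi> \<in> auto F" using t \<phi>0 ta by simp
    have "nielsen_minimal \<phi>" unfolding nielsen_minimal_def
    proof (intro conjI allI impI \<phi> notI)
      fix i g h assume *: "i < n" "avoids i g" "avoids i h"
        and less: "(\<phi> \<odot> transv i g h, \<phi>) \<in> measures [total length, total (weight n)]"
      have "\<phi> \<odot> transv i g h = \<phi>0 \<odot> (t \<odot> transv i g h)"
        unfolding t using \<phi>0 ta transv_auto[OF *] by (intro A.m_assoc) auto
      then show False using min[OF less] t(2) transv[OF *] by auto
    qed
    have sp: "\<exists>a. fst a < n \<and> \<phi> [a] = gen i" if i: "i < n" for i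
    proof -
      obtain v where v: "v \<in> carrier F" "\<phi> v = gen i"
        using F.autoD(2)[OF \<phi>] gen_closed[OF i] by (metis bij_betw_imp_surj_on imageE)
      have "length v \<le> 1" using nielsen_minimal_length[OF \<open>nielsen_minimal \<phi>\<close> v(1)] v(2)
        by (simp add: gen_def)
      moreover have "v \<noteq> []" using v(2) F.autoD(6)[OF \<phi>] by (auto simp: free_group_simps gen_def)
      ultimately obtain a where "v = [a]" by (cases v) auto
      then show ?thesis using v by (intro exI[of _ a] conjI) (auto simp: free_group_simps)
    qed
    have "\<phi> \<in> L" using signed_permutation_in_subgroup[OF L flip swap \<phi> sp] by blast
    moreover have "\<phi>0 = \<phi> \<odot> inv\<^sub>A t" unfolding t using \<phi>0 ta by (subst A.m_assoc) auto
    ultimately show "\<phi>0 \<in> L" using t(2) by simp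
  qed
qed

end

section \<open>Stabilisers of normal subgroups of free groups\<close>

lemma finite_image_factor:
  assumes "finite (g ` S)" "\<And>x y. x \<in> S \<Longrightarrow> y \<in> S \<Longrightarrow> g x = g y \<Longrightarrow> f x = f y"
  shows "finite (f ` S)"
proof -
  have "f ` S \<subseteq> (\<lambda>v. f (SOME x. x \<in> S \<and> g x = v)) ` g ` S"
  proof
    fix y assume "y \<in> f ` S"
    then obtain x where x: "x \<in> S" "y = f x" by blast
    define x' where "x' = (SOME z. z \<in> S \<and> g z = g x)"
    have "x' \<in> S \<and> g x' = g x" unfolding x'_def by (rule someI[of _ x]) (use x in auto)
    then have "y = f x'" using assms(2) x by metis
    then show "y \<in> (\<lambda>v. f (SOME x. x \<in> S \<and> g x = v)) ` g ` S" using x by (auto simp: x'_def)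
  qed
  then show ?thesis using assms(1) finite_surj by blast
qed

lemma (in group) inv_mult_cancel:
  "x \<in> carrier G \<Longrightarrow> y \<in> carrier G \<Longrightarrow> inv x \<otimes> (x \<otimes> y) = y"
  "x \<in> carrier G \<Longrightarrow> y \<in> carrier G \<Longrightarrow> x \<otimes> (inv x \<otimes> y) = y"
  by (simp_all flip: m_assoc)

context free_group_rank
begin

text \<open>An equivalence instead of an inclusion, so that closure under inverses needs no
  finiteness.\<close>

definition stab :: "letter list set \<Rightarrow> (letter list \<Rightarrow> letter list) set" where
  "stab K = {\<psi> \<in> auto F. \<forall>w \<in> carrier F. \<psi> w \<in> K \<longleftrightarrow> w \<in> K}"

lemma aut_mult_apply:
  "\<psi> \<in> auto F \<Longrightarrow> \<chi> \<in> auto F \<Longrightarrow> w \<in> carrier F \<Longrightarrow> (\<psi> \<odot> \<chi>) w = \<psi> (\<chi> w)"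
  by (rule F.AutoGroup_mult)

lemma stab_subgroup: "subgroup (stab K) A"
proof (rule A.subgroupI)
  show "stab K \<subseteq> carrier A" by (auto simp: stab_def)
  show "stab K \<noteq> {}" using A.one_closed by (auto simp: stab_def F.AutoGroup_one)
  fix \<psi> assume \<psi>: "\<psi> \<in> stab K"
  then have a: "\<psi> \<in> auto F" by (simp add: stab_def)
  have "(inv\<^sub>A \<psi>) w \<in> K \<longleftrightarrow> w \<in> K" if "w \<in> carrier F" for w
  proof -
    have "(inv\<^sub>A \<psi>) w \<in> carrier F" using aut_apply[OF aut_closed(2)[OF a] that] .
    then have "\<psi> ((inv\<^sub>A \<psi>) w) \<in> K \<longleftrightarrow> (inv\<^sub>A \<psi>) w \<in> K" using \<psi> unfolding stab_def by blast
    then show ?thesis using F.AutoGroup_inv(1)[OF a that] by simp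
  qed
  then show "inv\<^sub>A \<psi> \<in> stab K" using a by (simp add: stab_def)
  fix \<chi> assume "\<chi> \<in> stab K"
  then have \<chi>: "\<chi> \<in> auto F" "\<And>w. w \<in> carrier F \<Longrightarrow> \<chi> w \<in> K \<longleftrightarrow> w \<in> K" by (auto simp: stab_def)
  have "\<psi> (\<chi> w) \<in> K \<longleftrightarrow> w \<in> K" if "w \<in> carrier F" for w
    using \<psi> \<chi>(2)[OF that] aut_apply[OF \<chi>(1) that] by (simp add: stab_def)
  then show "\<psi> \<odot> \<chi> \<in> stab K" using a \<chi>(1) by (simp add: stab_def aut_mult_apply)
qed

lemma inner_auto_stab:
  assumes "K \<lhd> F"
  shows "inner_auto F \<inter> auto F \<subseteq> stab K"
proof
  fix \<psi> assume \<psi>: "\<psi> \<in> inner_auto F \<inter> auto F"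
  then obtain g where g: "g \<in> carrier F" "\<psi> = (\<lambda>x\<in>carrier F. g \<cdot> x \<cdot> inv\<^sub>F g)"
    by (auto simp: inner_auto_def)
  interpret K: normal K F by fact
  have "x \<in> K" if "x \<in> carrier F" "g \<cdot> x \<cdot> inv\<^sub>F g \<in> K" for x
    using K.inv_op_closed1[OF g(1) that(2)] g(1) that(1) by (simp add: F.m_assoc F.inv_mult_cancel)
  then have conj: "g \<cdot> x \<cdot> inv\<^sub>F g \<in> K \<longleftrightarrow> x \<in> K" if "x \<in> carrier F" for x
    using K.inv_op_closed2[OF g(1), of x] that by blast
  have "\<psi> x \<in> K \<longleftrightarrow> x \<in> K" if "x \<in> carrier F" for x
    using conj[OF that] that by (simp add: g(2))
  then show "\<psi> \<in> stab K" using \<psi> unfolding stab_def by blast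
qed

text \<open>The coset of an automorphism is determined by the residues modulo \<open>K\<close> of
  the images of the basis, and there are finitely many such tuples.\<close>

lemma stab_finite_index:
  assumes "K \<lhd> F" "finite (rcosets\<^bsub>F\<^esub> K)"
  shows "finite (rcosets\<^bsub>A\<^esub> (stab K))"
proof -
  interpret K: normal K F by fact
  define r where "r w = K #>\<^bsub>F\<^esub> w" for w
  have r: "r \<in> hom F (F Mod K)" using K.r_coset_hom_Mod by (simp add: r_def[abs_def])
  have rK: "w \<in> K \<longleftrightarrow> r w = K" if "w \<in> carrier F" for w
    using F.coset_join1[OF _ that K.subgroup_axioms] F.coset_join2[OF that K.subgroup_axioms]
    by (auto simp: r_def)
  have eq: "stab K #>\<^bsub>A\<^esub> \<psi> = stab K #>\<^bsub>A\<^esub> \<chi>"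
    if *: "\<psi> \<in> auto F" "\<chi> \<in> auto F" "\<And>i. i < n \<Longrightarrow> r (\<psi> (gen i)) = r (\<chi> (gen i))" for \<psi> \<chi>
  proof -
    have "r (\<psi> w) = r (\<chi> w)" if "w \<in> carrier F" for w
    proof -
      have "(r \<circ> \<psi>) w = (r \<circ> \<chi>) w"
        by (rule hom_eqI[OF K.factorgroup_is_group hom_compose[OF F.autoD(1)[OF *(1)] r]
              hom_compose[OF F.autoD(1)[OF *(2)] r] that]) (simp add: *(3))
      then show ?thesis by simp
    qed
    then have "\<psi> \<odot> inv\<^sub>A \<chi> \<in> stab K"
    proof -
      assume r: "\<And>w. w \<in> carrier F \<Longrightarrow> r (\<psi> w) = r (\<chi> w)"
      have "\<psi> ((inv\<^sub>A \<chi>) w) \<in> K \<longleftrightarrow> w \<in> K" if w: "w \<in> carrier F" for w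
      proof -
        have c: "(inv\<^sub>A \<chi>) w \<in> carrier F" using aut_apply[OF aut_closed(2)[OF *(2)] w] .
        then have "r (\<psi> ((inv\<^sub>A \<chi>) w)) = r w" using r F.AutoGroup_inv(1)[OF *(2) w] by simp
        then show ?thesis using rK[OF w] rK[OF aut_apply[OF *(1) c]] by simp
      qed
      then show ?thesis using * by (simp add: stab_def aut_mult_apply)
    qed
    moreover have "\<psi> = (\<psi> \<odot> inv\<^sub>A \<chi>) \<odot> \<chi>" using * by (simp add: A.m_assoc)
    ultimately have "\<psi> \<in> stab K #>\<^bsub>A\<^esub> \<chi>" by (auto simp: r_coset_def)
    then show ?thesis using A.repr_independence[OF _ _ stab_subgroup] *(2) by simp
  qed
  have "finite ((\<lambda>\<psi>. stab K #>\<^bsub>A\<^esub> \<psi>) ` auto F)"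
  proof (rule finite_image_factor[where g = "\<lambda>\<psi>. \<lambda>i\<in>{..<n}. r (\<psi> (gen i))"])
    have "(\<lambda>\<psi>. \<lambda>i\<in>{..<n}. r (\<psi> (gen i))) ` auto F \<subseteq> {..<n} \<rightarrow>\<^sub>E rcosets\<^bsub>F\<^esub> K"
      by (auto simp: r_def F.autoD(4) intro!: F.rcosetsI K.subset)
    then show "finite ((\<lambda>\<psi>. \<lambda>i\<in>{..<n}. r (\<psi> (gen i))) ` auto F)"
      by (rule finite_subset) (intro finite_PiE, use assms(2) in auto)
    fix \<psi> \<chi> assume *: "\<psi> \<in> auto F" "\<chi> \<in> auto F"
      "(\<lambda>i\<in>{..<n}. r (\<psi> (gen i))) = (\<lambda>i\<in>{..<n}. r (\<chi> (gen i)))"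
    have "r (\<psi> (gen i)) = r (\<chi> (gen i))" if "i < n" for i
      using fun_cong[OF *(3), of i] that by simp
    then show "stab K #>\<^bsub>A\<^esub> \<psi> = stab K #>\<^bsub>A\<^esub> \<chi>" using eq * by blast
  qed
  moreover have "rcosets\<^bsub>A\<^esub> (stab K) = (\<lambda>\<psi>. stab K #>\<^bsub>A\<^esub> \<psi>) ` auto F" by (auto simp: RCOSETS_def)
  ultimately show ?thesis by simp
qed

lemma avoids_word_val:
  "(\<And>i. i \<in> fst ` set w \<Longrightarrow> avoids l (f i)) \<Longrightarrow> avoids l (word_val F f w)"
  by (induction w) (auto simp: letter_val_def intro!: avoids_mult avoids_inv)

text \<open>Swaps involving \<open>l\<close> are built from three transvections and a flip. They
  generate all swaps, and conjugation by them carries transvections and flips at \<open>l\<close> to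
  every index.\<close>

lemma subgroup_generated_by_transvections:
  assumes L: "subgroup L A" and l: "l < n"
    and T: "\<And>g h. avoids l g \<Longrightarrow> avoids l h \<Longrightarrow> transv l g h \<in> L"
    and E: "\<And>i. i < n \<Longrightarrow> i \<noteq> l \<Longrightarrow> transv i [] (inv\<^sub>F (gen l)) \<in> L"
    and flip_l: "flip l \<in> L"
  shows "L = auto F"
proof -
  interpret L: subgroup L A by fact
  have LA: "\<psi> \<in> auto F" if "\<psi> \<in> L" for \<psi> using that L.subset by auto
  have swap_l: "swap i l \<in> L" if i: "i < n" "i \<noteq> l" for i
  proof -
    have av: "avoids l (gen i)" "avoids i (inv\<^sub>F (gen l))" "avoids l []" "avoids i []"
      using i l by (auto intro: avoids_gen avoids_inv)
    note t = transv_auto[OF l av(3) av(1)] transv_auto[OF i(1) av(4) av(2)] transv_auto[OF l av(1) av(3)]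
    note f = flip_auto[OF l]
    have one: "[] \<cdot> w = w" "w \<cdot> [] = w" if "w \<in> carrier F" for w
      using that F.l_one F.r_one by (auto simp: free_group_simps(3))
    \<comment> \<open>Read from right to left, the three transvections send x_l to x_i and x_i to
      the inverse of x_l; the flip corrects the sign.\<close>
    have "flip l \<odot> (transv l [] (gen i) \<odot> (transv i [] (inv\<^sub>F (gen l)) \<odot> transv l (gen i) [])) = swap i l"
      (is "?lhs = _")
    proof (rule aut_eqI)
      show "?lhs \<in> auto F" using t f by simp
      show "swap i l \<in> auto F" using i l swap_auto by simp
      fix k assume k: "k < n"
      have e: "?lhs (gen k) = flip l (transv l [] (gen i) (transv i [] (inv\<^sub>F (gen l)) (transv l (gen i) [] (gen k))))"
        using t f k aut_apply by (simp add: aut_mult_apply)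
      note D = F.autoD(4,5,7)[OF t(1)] F.autoD(4,5,7)[OF t(2)] F.autoD(4,5,7)[OF t(3)] F.autoD(4,5,7)[OF f]
      note G = transv_gen[OF l av(3) av(1)] transv_gen[OF i(1) av(4) av(2)] transv_gen[OF l av(1) av(3)]
        transv_gen_other[OF l av(3) av(1)] transv_gen_other[OF i(1) av(4) av(2)]
        transv_gen_other[OF l av(1) av(3)] flip_gen[OF l]
      show "?lhs (gen k) = swap i l (gen k)"
        unfolding e swap_gen[OF i(1) l k]
        using i l k by (cases "k = l"; cases "k = i")
          (simp_all add: D G one F.m_assoc F.inv_mult_group F.inv_mult_cancel Transposition.transpose_def)
    qed
    moreover have "?lhs \<in> L"
      using flip_l T[OF av(3,1)] E[OF i] T[OF av(1,3)] by simp
    ultimately show ?thesis by simp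
  qed
  have swap_self: "swap i i \<in> L" if "i < n" for i
  proof -
    have "swap i i = \<one>\<^bsub>A\<^esub>"
      using that A.one_closed swap_auto by (intro aut_eqI) (auto simp: swap_gen F.AutoGroup_one)
    then show ?thesis by simp
  qed
  have swap: "swap i j \<in> L" if ij: "i < n" "j < n" for i j
  proof -
    consider "i = j" | "j = l" "i \<noteq> l" | "i = l" "j \<noteq> l" | "i \<noteq> j" "i \<noteq> l" "j \<noteq> l" by blast
    then show ?thesis
    proof cases
      case 1
      then show ?thesis using swap_self ij by simp
    next
      case 2
      then show ?thesis using swap_l ij by simp
    next
      case 3
      have "swap i j = swap j i" by (simp add: swap_def transpose_commute)
      then show ?thesis using 3 swap_l ij by simp
    next
      case 4
      note s = swap_auto[OF ij(1) l] swap_auto[OF ij(2) l]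
      have "swap i l \<odot> (swap j l \<odot> swap i l) = swap i j"
      proof (rule aut_eqI)
        show "swap i l \<odot> (swap j l \<odot> swap i l) \<in> auto F" using s by simp
        show "swap i j \<in> auto F" using ij swap_auto by simp
        fix k assume k: "k < n"
        have b: "Transposition.transpose i l k < n" "Transposition.transpose j l k < n" if "k < n" for k
          using that ij l by (auto simp: Transposition.transpose_def)
        have "Transposition.transpose i l (Transposition.transpose j l (Transposition.transpose i l k))
            = Transposition.transpose i j k"
          using 4 by (auto simp: Transposition.transpose_def)
        then show "(swap i l \<odot> (swap j l \<odot> swap i l)) (gen k) = swap i j (gen k)"
          using s k b ij l by (simp add: aut_mult_apply swap_gen aut_apply)
      qed
      then show ?thesis using swap_l 4 ij by (metis L.m_closed)
    qed
  qed
  show ?thesis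
  proof (rule nielsen_generators[OF L _ swap])
    have conj: "\<psi> \<in> L" if i: "i < n" and \<psi>: "\<psi> \<in> auto F" and \<chi>: "\<chi> \<in> L"
      and eq: "\<And>k. k < n \<Longrightarrow> swap i l (\<chi> (swap i l (gen k))) = \<psi> (gen k)" for i \<psi> \<chi>
    proof -
      note s = swap_auto[OF i l]
      have "swap i l \<odot> (\<chi> \<odot> swap i l) = \<psi>"
        using s LA[OF \<chi>] \<psi> eq by (intro aut_eqI) (auto simp: aut_mult_apply aut_apply)
      then show ?thesis using swap[OF i l] \<chi> by (metis L.m_closed)
    qed
    have tr: "Transposition.transpose i l k < n" if "i < n" "k < n" for i k
      using that l by (auto simp: Transposition.transpose_def)
    show "flip i \<in> L" if i: "i < n" for i
    proof (rule conj[OF i flip_auto[OF i] flip_l])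
      fix k assume "k < n"
      then show "swap i l (flip l (swap i l (gen k))) = flip i (gen k)"
        using i l tr F.autoD(7)[OF swap_auto[OF i l]]
        by (cases "k = i"; cases "k = l") (simp_all add: swap_gen flip_gen Transposition.transpose_def)
    qed
    show "transv i g h \<in> L" if i: "i < n" and g: "avoids i g" and h: "avoids i h" for i g h
    proof -
      have av: "avoids l (swap i l w)" if "avoids i w" for w
      proof -
        have "swap i l w = word_val F (gen \<circ> Transposition.transpose i l) w"
          using avoidsD[OF that] by (simp add: swap_def ext_def)
        moreover have "avoids l ((gen \<circ> Transposition.transpose i l) k)" if "k \<in> fst ` set w" for k
          using \<open>avoids i w\<close> that i tr[OF i, of k]
          by (auto simp: avoids_def free_group_simps(1) gen_def Transposition.transpose_def)
        ultimately show ?thesis using avoids_word_val by metis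
      qed
      note gh = av[OF g] av[OF h]
      note D = F.autoD(4,5)[OF swap_auto[OF i l]]
      show ?thesis
      proof (rule conj[OF i transv_auto[OF i g h] T[OF gh]])
        fix k assume k: "k < n"
        show "swap i l (transv l (swap i l g) (swap i l h) (swap i l (gen k))) = transv i g h (gen k)"
        proof (cases "k = i")
          case True
          then show ?thesis
            using i l k g h avoidsD gh D by (simp add: swap_gen transv_gen swap_swap)
        next
          case False
          then have "Transposition.transpose i l k \<noteq> l" by (auto simp: Transposition.transpose_def)
          then show ?thesis
            using i l k g h gh False tr[OF i k] by (simp add: swap_gen transv_gen_other)
        qed
      qed
    qed
  qed
qed

end

text \<open>Let \<open>L\<close> be a subgroup properly containing the stabiliser of \<open>K\<close>. The words \<open>g\<close> avoiding the
  \<open>l\<close>-th letter whose transvection \<open>x\<^sub>l \<mapsto> x\<^sub>l g\<close> lies in \<open>L\<close> form a normal subgroup, which by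
  maximality of \<open>K\<close> must be everything.\<close>

locale maximal_normal = free_group_rank +
  fixes K :: "letter list set" and l :: nat
  assumes K: "K \<lhd> F" and K_proper: "K \<noteq> carrier F" and K_index: "finite (rcosets\<^bsub>F\<^esub> K)"
    and K_max: "\<And>N. N \<lhd> F \<Longrightarrow> K \<subseteq> N \<Longrightarrow> N = K \<or> N = carrier F"
    and l: "l < n" and gen_l: "gen l \<in> K"
begin

sublocale K: normal K F by (rule K)

abbreviation Q where "Q \<equiv> F Mod K"

sublocale Q: group Q by (rule K.factorgroup_is_group)

declare one_FactGroup [simp del] mult_FactGroup [simp del]

definition r :: "letter list \<Rightarrow> letter list set" where
  "r w = K #>\<^bsub>F\<^esub> w"

lemma r_hom: "r \<in> hom F Q"
  using K.r_coset_hom_Mod by (simp add: r_def[abs_def])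

sublocale r: group_hom F Q r
  using r_hom by unfold_locales

lemma r_one_iff: "w \<in> carrier F \<Longrightarrow> r w = \<one>\<^bsub>Q\<^esub> \<longleftrightarrow> w \<in> K"
  using F.coset_join1[of K w] F.coset_join2[of w K] K.subgroup_axioms
  by (auto simp: r_def one_FactGroup)

text \<open>Acting trivially on the quotient is more than preserving \<open>K\<close>, but can be
  checked on the basis.\<close>

lemma stabI:
  assumes "\<psi> \<in> auto F" "\<And>i. i < n \<Longrightarrow> r (\<psi> (gen i)) = r (gen i)"
  shows "\<psi> \<in> stab K"
proof -
  have "r \<circ> \<psi> \<in> hom F Q" using hom_compose[OF F.autoD(1)[OF assms(1)] r_hom] .
  then have "r (\<psi> w) = r w" if "w \<in> carrier F" for w
    using hom_eqI[OF Q.is_group _ r_hom that, of "r \<circ> \<psi>"] assms(2) by simp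
  then have "\<psi> w \<in> K \<longleftrightarrow> w \<in> K" if "w \<in> carrier F" for w
    using that r_one_iff[OF that] r_one_iff[OF aut_apply[OF assms(1) that]] by simp
  then show ?thesis using assms(1) by (simp add: stab_def)
qed

lemma r_gen_l: "r (gen l) = \<one>\<^bsub>Q\<^esub>"
  using r_one_iff gen_l l by simp

lemma transv_stabI:
  assumes "i < n" "avoids i g" "avoids i h" "r g \<otimes>\<^bsub>Q\<^esub> r (gen i) \<otimes>\<^bsub>Q\<^esub> r h = r (gen i)"
  shows "transv i g h \<in> stab K"
proof (rule stabI[OF transv_auto[OF assms(1-3)]])
  fix k assume "k < n"
  then show "r (transv i g h (gen k)) = r (gen k)"
    using assms avoidsD[OF assms(2)] avoidsD[OF assms(3)]
    by (cases "k = i") (simp_all add: transv_gen transv_gen_other)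
qed

text \<open>The retraction onto the free factor avoiding \<open>x_l\<close>. As \<open>x_l\<close>
  lies in \<open>K\<close>, residues do not change, so this factor already surjects onto the
  quotient.\<close>

definition proj :: "letter list \<Rightarrow> letter list" where
  "proj = ext (gen(l := []))"

lemma proj_fun: "gen(l := []) \<in> {..<n} \<rightarrow> carrier F"
  by (auto simp: free_group_simps(1) gen_def)

lemma proj_hom: "proj \<in> hom F F"
  unfolding proj_def by (rule ext_hom[OF proj_fun])

lemma proj_fixes: "avoids l w \<Longrightarrow> proj w = w"
  unfolding proj_def by (rule ext_fixes[OF proj_fun]) (auto simp: avoids_def)

lemma avoids_proj: "w \<in> carrier F \<Longrightarrow> avoids l (proj w)"
  unfolding proj_def ext_def
  by (auto intro!: avoids_word_val) (auto simp: free_group_simps avoids_def gen_def)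

lemma r_proj:
  assumes "w \<in> carrier F"
  shows "r (proj w) = r w"
proof -
  have "(r \<circ> proj) w = r w"
  proof (rule hom_eqI[OF Q.is_group hom_compose[OF proj_hom r_hom] r_hom assms])
    fix i assume "i < n"
    then have "proj (gen i) = (if i = l then [] else gen i)"
      unfolding proj_def using ext_gen[OF proj_fun] by simp
    then show "(r \<circ> proj) (gen i) = r (gen i)"
      using r_gen_l r.hom_one by (simp add: free_group_simps(3))
  qed
  then show ?thesis by simp
qed

text \<open>A proper \<open>K\<close> omits some basis element, and swapping it with
  \<open>x_l\<close> moves an element of \<open>K\<close> out of \<open>K\<close>.\<close>

lemma stab_proper: "stab K \<noteq> auto F"
proof
  assume eq: "stab K = auto F"
  have "\<exists>i<n. gen i \<notin> K"
  proof (rule ccontr)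
    assume neg: "\<not> ?thesis"
    have "w \<in> K" if "w \<in> carrier F" for w
    proof -
      have "(\<lambda>w. \<one>\<^bsub>Q\<^esub>) \<in> hom F Q" by (simp add: hom_def)
      then have "r w = \<one>\<^bsub>Q\<^esub>"
        by (rule hom_eqI[OF Q.is_group r_hom _ that]) (use neg r_one_iff in auto)
      then show ?thesis using r_one_iff that by simp
    qed
    then show False using K_proper K.subset by blast
  qed
  then obtain i where i: "i < n" "gen i \<notin> K" by blast
  have "swap l i \<in> stab K" using eq swap_auto l i by simp
  then have "swap l i (gen l) \<in> K" using gen_l l by (simp add: stab_def)
  then show False using i l by (simp add: swap_gen)
qed

lemma transv_right_mult:
  assumes "avoids l g" "avoids l h"
  shows "transv l [] g \<odot> transv l [] h = transv l [] (g \<cdot> h)"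
proof (rule aut_eqI)
  note one = avoids_one(1)[of l]
  note t = transv_auto[OF l one assms(1)] transv_auto[OF l one assms(2)]
    transv_auto[OF l one avoids_mult[OF assms]]
  show "transv l [] g \<odot> transv l [] h \<in> auto F" "transv l [] (g \<cdot> h) \<in> auto F" using t by simp_all
  fix k assume k: "k < n"
  note c = avoidsD[OF assms(1)] avoidsD[OF assms(2)]
  have one': "[] \<cdot> w = w" if "w \<in> carrier F" for w
    using that F.l_one by (auto simp: free_group_simps(3))
  show "(transv l [] g \<odot> transv l [] h) (gen k) = transv l [] (g \<cdot> h) (gen k)"
  proof (cases "k = l")
    case True
    have "transv l [] h (gen l) = gen l \<cdot> h" using transv_gen[OF l one assms(2)] one' l by simp
    then have "(transv l [] g \<odot> transv l [] h) (gen l) = (gen l \<cdot> g) \<cdot> h"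
      using t l c F.autoD(5)[OF t(1)] transv_fixes[OF l one assms(1,2)] transv_gen[OF l one assms(1)] one'
      by (simp add: aut_mult_apply)
    then show ?thesis
      using True transv_gen[OF l one avoids_mult[OF assms]] one' l c by (simp add: F.m_assoc)
  next
    case False
    then show ?thesis
      using k t l one assms avoids_mult[OF assms] by (simp add: aut_mult_apply transv_gen_other)
  qed
qed

lemma transv_one: "transv l [] [] = \<one>\<^bsub>A\<^esub>"
proof (rule aut_eqI)
  note one = avoids_one(1)[of l]
  show "transv l [] [] \<in> auto F" using transv_auto[OF l one one] .
  show "\<one>\<^bsub>A\<^esub> \<in> auto F" using A.one_closed by simp
  fix k assume k: "k < n"
  show "transv l [] [] (gen k) = \<one>\<^bsub>A\<^esub> (gen k)"
    using transv_gen[OF l one one] transv_gen_other[OF l one one k] k l F.l_one F.r_one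
    by (cases "k = l") (auto simp: F.AutoGroup_one free_group_simps(3))
qed

text \<open>The crux is an element of \<open>H\<close> outside \<open>K\<close>. The quotient map is
  twisted by an element \<open>\<kappa>\<close> of \<open>L\<close> that does not stabilise
  \<open>K\<close>, and compared with the original on words avoiding \<open>x_l\<close>; either a
  kernel element or a count in the finite quotient yields the element sought.\<close>

lemma overgroup:
  assumes L: "subgroup L A" "stab K \<subseteq> L" "L \<noteq> stab K"
  shows "L = auto F"
proof -
  interpret L: subgroup L A by fact
  have LA: "\<psi> \<in> auto F" if "\<psi> \<in> L" for \<psi> using that L.subset by auto
  note one = avoids_one(1)[of l]
  have one': "[] \<cdot> w = w" "w \<cdot> [] = w" if "w \<in> carrier F" for w
    using that F.l_one F.r_one by (auto simp: free_group_simps(3))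
  define T where "T g = transv l [] g" for g
  have T: "T g \<in> auto F" "T g (gen l) = gen l \<cdot> g" "\<And>k. k < n \<Longrightarrow> k \<noteq> l \<Longrightarrow> T g (gen k) = gen k"
    if "avoids l g" for g
    using transv_auto[OF l one that] transv_gen[OF l one that] transv_gen_other[OF l one that] one' l
      avoidsD[OF that] by (auto simp: T_def)
  \<comment> \<open>Partial conjugations of \<open>x_l\<close> act trivially modulo \<open>K\<close>
    because \<open>x_l\<close> does; conjugating transvections by them makes \<open>H\<close>
    normal.\<close>
  define C where "C h = transv l h (inv\<^sub>F h)" for h
  have C: "C h \<in> auto F" "C h (gen l) = h \<cdot> gen l \<cdot> inv\<^sub>F h"
    "\<And>k. k < n \<Longrightarrow> k \<noteq> l \<Longrightarrow> C h (gen k) = gen k" "\<And>w. avoids l w \<Longrightarrow> C h w = w" "C h \<in> L"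
    if "avoids l h" for h
  proof -
    note h = that avoids_inv[OF that]
    show "C h \<in> auto F" "C h (gen l) = h \<cdot> gen l \<cdot> inv\<^sub>F h"
      "\<And>k. k < n \<Longrightarrow> k \<noteq> l \<Longrightarrow> C h (gen k) = gen k" "\<And>w. avoids l w \<Longrightarrow> C h w = w"
      using transv_auto[OF l h] transv_gen[OF l h] transv_gen_other[OF l h] transv_fixes[OF l h]
      by (auto simp: C_def)
    have "transv l h (inv\<^sub>F h) \<in> stab K"
      using avoidsD[OF that] r_gen_l by (intro transv_stabI[OF l h]) simp
    then show "C h \<in> L" using L(2) by (auto simp: C_def)
  qed
  define H where "H = {g. avoids l g \<and> T g \<in> L}"
  have H_mult: "g \<cdot> h \<in> H" if "g \<in> H" "h \<in> H" for g h
  proof -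
    have gh: "avoids l g" "avoids l h" "T g \<in> L" "T h \<in> L" using that by (auto simp: H_def)
    have "T g \<odot> T h \<in> L" using gh L.m_closed by simp
    then show ?thesis using transv_right_mult[OF gh(1,2)] avoids_mult[OF gh(1,2)]
      by (simp add: H_def T_def)
  qed
  have H_one: "[] \<in> H" using transv_one by (simp add: H_def T_def)
  have H_inv: "inv\<^sub>F g \<in> H" if "g \<in> H" for g
  proof -
    have g: "avoids l g" "T g \<in> L" "avoids l (inv\<^sub>F g)" using that avoids_inv by (auto simp: H_def)
    have "T (inv\<^sub>F g) \<odot> T g = \<one>\<^bsub>A\<^esub>"
      using transv_right_mult[OF g(3,1)] transv_one avoidsD[OF g(1)]
      by (simp add: T_def free_group_simps(3))
    then have "T (inv\<^sub>F g) = inv\<^sub>A T g"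
      using T(1) g A.inv_equality by (metis F.carrier_AutoGroup)
    then show ?thesis using g by (simp add: H_def)
  qed
  have H_conj: "h \<cdot> g \<cdot> inv\<^sub>F h \<in> H" if "g \<in> H" "avoids l h" for g h
  proof -
    have g: "avoids l g" "T g \<in> L" using that by (auto simp: H_def)
    note h = that(2) avoids_inv[OF that(2)]
    have av: "avoids l (h \<cdot> g \<cdot> inv\<^sub>F h)" using g h avoids_mult by simp
    note c = avoidsD[OF g(1)] avoidsD[OF h(1)]
    note D = F.autoD(5)[OF C(1)[OF h(2)]] F.autoD(5)[OF T(1)[OF g(1)]]
    have Tf: "T g w = w" if "avoids l w" for w using transv_fixes[OF l one g(1) that] by (simp add: T_def)
    have "C (inv\<^sub>F h) \<odot> (T g \<odot> C h) = T (h \<cdot> g \<cdot> inv\<^sub>F h)"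
    proof (rule aut_eqI)
      show "C (inv\<^sub>F h) \<odot> (T g \<odot> C h) \<in> auto F" "T (h \<cdot> g \<cdot> inv\<^sub>F h) \<in> auto F"
        using C h T g av by auto
      fix k assume k: "k < n"
      have e: "(C (inv\<^sub>F h) \<odot> (T g \<odot> C h)) (gen k) = C (inv\<^sub>F h) (T g (C h (gen k)))"
        using C h T g k aut_apply by (simp add: aut_mult_apply)
      show "(C (inv\<^sub>F h) \<odot> (T g \<odot> C h)) (gen k) = T (h \<cdot> g \<cdot> inv\<^sub>F h) (gen k)"
      proof (cases "k = l")
        case True
        have "C (inv\<^sub>F h) (T g (C h (gen l))) =
            h \<cdot> (inv\<^sub>F h \<cdot> gen l \<cdot> inv\<^sub>F (inv\<^sub>F h) \<cdot> g) \<cdot> inv\<^sub>F h"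
          using C(2)[OF h(1)] C(2)[OF h(2)] T(2)[OF g(1)] Tf[OF h(1)] Tf[OF h(2)] C(4)[OF h(2)] g h c l
          by (simp add: D)
        also have "\<dots> = gen l \<cdot> (h \<cdot> g \<cdot> inv\<^sub>F h)" using c l by (simp add: F.m_assoc F.inv_mult_cancel)
        finally show ?thesis using e T(2)[OF av] True by simp
      next
        case False
        then show ?thesis using e C T g h av k by simp
      qed
    qed
    moreover have "C (inv\<^sub>F h) \<odot> (T g \<odot> C h) \<in> L" using C(5) h g by simp
    ultimately show ?thesis using av by (simp add: H_def)
  qed
  have KH: "g \<in> H" if "avoids l g" "g \<in> K" for g
  proof -
    have "T g \<in> stab K" unfolding T_def
      using avoidsD[OF that(1)] r_gen_l that(2) r_one_iff r.hom_one l
      by (intro transv_stabI[OF l one that(1)]) (simp add: free_group_simps(3))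
    then show ?thesis using that L(2) by (auto simp: H_def)
  qed
  obtain \<kappa> where \<kappa>: "\<kappa> \<in> L" "\<kappa> \<notin> stab K" using L by blast
  have \<kappa>a: "\<kappa> \<in> auto F" using LA \<kappa> by simp
  define \<mu> where "\<mu> = inv\<^sub>A \<kappa>"
  have \<mu>: "\<mu> \<in> auto F" "\<mu> \<in> L" "\<And>w. w \<in> carrier F \<Longrightarrow> \<kappa> (\<mu> w) = w" "\<And>w. w \<in> carrier F \<Longrightarrow> \<mu> (\<kappa> w) = w"
    using \<kappa>a \<kappa>(1) F.AutoGroup_inv by (auto simp: \<mu>_def)
  \<comment> \<open>The twisted quotient map; its kernel is the image of \<open>K\<close> under
    \<open>\<kappa>\<close>.\<close>
  define r' where "r' w = r (\<mu> w)" for w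
  have r': "r' \<in> hom F Q"
    using hom_compose[OF F.autoD(1)[OF \<mu>(1)] r_hom] by (simp add: r'_def[abs_def] comp_def)
  interpret r': group_hom F Q r' using r' by unfold_locales
  have "\<exists>g \<in> H. g \<notin> K"
  proof (cases "\<exists>g. avoids l g \<and> r' g = \<one>\<^bsub>Q\<^esub> \<and> g \<notin> K")
    case True
    then obtain g where g: "avoids l g" "r' g = \<one>\<^bsub>Q\<^esub>" "g \<notin> K" by blast
    \<comment> \<open>The twisted map does not see the transvection by \<open>g\<close>, so
      conjugating this transvection by \<open>\<kappa>\<close> lands in the stabiliser.\<close>
    have eq: "r' (T g w) = r' w" if "w \<in> carrier F" for w
    proof -
      have "(r' \<circ> T g) w = r' w"
      proof (rule hom_eqI[OF Q.is_group hom_compose[OF F.autoD(1)[OF T(1)[OF g(1)]] r'] r' that])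
        fix i assume "i < n"
        then show "(r' \<circ> T g) (gen i) = r' (gen i)"
          using T(2,3)[OF g(1)] g avoidsD[OF g(1)] by (cases "i = l") auto
      qed
      then show ?thesis by simp
    qed
    have "\<mu> \<odot> (T g \<odot> \<kappa>) \<in> stab K"
    proof (rule stabI)
      show "\<mu> \<odot> (T g \<odot> \<kappa>) \<in> auto F" using \<mu> T g \<kappa>a by simp
      fix i assume "i < n"
      then show "r ((\<mu> \<odot> (T g \<odot> \<kappa>)) (gen i)) = r (gen i)"
        using eq[of "\<kappa> (gen i)"] \<mu> T(1)[OF g(1)] \<kappa>a by (simp add: aut_mult_apply aut_apply r'_def)
    qed
    then have "\<kappa> \<odot> (\<mu> \<odot> (T g \<odot> \<kappa>)) \<odot> \<mu> \<in> L" using L(2) \<kappa>(1) \<mu>(2) by blast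
    moreover have "\<kappa> \<odot> (\<mu> \<odot> (T g \<odot> \<kappa>)) \<odot> \<mu> = T g"
      using \<kappa>a T(1)[OF g(1)] \<mu> by (intro aut_eqI) (auto simp: aut_mult_apply aut_apply)
    ultimately show ?thesis using g by (auto simp: H_def)
  next
    case False
    define W where "W = {w. avoids l w}"
    have WF: "W \<subseteq> carrier F" using avoidsD by (auto simp: W_def)
    have finQ: "finite (carrier Q)" using K_index by (simp add: FactGroup_def)
    \<comment> \<open>The twisted kernel on \<open>W\<close> now lies in the original one, so
      \<open>r\<close> factors through \<open>r'\<close> on \<open>W\<close> by a map
      \<open>h\<close>; surjectivity onto the finite quotient forces \<open>h\<close> to be
      bijective.\<close>
    define h where "h y = r (SOME w. w \<in> W \<and> r' w = y)" for y
    have h: "h (r' w) = r w" if "w \<in> W" for w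
    proof -
      define u where "u = (SOME u. u \<in> W \<and> r' u = r' w)"
      have u: "u \<in> W" "r' u = r' w" unfolding u_def using someI[of "\<lambda>u. u \<in> W \<and> r' u = r' w" w] that by auto
      have av: "avoids l (u \<cdot> inv\<^sub>F w)" using u that avoids_mult avoids_inv by (simp add: W_def)
      have uw: "u \<in> carrier F" "w \<in> carrier F" using u that WF by auto
      have "r' (u \<cdot> inv\<^sub>F w) = \<one>\<^bsub>Q\<^esub>" using u uw by simp
      then have "r (u \<cdot> inv\<^sub>F w) = \<one>\<^bsub>Q\<^esub>" using False av r_one_iff avoidsD by blast
      then have "r u = r w" using uw by (simp add: Q.inv_solve_right')
      then show ?thesis by (simp add: h_def u_def)
    qed
    have rW: "r ` W = carrier Q"
    proof
      show "r ` W \<subseteq> carrier Q" using WF by auto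
      show "carrier Q \<subseteq> r ` W"
      proof
        fix q assume "q \<in> carrier Q"
        then obtain w where "w \<in> carrier F" "q = r w" by (auto simp: FactGroup_def RCOSETS_def r_def)
        then show "q \<in> r ` W" using r_proj avoids_proj by (auto simp: W_def intro!: image_eqI[of _ _ "proj w"])
      qed
    qed
    have hW: "h ` r' ` W = carrier Q" using h rW by (force simp: image_image)
    have sub: "r' ` W \<subseteq> carrier Q" using WF by auto
    have card: "card (r' ` W) = card (carrier Q)"
      using card_mono[OF finQ sub] card_image_le[OF finite_subset[OF sub finQ], of h] hW by simp
    then have r'W: "r' ` W = carrier Q" using card_subset_eq[OF finQ sub] by simp
    have inj: "inj_on h (r' ` W)"
      using eq_card_imp_inj_on[OF finite_subset[OF sub finQ], of h] hW card by simp
    have r'r: "r' w = \<one>\<^bsub>Q\<^esub> \<longleftrightarrow> r w = \<one>\<^bsub>Q\<^esub>" if "w \<in> W" for w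
    proof
      show "r w = \<one>\<^bsub>Q\<^esub>" if "r' w = \<one>\<^bsub>Q\<^esub>"
        using False \<open>w \<in> W\<close> that WF r_one_iff by (auto simp: W_def)
      have nW: "[] \<in> W" by (simp add: W_def)
      have r1: "r [] = \<one>\<^bsub>Q\<^esub>" "r' [] = \<one>\<^bsub>Q\<^esub>"
        using r.hom_one r'.hom_one by (simp_all add: free_group_simps(3))
      show "r' w = \<one>\<^bsub>Q\<^esub>" if "r w = \<one>\<^bsub>Q\<^esub>"
      proof -
        have "h (r' w) = h (r' [])" using h[OF \<open>w \<in> W\<close>] h[OF nW] r1(1) that by simp
        then have "r' w = r' []" using inj_onD[OF inj _ imageI[OF \<open>w \<in> W\<close>] imageI[OF nW]] by blast
        then show ?thesis using r1(2) by simp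
      qed
    qed
    have "inv\<^bsub>Q\<^esub> (r' (gen l)) \<in> r' ` W" using r'W l by simp
    \<comment> \<open>The twisted map kills x_l c, so after composition with the transvection by
      \<open>c\<close> it kills \<open>x_l\<close>, as the original map does.\<close>
    then obtain c where c: "avoids l c" "r' c = inv\<^bsub>Q\<^esub> (r' (gen l))" by (auto simp: W_def)
    have eq: "r' (T c w) = r' (proj w)" if "w \<in> carrier F" for w
    proof -
      have "(r' \<circ> T c) w = (r' \<circ> proj) w"
      proof (rule hom_eqI[OF Q.is_group hom_compose[OF F.autoD(1)[OF T(1)[OF c(1)]] r'] hom_compose[OF proj_hom r'] that])
        fix i assume i: "i < n"
        have "proj (gen i) = (if i = l then [] else gen i)"
          unfolding proj_def using ext_gen[OF proj_fun] i by simp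
        then show "(r' \<circ> T c) (gen i) = (r' \<circ> proj) (gen i)"
          using T(2,3)[OF c(1)] c avoidsD[OF c(1)] r'.hom_one i l by (cases "i = l") (auto simp: free_group_simps(3))
      qed
      then show ?thesis by simp
    qed
    have stab: "\<mu> \<odot> T c \<in> stab K"
    proof -
      have "\<mu> (T c w) \<in> K \<longleftrightarrow> w \<in> K" if w: "w \<in> carrier F" for w
      proof -
        have "\<mu> (T c w) \<in> K \<longleftrightarrow> r' (T c w) = \<one>\<^bsub>Q\<^esub>"
          using w r_one_iff \<mu>(1) T(1)[OF c(1)] aut_apply by (simp add: r'_def)
        also have "\<dots> \<longleftrightarrow> r (proj w) = \<one>\<^bsub>Q\<^esub>" using eq[OF w] r'r avoids_proj[OF w] by (simp add: W_def)
        also have "\<dots> \<longleftrightarrow> w \<in> K" using r_proj[OF w] r_one_iff[OF w] by simp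
        finally show ?thesis .
      qed
      then show ?thesis using \<mu>(1) T(1)[OF c(1)] by (simp add: stab_def aut_mult_apply)
    qed
    interpret S: subgroup "stab K" A by (rule stab_subgroup)
    have "T c = \<kappa> \<odot> (\<mu> \<odot> T c)"
      using \<kappa>a T(1)[OF c(1)] \<mu> by (intro aut_eqI) (auto simp: aut_mult_apply aut_apply)
    then have "T c \<in> L" using stab L(2) \<kappa>(1) by (metis L.m_closed subsetD)
    \<comment> \<open>Otherwise the transvection by \<open>c\<close> would stabilise
      \<open>K\<close>, and with it \<open>\<kappa>\<close>.\<close>
    moreover have "c \<notin> K"
    proof
      assume cK: "c \<in> K"
      have "T c \<in> stab K" unfolding T_def
        using avoidsD[OF c(1)] r_gen_l cK r_one_iff r.hom_one l
        by (intro transv_stabI[OF l one c(1)]) (simp add: free_group_simps(3))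
      then have "(\<mu> \<odot> T c) \<odot> inv\<^sub>A T c \<in> stab K" using stab by blast
      then have "\<mu> \<in> stab K" using \<mu>(1) T(1)[OF c(1)] by (simp add: A.m_assoc)
      then have "inv\<^sub>A \<mu> \<in> stab K" by blast
      then show False using \<kappa>(2) \<kappa>a by (simp add: \<mu>_def)
    qed
    ultimately show ?thesis using c(1) by (auto simp: H_def)
  qed
  then obtain g0 where g0: "g0 \<in> H" "g0 \<notin> K" by blast
  \<comment> \<open>\<open>H\<close> lives in a free factor; pulling it back along
    \<open>proj\<close> gives a normal subgroup of the whole free group, to which maximality of
    \<open>K\<close> applies.\<close>
  define N where "N = {w \<in> carrier F. proj w \<in> H}"
  have pm: "proj (u \<cdot> v) = proj u \<cdot> proj v" if "u \<in> carrier F" "v \<in> carrier F" for u v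
    using proj_hom that by (simp add: hom_mult)
  interpret p: group_hom F F proj using proj_hom by unfold_locales
  have "N \<lhd> F"
  proof (rule F.normal_invI)
    show "subgroup N F"
    proof (rule F.subgroupI)
      show "N \<subseteq> carrier F" by (auto simp: N_def)
      have "[] \<in> N" using H_one proj_fixes[OF one] avoidsD[OF one] by (simp add: N_def)
      then show "N \<noteq> {}" by blast
      show "inv\<^sub>F a \<in> N" if "a \<in> N" for a using that H_inv by (auto simp: N_def)
      show "a \<cdot> b \<in> N" if "a \<in> N" "b \<in> N" for a b using that H_mult by (auto simp: N_def)
    qed
    fix x h assume "x \<in> carrier F" "h \<in> N"
    then show "x \<cdot> h \<cdot> inv\<^sub>F x \<in> N" using H_conj[of "proj h" "proj x"] avoids_proj by (simp add: N_def)
  qed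
  moreover have "K \<subseteq> N"
  proof
    fix w assume w: "w \<in> K"
    then have wF: "w \<in> carrier F" using K.subset by blast
    then have "proj w \<in> K" using r_proj[OF wF] r_one_iff w avoidsD[OF avoids_proj[OF wF]] by metis
    then show "w \<in> N" using KH avoids_proj[OF wF] wF by (simp add: N_def)
  qed
  moreover have "g0 \<in> N" using g0 avoidsD proj_fixes by (auto simp: N_def H_def)
  ultimately have "N = carrier F" using K_max g0(2) by blast
  then have H_all: "g \<in> H" if "avoids l g" for g
  proof -
    have "g \<in> N" using avoidsD[OF that] \<open>N = carrier F\<close> by simp
    then show ?thesis using proj_fixes[OF that] by (simp add: N_def)
  qed
  show ?thesis
  proof (rule subgroup_generated_by_transvections[OF L(1) l])
    fix g h assume gh: "avoids l g" "avoids l h"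
    note m = avoids_mult[OF gh]
    note c = avoidsD[OF gh(1)] avoidsD[OF gh(2)]
    \<comment> \<open>A two-sided transvection is the one-sided one by g h, corrected by a partial
      conjugation.\<close>
    have "C g \<odot> T (g \<cdot> h) = transv l g h"
    proof (rule aut_eqI)
      show "C g \<odot> T (g \<cdot> h) \<in> auto F" "transv l g h \<in> auto F"
        using C gh T m transv_auto[OF l gh] by auto
      fix k assume k: "k < n"
      show "(C g \<odot> T (g \<cdot> h)) (gen k) = transv l g h (gen k)"
      proof (cases "k = l")
        case True
        have "(C g \<odot> T (g \<cdot> h)) (gen l) = (g \<cdot> gen l \<cdot> inv\<^sub>F g) \<cdot> (g \<cdot> h)"
          using C(1,2,4)[OF gh(1)] T(1,2)[OF m] m c l F.autoD(5)[OF C(1)[OF gh(1)]]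
          by (simp add: aut_mult_apply)
        also have "\<dots> = g \<cdot> gen l \<cdot> h" using c l by (simp add: F.m_assoc F.inv_mult_cancel)
        finally show ?thesis using True transv_gen[OF l gh] by simp
      next
        case False
        then show ?thesis
          using C(1,3)[OF gh(1)] T(1,3)[OF m] k transv_gen_other[OF l gh] by (simp add: aut_mult_apply)
      qed
    qed
    then show "transv l g h \<in> L" using C(5)[OF gh(1)] H_all[OF m] by (metis (no_types, lifting) H_def L.m_closed mem_Collect_eq)
  next
    fix i assume i: "i < n" "i \<noteq> l"
    have av: "avoids i []" "avoids i (inv\<^sub>F (gen l))" using i l by (auto intro: avoids_gen avoids_inv)
    have "r [] = \<one>\<^bsub>Q\<^esub>" using r.hom_one by (simp add: free_group_simps(3))
    then show "transv i [] (inv\<^sub>F (gen l)) \<in> L"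
      using transv_stabI[OF i(1) av] r_gen_l i l L(2) by auto
  next
    have "flip l \<in> stab K"
      using l r_gen_l by (intro stabI[OF flip_auto[OF l]]) (auto simp: flip_gen)
    then show "flip l \<in> L" using L(2) by blast
  qed
qed

theorem stab_maximal: "maximal_subgroup (stab K) A"
  unfolding maximal_subgroup_def
  using stab_subgroup stab_proper overgroup by auto

end

section \<open>Congruence quotients of \<open>SL\<^sub>2\<close>\<close>

datatype 'a mat2 = Mat (m11: 'a) (m12: 'a) (m21: 'a) (m22: 'a)

fun mmul :: "'a::comm_ring_1 mat2 \<Rightarrow> 'a mat2 \<Rightarrow> 'a mat2" where
  "mmul (Mat a b c d) (Mat a' b' c' d') =
    Mat (a * a' + b * c') (a * b' + b * d') (c * a' + d * c') (c * b' + d * d')"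

fun madj :: "'a::comm_ring_1 mat2 \<Rightarrow> 'a mat2" where
  "madj (Mat a b c d) = Mat d (- b) (- c) a"

fun mdet :: "'a::comm_ring_1 mat2 \<Rightarrow> 'a" where
  "mdet (Mat a b c d) = a * d - b * c"

fun mtr :: "'a::comm_ring_1 mat2 \<Rightarrow> 'a" where
  "mtr (Mat a b c d) = a + d"

text \<open>Stated over any commutative ring, since both integers and integer polynomials serve as
  coefficients.\<close>

definition SL2 :: "'a::comm_ring_1 mat2 monoid" where
  "SL2 = \<lparr>carrier = {M. mdet M = 1}, monoid.mult = mmul, one = Mat 1 0 0 1\<rparr>"

lemma SL2_simps:
  "M \<in> carrier SL2 \<longleftrightarrow> mdet M = 1" "M \<otimes>\<^bsub>SL2\<^esub> N = mmul M N" "\<one>\<^bsub>SL2\<^esub> = Mat 1 0 0 1"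
  by (simp_all add: SL2_def)

lemma mdet_mmul: "mdet (mmul M N) = mdet M * mdet N"
  by (cases M; cases N) (simp add: algebra_simps)

lemma mdet_madj [simp]: "mdet (madj M) = mdet M"
  by (cases M) (simp add: algebra_simps)

lemma mmul_assoc: "mmul (mmul M N) P = mmul M (mmul N P)"
  by (cases M; cases N; cases P) (simp add: algebra_simps)

lemma mmul_madj: "mdet M = 1 \<Longrightarrow> mmul (madj M) M = Mat 1 0 0 1" "mdet M = 1 \<Longrightarrow> mmul M (madj M) = Mat 1 0 0 1"
  by (cases M; simp add: algebra_simps)+

lemma mmul_one [simp]: "mmul (Mat 1 0 0 1) M = M" "mmul M (Mat 1 0 0 1) = M"
  by (cases M; simp)+

lemma group_SL2: "group SL2"
proof (rule groupI)
  fix M :: "'a mat2" assume "M \<in> carrier SL2"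
  then show "\<exists>N\<in>carrier SL2. N \<otimes>\<^bsub>SL2\<^esub> M = \<one>\<^bsub>SL2\<^esub>"
    by (intro bexI[of _ "madj M"]) (auto simp: SL2_simps mmul_madj)
qed (auto simp: SL2_simps mdet_mmul mmul_assoc)

lemma inv_SL2: "mdet M = 1 \<Longrightarrow> inv\<^bsub>SL2\<^esub> M = madj M"
  by (rule group.inv_equality[OF group_SL2]) (auto simp: SL2_simps mmul_madj)

lemma mtr_mmul_commute: "mtr (mmul M N) = mtr (mmul N M)"
  by (cases M; cases N) (simp add: algebra_simps)

lemma mtr_conj: "mdet B = 1 \<Longrightarrow> mtr (mmul (mmul B M) (madj B)) = mtr M"
  by (subst mtr_mmul_commute) (simp add: mmul_madj flip: mmul_assoc)

lemma mtr_madj [simp]: "mtr (madj M) = mtr M"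
  by (cases M) (simp add: algebra_simps)

section \<open>Unipotent matrices and congruence modulo a prime\<close>

definition upper :: "'a::comm_ring_1 \<Rightarrow> 'a mat2" where "upper x = Mat 1 x 0 1"
definition lower :: "'a::comm_ring_1 \<Rightarrow> 'a mat2" where "lower x = Mat 1 0 x 1"

lemmas unip_defs = upper_def lower_def

text \<open>Integer matrices up to this relation, with determinant congruent to 1, stand for
  SL_2(p); the prime remains an ordinary variable.\<close>

definition mcong :: "int \<Rightarrow> int mat2 \<Rightarrow> int mat2 \<Rightarrow> bool" where
  "mcong p M N \<longleftrightarrow> p dvd m11 M - m11 N \<and> p dvd m12 M - m12 N \<and> p dvd m21 M - m21 N \<and> p dvd m22 M - m22 N"

lemma dvd_comb1:
  fixes p :: int
  assumes "p dvd x" "g = s * x"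
  shows "p dvd g"
  using assms by simp

lemma dvd_comb2:
  fixes p :: int
  assumes "p dvd x" "p dvd y" "g = s * x + t * y"
  shows "p dvd g"
  using assms by simp

lemma mcong_refl [simp]: "mcong p M M"
  by (simp add: mcong_def)

lemma mcong_sym: "mcong p M N \<Longrightarrow> mcong p N M"
  by (auto simp: mcong_def dvd_diff_commute)

lemma dvd_diff_trans: "p dvd x - y \<Longrightarrow> p dvd y - z \<Longrightarrow> p dvd x - (z :: int)"
  using dvd_add[of p "x - y" "y - z"] by simp

lemma mcong_trans: "mcong p M N \<Longrightarrow> mcong p N P \<Longrightarrow> mcong p M P"
  unfolding mcong_def by (meson dvd_diff_trans)

lemma dvd_diff_mult_add:
  fixes p :: int
  assumes "p dvd a - a'" "p dvd b - b'" "p dvd c - c'" "p dvd d - d'"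
  shows "p dvd (a * b + c * d) - (a' * b' + c' * d')"
proof -
  have "(a * b + c * d) - (a' * b' + c' * d') =
      (a - a') * b + a' * (b - b') + (c - c') * d + c' * (d - d')" by (simp add: algebra_simps)
  then show ?thesis using assms by simp
qed

lemma mcong_mmul: "mcong p M M' \<Longrightarrow> mcong p N N' \<Longrightarrow> mcong p (mmul M N) (mmul M' N')"
  by (cases M; cases M'; cases N; cases N') (simp add: mcong_def dvd_diff_mult_add)

lemma mcong_madj: "mcong p M N \<Longrightarrow> mcong p (madj M) (madj N)"
  by (cases M; cases N) (simp add: mcong_def dvd_diff_commute)

lemma mcong_mtr:
  assumes "mcong p M N"
  shows "p dvd mtr M - mtr N"
proof -
  obtain a b c d a' b' c' d' where "M = Mat a b c d" "N = Mat a' b' c' d'"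
    by (cases M; cases N) auto
  then show ?thesis using assms
    by (auto simp: mcong_def intro: dvd_comb2[where s = 1 and t = 1 and x = "a - a'" and y = "d - d'"])
qed

lemma mcong_mdet:
  assumes "mcong p M N" "mdet M = 1"
  shows "p dvd mdet N - 1"
proof -
  obtain a b c d a' b' c' d' where *: "M = Mat a b c d" "N = Mat a' b' c' d'"
    by (cases M; cases N) auto
  then have "p dvd (a * d + b * (- c)) - (a' * d' + b' * (- c'))"
    using assms by (intro dvd_diff_mult_add) (auto simp: mcong_def dvd_diff_commute)
  then show ?thesis using assms * by (simp add: dvd_diff_commute)
qed

lemma prime_inverse:
  assumes "prime (p :: int)" "\<not> p dvd c"
  obtains c' where "p dvd c * c' - 1"
proof -
  have "coprime c p" using prime_imp_coprime[OF assms] by (simp add: coprime_commute)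
  then obtain x where "[c * x = 1] (mod p)" using cong_solve_coprime_int by blast
  then show thesis using that by (simp add: cong_iff_dvd_diff)
qed

text \<open>If the lower-left entry is invertible modulo \<open>p\<close>, a product of three
  unipotents has the right first column and last row, and the determinant forces the remaining
  entry. Otherwise a row operation makes that entry invertible.\<close>

lemma unipotents_generate:
  assumes p: "prime (p :: int)"
    and mult: "\<And>M N. M \<in> S \<Longrightarrow> N \<in> S \<Longrightarrow> mmul M N \<in> S"
    and cong: "\<And>M N. M \<in> S \<Longrightarrow> mcong p M N \<Longrightarrow> N \<in> S"
    and U: "\<And>x. upper x \<in> S" and V: "\<And>x. lower x \<in> S"
    and det: "p dvd mdet M - 1"
  shows "M \<in> S"
proof -
  have *: "Mat a b c d \<in> S" if f: "p dvd a * d - b * c - 1" and c: "\<not> p dvd c" for a b c d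
  proof -
    obtain c' where e: "p dvd c * c' - 1" using prime_inverse[OF p c] .
    \<comment> \<open>Solves 1 + x c = a modulo \<open>p\<close>; likewise \<open>z\<close> solves 1
      + c z = d.\<close>
    define x where "x = (a - 1) * c'"
    define z where "z = (d - 1) * c'"
    have "mmul (mmul (upper x) (lower c)) (upper z) = Mat (1 + x * c) ((1 + x * c) * z + x) c (c * z + 1)"
      by (simp add: unip_defs)
    moreover have "mcong p (Mat (1 + x * c) ((1 + x * c) * z + x) c (c * z + 1)) (Mat a b c d)"
      unfolding mcong_def mat2.sel
    proof (intro conjI)
      show "p dvd 1 + x * c - a"
        by (rule dvd_comb1[OF e, where s = "a - 1"]) (simp add: x_def algebra_simps)
      show "p dvd c * z + 1 - d"
        by (rule dvd_comb1[OF e, where s = "d - 1"]) (simp add: z_def algebra_simps)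
      show "p dvd (1 + x * c) * z + x - b"
        by (rule dvd_comb2[OF e f, where s = "(a - 1) * z + b" and t = c'])
          (simp add: x_def z_def algebra_simps)
    qed simp
    ultimately show ?thesis using mult U V cong by metis
  qed
  obtain a b c d where M: "M = Mat a b c d" by (cases M)
  have f: "p dvd a * d - b * c - 1" using det M by simp
  show ?thesis
  proof (cases "p dvd c")
    case False
    then show ?thesis using * f M by simp
  next
    case True
    have a: "\<not> p dvd a"
    proof
      assume "p dvd a"
      then have "p dvd a * d - b * c" using True by simp
      then have "p dvd 1" using dvd_diff[OF _ f] by fastforce
      then show False using p not_prime_unit by blast
    qed
    \<comment> \<open>The first row is added to the second; \<open>a\<close> is invertible because
      \<open>c\<close> vanishes modulo \<open>p\<close> and the determinant is 1.\<close>
    have "\<not> p dvd c + a" using True a by (simp add: dvd_add_right_iff)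
    then have "Mat a b (c + a) (d + b) \<in> S"
      using f by (intro *) (simp_all add: algebra_simps)
    then have "mmul (lower (- 1)) (Mat a b (c + a) (d + b)) \<in> S" using mult V by blast
    then show ?thesis by (simp add: unip_defs M)
  qed
qed

text \<open>Simplicity of PSL_2(p) without quotient groups: \<open>S\<close> is a normal subgroup,
  given as a union of congruence classes. Two commutators turn a noncentral element into lower
  unipotents with arbitrary entry, and a Weyl element supplies the upper ones.\<close>

lemma noncentral_normal_generates:
  assumes p: "prime (p :: int)" "p > 5"
    and mult: "\<And>M N. M \<in> S \<Longrightarrow> N \<in> S \<Longrightarrow> mmul M N \<in> S"
    and cong: "\<And>M N. M \<in> S \<Longrightarrow> mcong p M N \<Longrightarrow> N \<in> S"
    and adj: "\<And>M. M \<in> S \<Longrightarrow> madj M \<in> S"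
    and conj: "\<And>M B. M \<in> S \<Longrightarrow> p dvd mdet B - 1 \<Longrightarrow> mmul (mmul B M) (madj B) \<in> S"
    and det: "\<And>M. M \<in> S \<Longrightarrow> p dvd mdet M - 1"
    and M0: "M0 \<in> S" "\<not> mcong p M0 (Mat 1 0 0 1)" "\<not> mcong p M0 (Mat (- 1) 0 0 (- 1))"
    and M: "p dvd mdet M - 1"
  shows "M \<in> S"
proof -
  have not_dvd: "\<not> p dvd m" if "0 < m" "m \<le> 5" for m using that p zdvd_imp_le[of p m] by auto
  have "\<exists>a b c d. Mat a b c d \<in> S \<and> \<not> p dvd c"
  proof -
    obtain a b c d where m: "M0 = Mat a b c d" by (cases M0)
    have f: "p dvd a * d - b * c - 1" using det[OF M0(1)] m by simp
    \<comment> \<open>In the first three cases some conjugate has nonzero lower-left entry; the last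
      one leaves only scalars of square 1, that is, the centre.\<close>
    consider "\<not> p dvd c" | "\<not> p dvd b" | "p dvd c" "p dvd b" "\<not> p dvd a - d" | "p dvd c" "p dvd b" "p dvd a - d"
      by blast
    then show ?thesis
    proof cases
      case 1
      then show ?thesis using M0 m by blast
    next
      case 2
      have "mmul (mmul (Mat 0 1 (- 1) 0) M0) (madj (Mat 0 1 (- 1) 0)) = Mat d (- c) (- b) a"
        by (simp add: m)
      then show ?thesis using conj[OF M0(1), of "Mat 0 1 (- 1) 0"] 2 by fastforce
    next
      case 3
      have "mmul (mmul (lower 1) M0) (madj (lower 1)) = Mat (a - b) b (a - d + (c - b)) (b + d)"
        by (simp add: m unip_defs algebra_simps)
      moreover have "\<not> p dvd a - d + (c - b)" using 3 by (simp add: dvd_add_left_iff)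
      ultimately show ?thesis using conj[OF M0(1), of "lower 1"] by (fastforce simp: unip_defs)
    next
      case 4
      have "p dvd (a * d - b * c - 1) + b * c + a * (a - d)" using f 4 by (intro dvd_add) auto
      then have "p dvd (a - 1) * (a + 1)" by (simp add: algebra_simps)
      then have "p dvd a - 1 \<or> p dvd a + 1" using p prime_dvd_mult_iff by blast
      then have "mcong p M0 (Mat 1 0 0 1) \<or> mcong p M0 (Mat (- 1) 0 0 (- 1))"
      proof
        assume a: "p dvd a - 1"
        then have "p dvd d - 1" using 4(3) by (intro dvd_comb2[OF a 4(3), where s = 1 and t = "- 1"]) simp
        then show ?thesis using a 4 by (simp add: mcong_def m)
      next
        assume a: "p dvd a + 1"
        then have "p dvd d + 1" using 4(3) by (intro dvd_comb2[OF a 4(3), where s = 1 and t = "- 1"]) simp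
        then show ?thesis using a 4 by (simp add: mcong_def m)
      qed
      then show ?thesis using M0 by blast
    qed
  qed
  then obtain a b c d where m: "Mat a b c d \<in> S" "\<not> p dvd c" by blast
  have f: "p dvd a * d - b * c - 1" using det[OF m(1)] by simp
  obtain c' where e: "p dvd c * c' - 1" using prime_inverse[OF p(1) m(2)] .
  \<comment> \<open>Conjugation by \<open>upper x\<close> makes the upper-left entry vanish modulo
    \<open>p\<close>.\<close>
  define x where "x = - a * c'"
  define b1 where "b1 = - (a + x * c) * x + b + x * d"
  define d1 where "d1 = d - x * c"
  have "mmul (mmul (upper x) (Mat a b c d)) (madj (upper x)) = Mat (a + x * c) b1 c d1"
    by (simp add: unip_defs b1_def d1_def algebra_simps)
  moreover have "mmul (mmul (upper x) (Mat a b c d)) (madj (upper x)) \<in> S"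
    by (rule conj[OF m(1)]) (simp add: unip_defs)
  ultimately have "Mat (a + x * c) b1 c d1 \<in> S" by simp
  moreover have ac: "p dvd a + x * c" by (rule dvd_comb1[OF e, where s = "- a"]) (simp add: x_def algebra_simps)
  then have "mcong p (Mat (a + x * c) b1 c d1) (Mat 0 b1 c d1)" by (simp add: mcong_def)
  ultimately have m1: "Mat 0 b1 c d1 \<in> S" using cong by blast
  have bc: "p dvd - b1 * c - 1" using det[OF m1] by simp
  \<comment> \<open>With \<open>h\<close> inverse to 2, diag(2, h) is a torus element; its
    commutator with the matrix just found is lower triangular with diagonal entries 4 and k =
    1/4.\<close>
  obtain h where h: "p dvd 2 * h - 1" using prime_inverse[OF p(1), of 2] not_dvd[of 2] by auto
  define k where "k = h * h"
  define q where "q = h * h * c * d1 - 2 * h * d1 * c"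
  have 4: "p dvd 4 * k - 1" by (rule dvd_comb1[OF h, where s = "2 * h + 1"]) (simp add: k_def algebra_simps)
  have "mmul (mmul (Mat 2 0 0 h) (Mat 0 b1 c d1)) (madj (Mat 2 0 0 h)) \<in> S"
    by (rule conj[OF m1]) (use h in simp)
  then have "mmul (mmul (mmul (Mat 2 0 0 h) (Mat 0 b1 c d1)) (madj (Mat 2 0 0 h))) (madj (Mat 0 b1 c d1)) \<in> S"
    using mult adj m1 by blast
  moreover have "mmul (mmul (mmul (Mat 2 0 0 h) (Mat 0 b1 c d1)) (madj (Mat 2 0 0 h))) (madj (Mat 0 b1 c d1))
      = Mat (- 4 * b1 * c) 0 q (- h * h * b1 * c)"
    by (simp add: q_def algebra_simps)
  ultimately have "Mat (- 4 * b1 * c) 0 q (- h * h * b1 * c) \<in> S" by (simp only:)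
  moreover have "mcong p (Mat (- 4 * b1 * c) 0 q (- h * h * b1 * c)) (Mat 4 0 q k)"
    unfolding mcong_def mat2.sel
  proof (intro conjI)
    show "p dvd - 4 * b1 * c - 4" by (rule dvd_comb1[OF bc, where s = 4]) (simp add: algebra_simps)
    show "p dvd - h * h * b1 * c - k" by (rule dvd_comb1[OF bc, where s = "h * h"]) (simp add: k_def algebra_simps)
  qed simp_all
  ultimately have Q: "Mat 4 0 q k \<in> S" using cong by blast
  \<comment> \<open>The commutator of this triangular matrix with \<open>lower y\<close> is again
    lower unipotent, with entry scaled by k^2 - 1.\<close>
  have Vk: "lower (y * (k * k - 1)) \<in> S" for y
  proof -
    have "mmul (mmul (lower y) (madj (Mat 4 0 q k))) (madj (lower y)) \<in> S"
      by (rule conj[OF adj[OF Q]]) (simp add: unip_defs)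
    then have "mmul (Mat 4 0 q k) (mmul (mmul (lower y) (madj (Mat 4 0 q k))) (madj (lower y))) \<in> S"
      using mult Q by blast
    moreover have "mmul (Mat 4 0 q k) (mmul (mmul (lower y) (madj (Mat 4 0 q k))) (madj (lower y)))
        = Mat (4 * k) 0 (k * k * y - 4 * k * y) (4 * k)"
      by (simp add: unip_defs algebra_simps)
    moreover have "mcong p (Mat (4 * k) 0 (k * k * y - 4 * k * y) (4 * k)) (lower (y * (k * k - 1)))"
      unfolding mcong_def mat2.sel unip_defs
    proof (intro conjI)
      show "p dvd k * k * y - 4 * k * y - y * (k * k - 1)"
        by (rule dvd_comb1[OF 4, where s = "- y"]) (simp add: algebra_simps)
    qed (use 4 in simp_all)
    ultimately show ?thesis using cong by metis
  qed
  \<comment> \<open>Otherwise 16 and 1 would agree modulo \<open>p\<close>, and \<open>p\<close>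
    would divide 15; this is excluded by p > 5.\<close>
  have "\<not> p dvd k * k - 1"
  proof
    assume k: "p dvd k * k - 1"
    have "p dvd 3 * 5" by (rule dvd_comb2[OF k 4, where s = "- 16" and t = "4 * k + 1"]) (simp add: algebra_simps)
    then have "p dvd 3 \<or> p dvd 5" using p(1) prime_dvd_mult_iff by blast
    then show False using not_dvd by auto
  qed
  then obtain g where g: "p dvd (k * k - 1) * g - 1" using prime_inverse[OF p(1)] by blast
  have V: "lower z \<in> S" for z
  proof -
    have "mcong p (lower ((z * g) * (k * k - 1))) (lower z)"
      using dvd_comb1[OF g, of "z * g * (k * k - 1) - z" z]
      by (simp add: mcong_def unip_defs algebra_simps)
    then show ?thesis using Vk cong by blast
  qed
  have U: "upper z \<in> S" for z
  proof -
    have "mmul (mmul (Mat 0 1 (- 1) 0) (lower (- z))) (madj (Mat 0 1 (- 1) 0)) = upper z"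
      by (simp add: unip_defs)
    then show ?thesis using conj[OF V[of "- z"], of "Mat 0 1 (- 1) 0"] by simp
  qed
  show ?thesis by (rule unipotents_generate[OF p(1) mult cong U V M])
qed

section \<open>Kernels of representations into PSL_2(p)\<close>

context free_group_rank
begin

definition pker :: "int \<Rightarrow> (letter list \<Rightarrow> int mat2) \<Rightarrow> letter list set" where
  "pker p \<rho> = {w \<in> carrier F. mcong p (\<rho> w) (Mat 1 0 0 1) \<or> mcong p (\<rho> w) (Mat (- 1) 0 0 (- 1))}"

end

text \<open>A representation whose reduction modulo \<open>p\<close> is already surjective on the words in the first two
  generators.\<close>

locale unipotent_rep = free_group_rank +
  fixes \<rho> :: "letter list \<Rightarrow> int mat2" and p t :: int
  assumes rho: "\<rho> \<in> hom F SL2" and p: "prime p" "p > 5" and pt: "\<not> p dvd t" and n3: "n \<ge> 3"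
    and rho0: "\<rho> (gen 0) = upper t" and rho1: "\<rho> (gen 1) = lower t"
begin

sublocale \<rho>: group_hom F SL2 \<rho>
  by (simp add: group_hom_def group_hom_axioms_def rho group_SL2 group_free_group)

declare \<rho>.hom_mult [simp del] \<rho>.hom_inv [simp del]

lemma rho_simps:
  "u \<in> carrier F \<Longrightarrow> mdet (\<rho> u) = 1"
  "u \<in> carrier F \<Longrightarrow> v \<in> carrier F \<Longrightarrow> \<rho> (u \<cdot> v) = mmul (\<rho> u) (\<rho> v)"
  "u \<in> carrier F \<Longrightarrow> \<rho> (inv\<^sub>F u) = madj (\<rho> u)"
  "\<rho> [] = Mat 1 0 0 1"
  using \<rho>.hom_closed[of u] \<rho>.hom_mult[of u v] \<rho>.hom_inv[of u] \<rho>.hom_one inv_SL2[of "\<rho> u"]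
  by (simp_all add: SL2_simps free_group_simps(3))

text \<open>Powers of the first two generators map to unipotents with entries s t, and
  \<open>t\<close> is invertible modulo \<open>p\<close>, so all unipotents come from words free of
  \<open>x_l\<close>.\<close>

lemma rho_surj:
  assumes "l \<ge> 2" and "p dvd mdet M - 1"
  shows "\<exists>w. avoids l w \<and> mcong p (\<rho> w) M"
proof -
  let ?S = "{M. \<exists>w. avoids l w \<and> mcong p (\<rho> w) M}"
  have mult: "mmul M N \<in> ?S" if MN: "M \<in> ?S" "N \<in> ?S" for M N
  proof -
    obtain u v where uv: "avoids l u" "avoids l v" "mcong p (\<rho> u) M" "mcong p (\<rho> v) N" using MN by blast
    then have "mcong p (\<rho> (u \<cdot> v)) (mmul M N)" using avoidsD by (simp add: rho_simps mcong_mmul)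
    then show ?thesis using uv avoids_mult by blast
  qed
  have pow: "f x \<in> ?S" if g: "\<And>s::nat. \<exists>w. avoids l w \<and> \<rho> w = f (int s * t)"
    and f: "\<And>x y. p dvd x - y \<Longrightarrow> mcong p (f x) (f y)" for f x
  proof -
    obtain t' where t': "p dvd t * t' - 1" using prime_inverse[OF p(1) pt] .
    \<comment> \<open>A nonnegative exponent congruent to x / t, so that only positive powers are
      needed.\<close>
    define s where "s = nat ((x * t') mod p)"
    have "p > 0" using p by simp
    then have s: "int s = (x * t') mod p" by (simp add: s_def)
    have "p dvd x * t' - int s" unfolding s by (simp add: minus_mod_eq_mult_div)
    then have "p dvd int s * t - x"
      by (rule dvd_comb2[OF _ t', where s = "- t" and t = x]) (simp add: algebra_simps)
    then have fs: "mcong p (f (int s * t)) (f x)" by (rule f)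
    obtain w where "avoids l w" "\<rho> w = f (int s * t)" using g by blast
    then show ?thesis using fs by auto
  qed
  have "0 < n" "1 < n" "0 \<noteq> l" "1 \<noteq> l" using n3 assms(1) by auto
  note av = avoids_gen[OF \<open>0 < n\<close> \<open>0 \<noteq> l\<close>] avoids_gen[OF \<open>1 < n\<close> \<open>1 \<noteq> l\<close>]
  have U: "\<exists>w. avoids l w \<and> \<rho> w = upper (int s * t)" for s
  proof (induction s)
    case 0
    then show ?case using rho_simps(4) avoids_one(1) by (intro exI[of _ "[]"]) (auto simp: unip_defs)
  next
    case (Suc s)
    then obtain w where w: "avoids l w" "\<rho> w = upper (int s * t)" by blast
    then show ?case using av avoids_mult avoidsD
      by (intro exI[of _ "gen 0 \<cdot> w"]) (auto simp: rho_simps rho0 unip_defs algebra_simps)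
  qed
  have V: "\<exists>w. avoids l w \<and> \<rho> w = lower (int s * t)" for s
  proof (induction s)
    case 0
    then show ?case using rho_simps(4) avoids_one(1) by (intro exI[of _ "[]"]) (auto simp: unip_defs)
  next
    case (Suc s)
    then obtain w where w: "avoids l w" "\<rho> w = lower (int s * t)" by blast
    then show ?case using av avoids_mult avoidsD
      by (intro exI[of _ "gen 1 \<cdot> w"]) (auto simp: rho_simps rho1[simplified] unip_defs algebra_simps)
  qed
  have "M \<in> ?S"
  proof (rule unipotents_generate[OF p(1) mult _ _ _ assms(2)])
    show "N \<in> ?S" if "M \<in> ?S" "mcong p M N" for M N using that mcong_trans by blast
    show "upper x \<in> ?S" for x
      by (rule pow[of upper, OF U]) (simp add: mcong_def unip_defs)
    show "lower x \<in> ?S" for x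
      by (rule pow[of lower, OF V]) (simp add: mcong_def unip_defs)
  qed
  then show ?thesis by simp
qed

abbreviation K where "K \<equiv> pker p \<rho>"

lemma K_closed: "w \<in> K \<Longrightarrow> w \<in> carrier F"
  by (simp add: pker_def)

lemma mcong_quotient_K:
  assumes "u \<in> carrier F" "v \<in> carrier F" "mcong p (\<rho> u) (\<rho> v)"
  shows "u \<cdot> inv\<^sub>F v \<in> K"
proof -
  have "mcong p (mmul (\<rho> u) (madj (\<rho> v))) (mmul (\<rho> v) (madj (\<rho> v)))"
    using assms(3) mcong_mmul mcong_refl by blast
  then show ?thesis using assms by (simp add: pker_def rho_simps mmul_madj)
qed

lemma K_normal: "K \<lhd> F"
proof (rule F.normal_invI)
  have c: "mcong p (mmul M N) (Mat 1 0 0 1) \<or> mcong p (mmul M N) (Mat (- 1) 0 0 (- 1))"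
    if "mcong p M (Mat 1 0 0 1) \<or> mcong p M (Mat (- 1) 0 0 (- 1))"
      "mcong p N (Mat 1 0 0 1) \<or> mcong p N (Mat (- 1) 0 0 (- 1))" for M N
    using that mcong_mmul[of p M _ N] by fastforce
  show "subgroup K F"
  proof (rule F.subgroupI)
    show "K \<subseteq> carrier F" using K_closed by blast
    have "[] \<in> K" using rho_simps(4) by (simp add: pker_def free_group_simps(1))
    then show "K \<noteq> {}" by blast
    show "inv\<^sub>F a \<in> K" if "a \<in> K" for a
      using that mcong_madj[of p "\<rho> a" "Mat 1 0 0 1"] mcong_madj[of p "\<rho> a" "Mat (- 1) 0 0 (- 1)"]
      by (auto simp: pker_def rho_simps)
    show "a \<cdot> b \<in> K" if "a \<in> K" "b \<in> K" for a b
      using that c[of "\<rho> a" "\<rho> b"] by (simp add: pker_def rho_simps)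
  qed
  fix x h assume x: "x \<in> carrier F" and h: "h \<in> K"
  have m: "mmul (mmul (\<rho> x) (Mat e 0 0 e)) (madj (\<rho> x)) = Mat e 0 0 e" for e
  proof -
    obtain a b c d where abcd: "\<rho> x = Mat a b c d" by (cases "\<rho> x")
    then have "a * d - b * c = 1" using rho_simps(1)[OF x] by simp
    then have "(a * d - b * c) * e = e" by simp
    then show ?thesis by (simp add: abcd algebra_simps)
  qed
  have "mcong p (mmul (mmul (\<rho> x) (\<rho> h)) (madj (\<rho> x))) (Mat e 0 0 e)" if "mcong p (\<rho> h) (Mat e 0 0 e)" for e
    using mcong_mmul[OF mcong_mmul[OF mcong_refl[of p "\<rho> x"] that] mcong_refl[of p "madj (\<rho> x)"]] m by simp
  then show "x \<cdot> h \<cdot> inv\<^sub>F x \<in> K" using x h by (auto simp: pker_def rho_simps)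
qed

lemma K_proper: "K \<noteq> carrier F"
proof
  assume "K = carrier F"
  then have "gen 0 \<in> K" using n3 by simp
  then show False using pt by (auto simp: pker_def rho0 mcong_def unip_defs)
qed

text \<open>A coset depends only on the residues of the four matrix entries.\<close>

lemma K_finite_index: "finite (rcosets\<^bsub>F\<^esub> K)"
proof -
  define res where "res w = Mat (m11 (\<rho> w) mod p) (m12 (\<rho> w) mod p) (m21 (\<rho> w) mod p) (m22 (\<rho> w) mod p)" for w
  interpret K: normal K F by (rule K_normal)
  have "finite ((\<lambda>w. K #>\<^bsub>F\<^esub> w) ` carrier F)"
  proof (rule finite_image_factor[where g = res])
    have "res ` carrier F \<subseteq> (\<lambda>(a, b, c, d). Mat a b c d) ` ({0..<p} \<times> {0..<p} \<times> {0..<p} \<times> {0..<p})"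
    proof
      fix y assume "y \<in> res ` carrier F"
      then obtain w where y: "y = res w" by blast
      have "(m11 (\<rho> w) mod p, m12 (\<rho> w) mod p, m21 (\<rho> w) mod p, m22 (\<rho> w) mod p)
          \<in> {0..<p} \<times> {0..<p} \<times> {0..<p} \<times> {0..<p}" using p by simp
      then show "y \<in> (\<lambda>(a, b, c, d). Mat a b c d) ` ({0..<p} \<times> {0..<p} \<times> {0..<p} \<times> {0..<p})"
        unfolding y res_def by (rule rev_image_eqI) simp
    qed
    then show "finite (res ` carrier F)" by (rule finite_subset) simp
    fix u v assume *: "u \<in> carrier F" "v \<in> carrier F" "res u = res v"
    then have "mcong p (\<rho> u) (\<rho> v)" by (simp add: res_def mcong_def mod_eq_dvd_iff)
    then have "u \<cdot> inv\<^sub>F v \<in> K" using mcong_quotient_K * by blast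
    moreover have "u = (u \<cdot> inv\<^sub>F v) \<cdot> v" using * by (simp add: F.m_assoc)
    ultimately have "u \<in> K #>\<^bsub>F\<^esub> v" by (auto simp: r_coset_def)
    then show "K #>\<^bsub>F\<^esub> u = K #>\<^bsub>F\<^esub> v" using F.repr_independence[OF _ *(2) K.subgroup_axioms] by blast
  qed
  moreover have "rcosets\<^bsub>F\<^esub> K = (\<lambda>w. K #>\<^bsub>F\<^esub> w) ` carrier F" by (auto simp: RCOSETS_def)
  ultimately show ?thesis by simp
qed

text \<open>The image of \<open>N\<close> modulo \<open>p\<close> is normal, since every matrix of
  determinant 1 comes from a word, and noncentral, since \<open>N\<close> exceeds \<open>K\<close>.
  Hence it is everything, and \<open>N\<close> contains each word because it contains
  \<open>K\<close>.\<close>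

lemma K_maximal:
  assumes N: "N \<lhd> F" "K \<subseteq> N"
  shows "N = K \<or> N = carrier F"
proof (cases "N = K")
  case False
  interpret N: normal N F by fact
  obtain w0 where w0: "w0 \<in> N" "w0 \<notin> K" using False N(2) by blast
  have w0F: "w0 \<in> carrier F" using w0 N.subset by blast
  let ?S = "{M. \<exists>w \<in> N. mcong p (\<rho> w) M}"
  have all: "M \<in> ?S" if "p dvd mdet M - 1" for M
  proof (rule noncentral_normal_generates[OF p _ _ _ _ _ _ _ _ that])
    fix M N' assume M: "M \<in> ?S"
    then obtain u where u: "u \<in> N" "mcong p (\<rho> u) M" by blast
    have uF: "u \<in> carrier F" using u N.subset by blast
    show "mmul M N' \<in> ?S" if N': "N' \<in> ?S"
    proof -
      obtain v where v: "v \<in> N" "mcong p (\<rho> v) N'" using N' by blast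
      have "v \<in> carrier F" using v N.subset by blast
      then have "mcong p (\<rho> (u \<cdot> v)) (mmul M N')" using u v uF by (simp add: rho_simps mcong_mmul)
      then show ?thesis using u v by blast
    qed
    show "N' \<in> ?S" if "mcong p M N'" using u that mcong_trans by blast
    have "mcong p (\<rho> (inv\<^sub>F u)) (madj M)" using u uF by (simp add: rho_simps mcong_madj)
    then show "madj M \<in> ?S" using u by blast
    show "p dvd mdet M - 1" using u uF mcong_mdet rho_simps(1) by blast
    show "mmul (mmul B M) (madj B) \<in> ?S" if B: "p dvd mdet B - 1" for B
    proof -
      obtain x where x: "avoids 2 x" "mcong p (\<rho> x) B" using rho_surj[OF _ B, of 2] by auto
      then have xF: "x \<in> carrier F" using avoidsD by blast
      have "mcong p (\<rho> (x \<cdot> u \<cdot> inv\<^sub>F x)) (mmul (mmul B M) (madj B))"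
        using xF uF u x by (simp add: rho_simps mcong_mmul mcong_madj)
      then show ?thesis using N.inv_op_closed2[OF xF u(1)] by blast
    qed
  next
    show "\<rho> w0 \<in> ?S" using w0 mcong_refl by blast
    show "\<not> mcong p (\<rho> w0) (Mat 1 0 0 1)" "\<not> mcong p (\<rho> w0) (Mat (- 1) 0 0 (- 1))"
      using w0 w0F by (auto simp: pker_def)
  qed
  have "N = carrier F"
  proof
    show "N \<subseteq> carrier F" by (rule N.subset)
    show "carrier F \<subseteq> N"
    proof
      fix w assume w: "w \<in> carrier F"
      then obtain u where u: "u \<in> N" "mcong p (\<rho> u) (\<rho> w)" using all[of "\<rho> w"] rho_simps(1) by auto
      have uF: "u \<in> carrier F" using u N.subset by blast
      have "w \<cdot> inv\<^sub>F u \<in> N" using mcong_quotient_K[OF w uF] u mcong_sym N(2) by blast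
      then have "(w \<cdot> inv\<^sub>F u) \<cdot> u \<in> N" using u by blast
      then show "w \<in> N" using w uF by (simp add: F.m_assoc)
    qed
  qed
  then show ?thesis by blast
qed simp

lemma stab_pker_maximal:
  assumes "l < n" "gen l \<in> K"
  shows "maximal_subgroup (stab K) A" "finite (rcosets\<^bsub>A\<^esub> (stab K))"
proof -
  interpret maximal_normal n K l
    by unfold_locales (use K_normal K_proper K_finite_index K_maximal assms in
      \<open>auto simp: normal_def subgroup_def normal_axioms_def\<close>)
  show "maximal_subgroup (stab K) A" by (rule stab_maximal)
  show "finite (rcosets\<^bsub>A\<^esub> (stab K))" using stab_finite_index K_normal K_finite_index by blast
qed

end

section \<open>Maximal subgroups under conjugation and in quotients\<close>

context group
begin

lemma rcos_eq_iff:
  assumes "subgroup M G" "x \<in> carrier G" "y \<in> carrier G"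
  shows "M #> x = M #> y \<longleftrightarrow> x \<otimes> inv y \<in> M"
proof
  interpret M: subgroup M G by fact
  assume "M #> x = M #> y"
  then have "x \<in> M #> y" using rcos_self[OF assms(2,1)] by simp
  then obtain m where "m \<in> M" "x = m \<otimes> y" by (auto simp: r_coset_def)
  then show "x \<otimes> inv y \<in> M" using assms(3) M.subset by (simp add: m_assoc subsetD)
next
  assume "x \<otimes> inv y \<in> M"
  moreover have "x = (x \<otimes> inv y) \<otimes> y" using assms by (simp add: m_assoc)
  ultimately have "x \<in> M #> y" by (auto simp: r_coset_def)
  then show "M #> x = M #> y" using repr_independence assms by blast
qed

lemma subgroup_conj_preimage:
  assumes "subgroup M G" "x \<in> carrier G"
  shows "subgroup {y \<in> carrier G. x \<otimes> y \<otimes> inv x \<in> M} G"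
proof (rule subgroupI)
  interpret M: subgroup M G by fact
  show "{y \<in> carrier G. x \<otimes> y \<otimes> inv x \<in> M} \<noteq> {}"
    using assms(2) by (auto intro!: exI[of _ \<one>])
  show "inv a \<in> {y \<in> carrier G. x \<otimes> y \<otimes> inv x \<in> M}" if a: "a \<in> {y \<in> carrier G. x \<otimes> y \<otimes> inv x \<in> M}" for a
  proof -
    have "inv (x \<otimes> a \<otimes> inv x) \<in> M" using a M.m_inv_closed by blast
    then show ?thesis using a assms(2) by (simp add: inv_mult_group m_assoc)
  qed
  show "a \<otimes> b \<in> {y \<in> carrier G. x \<otimes> y \<otimes> inv x \<in> M}"
    if ab: "a \<in> {y \<in> carrier G. x \<otimes> y \<otimes> inv x \<in> M}" "b \<in> {y \<in> carrier G. x \<otimes> y \<otimes> inv x \<in> M}" for a b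
  proof -
    have "(x \<otimes> a \<otimes> inv x) \<otimes> (x \<otimes> b \<otimes> inv x) \<in> M" using ab by blast
    then show ?thesis using ab assms(2) by (simp add: m_assoc inv_mult_cancel)
  qed
qed auto

text \<open>Conjugation is an automorphism; transporting maximality and finite index along it will
  make \<open>core\<close> a normal subset.\<close>

lemma maximal_subgroup_conj:
  assumes M: "maximal_subgroup M G" and x: "x \<in> carrier G"
  shows "maximal_subgroup {y \<in> carrier G. x \<otimes> y \<otimes> inv x \<in> M} G"
    "finite (rcosets M) \<Longrightarrow> finite (rcosets {y \<in> carrier G. x \<otimes> y \<otimes> inv x \<in> M})"
proof -
  have sM: "subgroup M G" and "M \<noteq> carrier G" using M by (auto simp: maximal_subgroup_def)
  interpret M: subgroup M G by fact
  let ?M = "{y \<in> carrier G. x \<otimes> y \<otimes> inv x \<in> M}"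
  have s: "subgroup ?M G" using subgroup_conj_preimage[OF sM x] .
  have c: "x \<otimes> (inv x \<otimes> z \<otimes> x) \<otimes> inv x = z" "inv x \<otimes> (x \<otimes> z \<otimes> inv x) \<otimes> x = z" if "z \<in> carrier G" for z
    using that x by (simp_all add: m_assoc inv_mult_cancel)
  show "maximal_subgroup ?M G" unfolding maximal_subgroup_def
  proof (intro conjI allI impI s)
    obtain z where z: "z \<in> carrier G" "z \<notin> M" using \<open>M \<noteq> carrier G\<close> M.subset by blast
    then have "inv x \<otimes> z \<otimes> x \<notin> ?M" using c(1)[OF z(1)] by simp
    then show "?M \<noteq> carrier G" using x z by blast
    fix J assume J: "subgroup J G \<and> ?M \<subseteq> J \<and> J \<noteq> carrier G"
    interpret J: subgroup J G using J by blast
    let ?J = "{z \<in> carrier G. inv x \<otimes> z \<otimes> inv (inv x) \<in> J}"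
    have "subgroup ?J G" using subgroup_conj_preimage[of J "inv x"] J x by simp
    moreover have "M \<subseteq> ?J"
    proof
      fix z assume z: "z \<in> M"
      then have zG: "z \<in> carrier G" using M.subset by blast
      then have "inv x \<otimes> z \<otimes> x \<in> ?M" using c(1)[OF zG] z x by simp
      then have "inv x \<otimes> z \<otimes> x \<in> J" using J by blast
      then show "z \<in> ?J" using zG x by simp
    qed
    moreover have "?J \<noteq> carrier G"
    proof
      assume e: "?J = carrier G"
      have "y \<in> J" if y: "y \<in> carrier G" for y
      proof -
        have "x \<otimes> y \<otimes> inv x \<in> ?J" using e x y by simp
        then show ?thesis using c(2)[OF y] x by simp
      qed
      then show False using J J.subset by blast
    qed
    ultimately have e: "?J = M" using M by (simp add: maximal_subgroup_def)
    have "y \<in> ?M" if y: "y \<in> J" for y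
    proof -
      have yG: "y \<in> carrier G" using y J.subset by blast
      then have "x \<otimes> y \<otimes> inv x \<in> ?J" using c(2)[OF yG] x y by simp
      then show ?thesis using e yG by simp
    qed
    then show "J = ?M" using J by blast
  qed
  assume fin: "finite (rcosets M)"
  have "finite ((\<lambda>y. ?M #> y) ` carrier G)"
  proof (rule finite_image_factor[where g = "\<lambda>y. M #> (x \<otimes> y \<otimes> inv x)"])
    show "finite ((\<lambda>y. M #> (x \<otimes> y \<otimes> inv x)) ` carrier G)"
      by (rule finite_subset[OF _ fin]) (use x in \<open>auto intro!: rcosetsI M.subset\<close>)
    fix y z assume yz: "y \<in> carrier G" "z \<in> carrier G"
      "M #> (x \<otimes> y \<otimes> inv x) = M #> (x \<otimes> z \<otimes> inv x)"
    then have "(x \<otimes> y \<otimes> inv x) \<otimes> inv (x \<otimes> z \<otimes> inv x) \<in> M" using rcos_eq_iff[OF sM] x by simp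
    then have "y \<otimes> inv z \<in> ?M" using x yz(1,2) by (simp add: inv_mult_group m_assoc inv_mult_cancel)
    then show "?M #> y = ?M #> z" using rcos_eq_iff[OF s] yz by simp
  qed
  moreover have "rcosets ?M = (\<lambda>y. ?M #> y) ` carrier G" by (auto simp: RCOSETS_def)
  ultimately show "finite (rcosets ?M)" by simp
qed

text \<open>The correspondence theorem for subgroups above \<open>I\<close>. The third claim lets
  membership of a coset be tested on any representative.\<close>

lemma maximal_subgroup_quotient:
  assumes I: "I \<lhd> G" and M: "maximal_subgroup M G" "I \<subseteq> M"
  defines "M' \<equiv> (\<lambda>x. I #> x) ` M"
  shows "maximal_subgroup M' (G Mod I)"
    "finite (rcosets M) \<Longrightarrow> finite (rcosets\<^bsub>G Mod I\<^esub> M')"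
    "\<And>x. x \<in> carrier G \<Longrightarrow> I #> x \<in> M' \<longleftrightarrow> x \<in> M"
proof -
  have sM: "subgroup M G" and "M \<noteq> carrier G" using M by (auto simp: maximal_subgroup_def)
  interpret M: subgroup M G by fact
  interpret I: normal I G by fact
  interpret Q: group "G Mod I" by (rule I.factorgroup_is_group)
  interpret q: group_hom G "G Mod I" "\<lambda>x. I #> x"
    using I.r_coset_hom_Mod by (simp add: group_hom_def group_hom_axioms_def Q.is_group)
  have s: "subgroup M' (G Mod I)" unfolding M'_def by (rule q.subgroup_img_is_subgroup[OF sM])
  have surj: "\<exists>x \<in> carrier G. y = I #> x" if "y \<in> carrier (G Mod I)" for y
    using that by (auto simp: carrier_FactGroup)
  show mem: "I #> x \<in> M' \<longleftrightarrow> x \<in> M" if x: "x \<in> carrier G" for x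
  proof
    assume "I #> x \<in> M'"
    then obtain m where m: "m \<in> M" "I #> x = I #> m" by (auto simp: M'_def)
    then have "x \<otimes> inv m \<in> M" using rcos_eq_iff[OF I.subgroup_axioms x] M(2) M.subset by blast
    then have "(x \<otimes> inv m) \<otimes> m \<in> M" using m by blast
    then show "x \<in> M" using x m M.subset by (simp add: m_assoc subsetD)
  qed (auto simp: M'_def)
  show "maximal_subgroup M' (G Mod I)" unfolding maximal_subgroup_def
  proof (intro conjI allI impI s)
    obtain z where z: "z \<in> carrier G" "z \<notin> M" using \<open>M \<noteq> carrier G\<close> M.subset by blast
    then show "M' \<noteq> carrier (G Mod I)" using mem[OF z(1)] q.hom_closed[OF z(1)] by metis
    fix J assume J: "subgroup J (G Mod I) \<and> M' \<subseteq> J \<and> J \<noteq> carrier (G Mod I)"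
    interpret J: subgroup J "G Mod I" using J by blast
    let ?J = "{x \<in> carrier G. I #> x \<in> J}"
    have "subgroup ?J G"
    proof (rule subgroupI)
      have "\<one> \<in> ?J" using q.hom_one J.one_closed by simp
      then show "?J \<noteq> {}" by blast
      show "inv a \<in> ?J" if a: "a \<in> ?J" for a
      proof -
        have "inv\<^bsub>G Mod I\<^esub> (I #> a) \<in> J" using a J.m_inv_closed by blast
        then have "I #> inv a \<in> J" using q.hom_inv[of a] a by (simp del: q.hom_inv)
        then show ?thesis using a by simp
      qed
      show "a \<otimes> b \<in> ?J" if ab: "a \<in> ?J" "b \<in> ?J" for a b
      proof -
        have "(I #> a) \<otimes>\<^bsub>G Mod I\<^esub> (I #> b) \<in> J" using ab J.m_closed by blast
        then have "I #> (a \<otimes> b) \<in> J" using q.hom_mult[of a b] ab by (simp del: q.hom_mult mult_FactGroup)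
        then show ?thesis using ab by simp
      qed
    qed auto
    moreover have "M \<subseteq> ?J" using J M.subset by (auto simp: M'_def)
    moreover have "?J \<noteq> carrier G"
    proof
      assume e: "?J = carrier G"
      have "y \<in> J" if "y \<in> carrier (G Mod I)" for y
        using surj[OF that] e by auto
      then show False using J J.subset by blast
    qed
    ultimately have e: "?J = M" using M(1) by (simp add: maximal_subgroup_def)
    have "y \<in> M'" if y: "y \<in> J" for y
    proof -
      obtain x where x: "x \<in> carrier G" "y = I #> x" using surj y J.subset by blast
      then have "x \<in> ?J" using y by simp
      then show ?thesis using e x by (simp add: M'_def)
    qed
    then show "J = M'" using J by blast
  qed
  assume fin: "finite (rcosets M)"
  have "finite ((\<lambda>x. M' #>\<^bsub>G Mod I\<^esub> (I #> x)) ` carrier G)"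
  proof (rule finite_image_factor[where g = "\<lambda>x. M #> x"])
    show "finite ((\<lambda>x. M #> x) ` carrier G)"
      by (rule finite_subset[OF _ fin]) (auto intro!: rcosetsI M.subset)
    fix x y assume xy: "x \<in> carrier G" "y \<in> carrier G" "M #> x = M #> y"
    then have "x \<otimes> inv y \<in> M" using rcos_eq_iff[OF sM] by simp
    then have "I #> (x \<otimes> inv y) \<in> M'" by (auto simp: M'_def)
    then have "(I #> x) \<otimes>\<^bsub>G Mod I\<^esub> inv\<^bsub>G Mod I\<^esub> (I #> y) \<in> M'"
      using q.hom_mult[of x "inv y"] q.hom_inv[of y] xy by simp
    then show "M' #>\<^bsub>G Mod I\<^esub> (I #> x) = M' #>\<^bsub>G Mod I\<^esub> (I #> y)"
      using Q.rcos_eq_iff[OF s q.hom_closed[OF xy(1)] q.hom_closed[OF xy(2)]] by simp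
  qed
  moreover have "rcosets\<^bsub>G Mod I\<^esub> M' = (\<lambda>x. M' #>\<^bsub>G Mod I\<^esub> (I #> x)) ` carrier G"
    by (auto simp: RCOSETS_def carrier_FactGroup)
  ultimately show "finite (rcosets\<^bsub>G Mod I\<^esub> M')" by simp
qed

section \<open>Inner automorphisms\<close>

definition inn :: "'a \<Rightarrow> 'a \<Rightarrow> 'a" where
  "inn g = (\<lambda>x \<in> carrier G. g \<otimes> x \<otimes> inv g)"

lemma inner_auto_eq: "inner_auto G = inn ` carrier G"
  by (auto simp: inner_auto_def inn_def)

lemma inn_auto:
  assumes "g \<in> carrier G"
  shows "inn g \<in> auto G"
proof (rule autoI[where \<chi> = "\<lambda>x. inv g \<otimes> x \<otimes> g"])
  show "inn g \<in> hom G G" using assms by (auto simp: inn_def hom_def m_assoc inv_mult_cancel)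
qed (use assms in \<open>auto simp: inn_def m_assoc inv_mult_cancel\<close>)

lemma inn_mult:
  assumes "g \<in> carrier G" "h \<in> carrier G"
  shows "inn g \<otimes>\<^bsub>AutoGroup G\<^esub> inn h = inn (g \<otimes> h)"
proof -
  interpret A: group "AutoGroup G" by (rule AutoGroup)
  show ?thesis
  proof (rule auto_eqI)
    show "inn g \<otimes>\<^bsub>AutoGroup G\<^esub> inn h \<in> auto G" "inn (g \<otimes> h) \<in> auto G"
      using A.m_closed[of "inn g" "inn h"] inn_auto assms by auto
    fix x assume "x \<in> carrier G"
    then show "(inn g \<otimes>\<^bsub>AutoGroup G\<^esub> inn h) x = inn (g \<otimes> h) x"
      using assms by (subst AutoGroup_mult) (auto simp: inn_auto, simp add: inn_def m_assoc inv_mult_group)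
  qed
qed

lemma inn_one: "inn \<one> = \<one>\<^bsub>AutoGroup G\<^esub>"
proof -
  interpret A: group "AutoGroup G" by (rule AutoGroup)
  show ?thesis
    using A.one_closed by (intro auto_eqI inn_auto) (auto simp: AutoGroup_one inn_def)
qed

text \<open>The conjugate of \<open>inn g\<close> by \<open>\<theta>\<close> is
  \<open>inn (\<theta> g)\<close>.\<close>

lemma inner_auto_normal: "inner_auto G \<lhd> AutoGroup G"
proof -
  interpret A: group "AutoGroup G" by (rule AutoGroup)
  show ?thesis
  proof (rule A.normal_invI)
    show "subgroup (inner_auto G) (AutoGroup G)"
    proof (rule A.subgroupI)
      show "inner_auto G \<subseteq> carrier (AutoGroup G)" "inner_auto G \<noteq> {}"
        using inn_auto by (auto simp: inner_auto_eq)
      show "inv\<^bsub>AutoGroup G\<^esub> a \<in> inner_auto G" if a: "a \<in> inner_auto G" for a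
      proof -
        obtain g where g: "g \<in> carrier G" "a = inn g" using a by (auto simp: inner_auto_eq)
        have "inn (inv g) \<otimes>\<^bsub>AutoGroup G\<^esub> inn g = \<one>\<^bsub>AutoGroup G\<^esub>" using g by (simp add: inn_mult inn_one)
        then have "inv\<^bsub>AutoGroup G\<^esub> a = inn (inv g)"
          using A.inv_equality g inn_auto by simp
        then show ?thesis using g by (simp add: inner_auto_eq)
      qed
      show "a \<otimes>\<^bsub>AutoGroup G\<^esub> b \<in> inner_auto G" if "a \<in> inner_auto G" "b \<in> inner_auto G" for a b
        using that by (auto simp: inner_auto_eq inn_mult)
    qed
    fix \<theta> h assume \<theta>: "\<theta> \<in> carrier (AutoGroup G)" and "h \<in> inner_auto G"
    then obtain g where g: "g \<in> carrier G" "h = inn g" by (auto simp: inner_auto_eq)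
    have a: "\<theta> \<in> auto G" using \<theta> by simp
    note D = autoD(4,5,7)[OF a]
    have i: "inv\<^bsub>AutoGroup G\<^esub> \<theta> \<in> auto G" using A.inv_closed[OF \<theta>] by simp
    have ig: "inn g \<in> auto G" using g inn_auto by simp
    have th: "\<theta> \<otimes>\<^bsub>AutoGroup G\<^esub> inn g \<in> auto G" using A.m_closed[of \<theta> "inn g"] a ig by simp
    have "\<theta> \<otimes>\<^bsub>AutoGroup G\<^esub> inn g \<otimes>\<^bsub>AutoGroup G\<^esub> inv\<^bsub>AutoGroup G\<^esub> \<theta> = inn (\<theta> g)"
    proof (rule auto_eqI)
      show "\<theta> \<otimes>\<^bsub>AutoGroup G\<^esub> inn g \<otimes>\<^bsub>AutoGroup G\<^esub> inv\<^bsub>AutoGroup G\<^esub> \<theta> \<in> auto G"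
        using A.m_closed[of "\<theta> \<otimes>\<^bsub>AutoGroup G\<^esub> inn g" "inv\<^bsub>AutoGroup G\<^esub> \<theta>"] th i by simp
      show "inn (\<theta> g) \<in> auto G" using D g inn_auto by simp
      fix x assume x: "x \<in> carrier G"
      have y: "(inv\<^bsub>AutoGroup G\<^esub> \<theta>) x \<in> carrier G" using autoD(4)[OF i x] .
      have "(\<theta> \<otimes>\<^bsub>AutoGroup G\<^esub> inn g \<otimes>\<^bsub>AutoGroup G\<^esub> inv\<^bsub>AutoGroup G\<^esub> \<theta>) x
          = \<theta> (inn g ((inv\<^bsub>AutoGroup G\<^esub> \<theta>) x))"
        using AutoGroup_mult[OF th i x] AutoGroup_mult[OF a ig y] by simp
      also have "\<dots> = \<theta> g \<otimes> \<theta> ((inv\<^bsub>AutoGroup G\<^esub> \<theta>) x) \<otimes> inv (\<theta> g)"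
        using D y g by (simp add: inn_def)
      also have "\<dots> = inn (\<theta> g) x" using AutoGroup_inv(1)[OF a x] x by (simp add: inn_def)
      finally show "(\<theta> \<otimes>\<^bsub>AutoGroup G\<^esub> inn g \<otimes>\<^bsub>AutoGroup G\<^esub> inv\<^bsub>AutoGroup G\<^esub> \<theta>) x = inn (\<theta> g) x" .
    qed
    then show "\<theta> \<otimes>\<^bsub>AutoGroup G\<^esub> h \<otimes>\<^bsub>AutoGroup G\<^esub> inv\<^bsub>AutoGroup G\<^esub> \<theta> \<in> inner_auto G"
      using g D by (simp add: inner_auto_eq)
  qed
qed

end

section \<open>Traces of parabolic words\<close>

text \<open>Generator \<open>i\<close> is sent to a transvection fixing the \<open>i\<close>-th of a family of pairwise independent
  vectors \<open>v\<^sub>i\<close>: the matrix is \<open>1 + z v\<^sub>i w\<^sub>i\<^sup>T\<close> with \<open>w\<^sub>i\<^sup>T v\<^sub>k\<close> zero only for \<open>i = k\<close>.\<close>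

definition vx :: "nat \<Rightarrow> int" where "vx i = (if i = 0 then 1 else int i - 1)"
definition vy :: "nat \<Rightarrow> int" where "vy i = (if i = 0 then 0 else 1)"
text \<open>The sign makes index 1 give \<open>lower z\<close> and not \<open>lower (- z)\<close>:
  the first two generators must carry the same parameter.\<close>

definition vs :: "nat \<Rightarrow> int" where "vs i = (if i = 0 then 1 else - 1)"

definition pairing :: "nat \<Rightarrow> nat \<Rightarrow> int" where
  "pairing i k = vs i * (vx i * vy k - vy i * vx k)"

lemma pairing_nz: "i \<noteq> k \<Longrightarrow> pairing i k \<noteq> 0"
  by (auto simp: pairing_def vx_def vy_def vs_def)

text \<open>The matrix c v_k w_j^T, with w_j equal to \<open>vs j\<close> times the vector with
  entries - \<open>vy j\<close> and \<open>vx j\<close>. Products of such matrices collapse, at the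
  price of a pairing.\<close>

definition rank1 :: "nat \<Rightarrow> nat \<Rightarrow> int \<Rightarrow> int mat2" where
  "rank1 k j c = Mat (- c * vx k * vs j * vy j) (c * vx k * vs j * vx j)
    (- c * vy k * vs j * vy j) (c * vy k * vs j * vx j)"

lemma rank1_mult: "mmul (rank1 i i' c) (rank1 k j d) = rank1 i j (c * d * pairing i' k)"
  by (simp add: rank1_def pairing_def algebra_simps)

lemma mtr_rank1: "mtr (rank1 k j c) = c * pairing j k"
  by (simp add: rank1_def pairing_def algebra_simps)

text \<open>Polymorphic, because the parameter will be both an integer and the indeterminate of a
  polynomial ring.\<close>

definition parab :: "nat \<Rightarrow> 'a::comm_ring_1 \<Rightarrow> 'a mat2" where
  "parab i z = Mat (1 - of_int (vs i * vx i * vy i) * z) (of_int (vs i * vx i * vx i) * z)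
    (- of_int (vs i * vy i * vy i) * z) (1 + of_int (vs i * vx i * vy i) * z)"

lemma parab_mult: "mmul (parab i y) (parab i z) = parab i (y + z)"
  by (simp add: parab_def algebra_simps)

lemma mdet_parab [simp]: "mdet (parab i z) = 1"
  by (simp add: parab_def algebra_simps)

lemma madj_parab: "madj (parab i z) = parab i (- z)"
  by (simp add: parab_def)

lemma parab_simps:
  "parab 0 z = upper z" "parab (Suc 0) z = lower z"
  by (simp_all add: parab_def vs_def vx_def vy_def unip_defs)

section \<open>Leading coefficients of words in the parabolic matrices\<close>

lemma mtr_sel: "mtr M = m11 M + m22 M"
  by (cases M) simp

text \<open>\<open>s\<close> only bounds the degrees and \<open>C\<close> may vanish; in this lax
  form the notion is multiplicative.\<close>

definition has_lead :: "int poly mat2 \<Rightarrow> nat \<Rightarrow> int mat2 \<Rightarrow> bool" where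
  "has_lead M s C \<longleftrightarrow>
    degree (m11 M) \<le> s \<and> degree (m12 M) \<le> s \<and> degree (m21 M) \<le> s \<and> degree (m22 M) \<le> s \<and>
    C = Mat (coeff (m11 M) s) (coeff (m12 M) s) (coeff (m21 M) s) (coeff (m22 M) s)"

lemma coeff_mult_degree_le:
  fixes p q :: "int poly"
  assumes "degree p \<le> s" "degree q \<le> t"
  shows "coeff (p * q) (s + t) = coeff p s * coeff q t"
proof -
  have "coeff (p * q) (s + t) = (\<Sum>i\<le>s + t. coeff p i * coeff q (s + t - i))" by (simp add: coeff_mult)
  also have "\<dots> = (\<Sum>i\<in>{s}. coeff p i * coeff q (s + t - i))"
  proof (rule sum.mono_neutral_right)
    show "\<forall>i\<in>{..s + t} - {s}. coeff p i * coeff q (s + t - i) = 0"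
    proof
      fix i assume "i \<in> {..s + t} - {s}"
      then consider "i > s" | "s + t - i > t" by force
      then show "coeff p i * coeff q (s + t - i) = 0"
        using assms by cases (auto simp: coeff_eq_0)
    qed
  qed auto
  finally show ?thesis by simp
qed

lemma has_lead_mult:
  assumes "has_lead M s C" "has_lead N t D"
  shows "has_lead (mmul M N) (s + t) (mmul C D)"
proof -
  obtain a b c d a' b' c' d' where M: "M = Mat a b c d" "N = Mat a' b' c' d'"
    by (cases M; cases N) auto
  have "degree (p * p' + q * q') \<le> s + t \<and> coeff (p * p' + q * q') (s + t) = coeff p s * coeff p' t + coeff q s * coeff q' t"
    if "degree p \<le> s" "degree q \<le> s" "degree p' \<le> t" "degree q' \<le> t" for p q p' q' :: "int poly"
    using that degree_mult_le[of p p'] degree_mult_le[of q q']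
    by (auto simp: coeff_mult_degree_le intro!: degree_add_le)
  then show ?thesis using assms by (auto simp: has_lead_def M)
qed

lemma has_lead_parab: "has_lead (parab i [:0, e:]) 1 (rank1 i i e)"
proof -
  have "of_int x = ([:x:] :: int poly)" for x :: int by (simp add: of_int_poly)
  then show ?thesis
    by (auto simp: has_lead_def parab_def rank1_def degree_diff_le degree_add_le one_pCons algebra_simps)
qed

definition parab_rep :: "'a::comm_ring_1 \<Rightarrow> letter list \<Rightarrow> 'a mat2" where
  "parab_rep z = word_val SL2 (\<lambda>i. parab i z)"

lemma parab_rep_Cons:
  "parab_rep z (a # w) = mmul (parab (fst a) (if snd a then z else - z)) (parab_rep z w)"
  by (simp add: parab_rep_def letter_val_def SL2_simps inv_SL2 madj_parab)

lemma parab_rep_Nil: "parab_rep z [] = Mat 1 0 0 1"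
  by (simp add: parab_rep_def SL2_simps)

lemma parab_rep_hom: "parab_rep z \<in> hom (free_group n) SL2"
  unfolding parab_rep_def by (rule group.word_val_hom[OF group_SL2]) (auto simp: SL2_simps)

lemma parab_rep_gen: "parab_rep z (gen i) = parab i z"
  by (simp add: gen_def parab_rep_Cons parab_rep_Nil)

lemma parab_rep_eval: "mtr (parab_rep t w) = poly (mtr (parab_rep [:0, 1:] w)) (t :: int)"
proof -
  define ev where "ev = map_mat2 (\<lambda>q. poly q t)"
  have "ev (mmul M N) = mmul (ev M) (ev N)" for M N
    by (cases M; cases N) (simp add: ev_def)
  moreover have "ev (parab i [:0, 1:]) = parab i t" "ev (parab i (- [:0, 1:])) = parab i (- t)" for i
    by (simp_all add: ev_def parab_def of_int_poly)
  ultimately have "ev (parab_rep [:0, 1:] w) = parab_rep t w"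
    by (induction w) (auto simp: parab_rep_Cons parab_rep_Nil, simp add: ev_def)
  moreover have "poly (mtr M) t = mtr (ev M)" for M by (cases M) (simp add: ev_def)
  ultimately show ?thesis by simp
qed

text \<open>A reduced word is a product of maximal runs of equal letters. Each run is a transvection
  with nonzero slope in the indeterminate, and the top coefficients multiply to a rank one matrix
  times pairings of neighbouring, hence distinct, indices. The first run stays separate because a
  letter prepended later may extend it.\<close>

lemma parab_rep_run:
  assumes "reduced w" "w \<noteq> []"
  shows "\<exists>e R. (if snd (hd w) then e > 0 else e < 0) \<and>
    parab_rep [:0, 1:] w = mmul (parab (fst (hd w)) [:0, e:]) R \<and>
    (R = Mat 1 0 0 1 \<and> fst (last w) = fst (hd w) \<or>
     (\<exists>s c k. c \<noteq> 0 \<and> k \<noteq> fst (hd w) \<and> has_lead R s (rank1 k (fst (last w)) c)))"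
  using assms
proof (induction w)
  case (Cons a w)
  show ?case
  proof (cases "w = []")
    case True
    then show ?thesis
      by (intro exI[of _ "if snd a then 1 else - 1"] exI[of _ "Mat 1 0 0 1"])
        (auto simp: parab_rep_Cons parab_rep_Nil)
  next
    case False
    have "reduced w" using Cons.prems by (simp add: reduced_Cons_iff)
    then obtain e R where e: "if snd (hd w) then e > 0 else e < 0"
      and R: "parab_rep [:0, 1:] w = mmul (parab (fst (hd w)) [:0, e:]) R"
      and alt: "R = Mat 1 0 0 1 \<and> fst (last w) = fst (hd w) \<or>
        (\<exists>s c k. c \<noteq> 0 \<and> k \<noteq> fst (hd w) \<and> has_lead R s (rank1 k (fst (last w)) c))"
      using Cons.IH[OF _ False] by blast
    show ?thesis
    proof (cases "fst a = fst (hd w)")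
      case True
      \<comment> \<open>Reducedness gives equal signs inside a run, so slopes add without
        cancelling.\<close>
      then have a: "a = hd w" using Cons.prems(1) False letter_cases[OF True] by (auto simp: reduced_Cons_iff)
      define e' where "e' = (if snd a then 1 + e else - 1 + e)"
      have "parab_rep [:0, 1:] (a # w) = mmul (parab (fst a) [:0, e':]) R"
        by (simp add: parab_rep_Cons R flip: mmul_assoc True) (simp add: parab_mult e'_def)
      moreover have "if snd a then e' > 0 else e' < 0" using e a by (auto simp: e'_def)
      ultimately show ?thesis using alt False a by (intro exI[of _ e'] exI[of _ R]) auto
    next
      case neq: False
      have nz: "e \<noteq> 0" using e by (auto split: if_splits)
      \<comment> \<open>A different generator closes the run, whose slope now enters the leading
        matrix.\<close>
      have "\<exists>s c. c \<noteq> 0 \<and> has_lead (parab_rep [:0, 1:] w) s (rank1 (fst (hd w)) (fst (last w)) c)"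
        using alt
      proof
        assume "R = Mat 1 0 0 1 \<and> fst (last w) = fst (hd w)"
        then show ?thesis using R has_lead_parab[of "fst (hd w)" e] nz by auto
      next
        assume "\<exists>s c k. c \<noteq> 0 \<and> k \<noteq> fst (hd w) \<and> has_lead R s (rank1 k (fst (last w)) c)"
        then obtain s c k where c: "c \<noteq> 0" "k \<noteq> fst (hd w)" "has_lead R s (rank1 k (fst (last w)) c)" by blast
        show ?thesis
          using has_lead_mult[OF has_lead_parab[of "fst (hd w)" e] c(3)] R nz c(1) pairing_nz[OF c(2)[symmetric]]
          unfolding rank1_mult by (intro exI[of _ "1 + s"] exI[of _ "e * c * pairing (fst (hd w)) k"]) simp
      qed
      then obtain s c where "c \<noteq> 0" "has_lead (parab_rep [:0, 1:] w) s (rank1 (fst (hd w)) (fst (last (a # w))) c)"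
        using False by auto
      then have "\<exists>s c k. c \<noteq> 0 \<and> k \<noteq> fst (hd (a # w)) \<and>
          has_lead (parab_rep [:0, 1:] w) s (rank1 k (fst (last (a # w))) c)"
        using neq by (metis list.sel(1))
      then show ?thesis
        by (intro exI[of _ "if snd a then 1 else - 1"] exI[of _ "parab_rep [:0, 1:] w"])
          (simp add: parab_rep_Cons)
    qed
  qed
qed simp

text \<open>Taking the trace closes the cycle: it contributes the pairing of the last index with the
  first, nonzero because they differ.\<close>

lemma degree_mtr_parab_rep:
  assumes "reduced w" "w \<noteq> []" "fst (hd w) \<noteq> fst (last w)"
  shows "degree (mtr (parab_rep [:0, 1 :: int:] w)) > 0"
proof -
  obtain e R where e: "if snd (hd w) then e > 0 else e < 0"
    and R: "parab_rep [:0, 1:] w = mmul (parab (fst (hd w)) [:0, e:]) R"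
    and alt: "R = Mat 1 0 0 1 \<and> fst (last w) = fst (hd w) \<or>
      (\<exists>s c k. c \<noteq> 0 \<and> k \<noteq> fst (hd w) \<and> has_lead R s (rank1 k (fst (last w)) c))"
    using parab_rep_run[OF assms(1,2)] by blast
  then obtain s c k where c: "c \<noteq> 0" "k \<noteq> fst (hd w)" "has_lead R s (rank1 k (fst (last w)) c)"
    using assms(3) by auto
  define C where "C = rank1 (fst (hd w)) (fst (last w)) (e * c * pairing (fst (hd w)) k)"
  have "has_lead (parab_rep [:0, 1:] w) (1 + s) C"
    using has_lead_mult[OF has_lead_parab[of "fst (hd w)" e] c(3)] R unfolding rank1_mult C_def by simp
  then have "coeff (mtr (parab_rep [:0, 1:] w)) (1 + s) = mtr C"
    by (simp add: has_lead_def mtr_sel)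
  moreover have "e \<noteq> 0" using e by (auto split: if_splits)
  then have "mtr C \<noteq> 0"
    using c pairing_nz[OF c(2)[symmetric]] pairing_nz[OF assms(3)[symmetric]] by (simp add: C_def mtr_rank1)
  ultimately have "coeff (mtr (parab_rep [:0, 1 :: int:] w)) (1 + s) \<noteq> 0" by simp
  then have "1 + s \<le> degree (mtr (parab_rep [:0, 1 :: int:] w))" by (rule le_degree)
  then show ?thesis by simp
qed

text \<open>A nonconstant polynomial takes each value finitely often, so it is unbounded on the
  nonzero integers. The parameter 0 would make the representation trivial.\<close>

lemma unbounded_mtr_parab_rep:
  assumes "reduced w" "w \<noteq> []" "fst (hd w) \<noteq> fst (last w)"
  shows "\<exists>t::int. t \<noteq> 0 \<and> \<bar>mtr (parab_rep t w)\<bar> > 2"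
proof (rule ccontr)
  assume neg: "\<not> ?thesis"
  define q where "q = mtr (parab_rep [:0, 1 :: int:] w)"
  have "poly q ` {t. t \<noteq> 0} \<subseteq> {-2..2}"
    using neg parab_rep_eval[of _ w] by (force simp: q_def)
  then have fin: "finite (poly q ` {t. t \<noteq> 0})" by (rule finite_subset) simp
  have "infinite {t :: int. t \<noteq> 0}"
  proof
    assume "finite {t :: int. t \<noteq> 0}"
    then have "finite (insert 0 {t :: int. t \<noteq> 0})" by simp
    moreover have "insert 0 {t :: int. t \<noteq> 0} = UNIV" by auto
    ultimately show False using infinite_UNIV_int by simp
  qed
  then obtain t0 where "infinite {t \<in> {t. t \<noteq> 0}. poly q t = poly q t0}"
    using pigeonhole_infinite[OF _ fin] by blast
  then have "infinite {t. poly (q - [:poly q t0:]) t = 0}"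
    by (rule contrapos_nn) (rule finite_subset, auto)
  then have "q - [:poly q t0:] = 0" using poly_roots_finite by blast
  then have "degree q = 0" by (metis degree_pCons_0 eq_iff_diff_eq_0)
  then show False using degree_mtr_parab_rep[OF assms] by (simp add: q_def)
qed

section \<open>Automorphisms contained in all maximal subgroups of finite index\<close>

context free_group_rank
begin

text \<open>The preimage in the automorphism group of the intersection of all finite-index maximal
  subgroups of the quotient, so that the argument can be run upstairs; if there were none, it would
  be the whole group.\<close>

definition core :: "(letter list \<Rightarrow> letter list) set" where
  "core = {\<phi> \<in> auto F. \<forall>M. maximal_subgroup M A \<longrightarrow> finite (rcosets\<^bsub>A\<^esub> M) \<longrightarrow> inner_auto F \<subseteq> M \<longrightarrow> \<phi> \<in> M}"

lemma core_auto: "\<phi> \<in> core \<Longrightarrow> \<phi> \<in> auto F"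
  by (simp add: core_def)

lemma core_mult:
  assumes "\<phi> \<in> core" "\<psi> \<in> core"
  shows "\<phi> \<odot> \<psi> \<in> core"
  using assms by (auto simp: core_def maximal_subgroup_def subgroup.m_closed)

lemma inn_core: "g \<in> carrier F \<Longrightarrow> F.inn g \<in> core"
  using F.inn_auto by (auto simp: core_def F.inner_auto_eq)

text \<open>Conjugation permutes the maximal subgroups in question: they still contain the inner
  automorphisms, which form a normal subgroup.\<close>

lemma core_conj:
  assumes \<phi>: "\<phi> \<in> core" and \<theta>: "\<theta> \<in> auto F"
  shows "\<theta> \<odot> \<phi> \<odot> inv\<^sub>A \<theta> \<in> core"
  unfolding core_def
proof (intro CollectI conjI allI impI)
  show "\<theta> \<odot> \<phi> \<odot> inv\<^sub>A \<theta> \<in> auto F" using core_auto[OF \<phi>] \<theta> by simp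
  fix M assume M: "maximal_subgroup M A" "finite (rcosets\<^bsub>A\<^esub> M)" "inner_auto F \<subseteq> M"
  interpret I: normal "inner_auto F" A by (rule F.inner_auto_normal)
  let ?M = "{\<psi> \<in> carrier A. \<theta> \<odot> \<psi> \<odot> inv\<^sub>A \<theta> \<in> M}"
  have \<theta>A: "\<theta> \<in> carrier A" using \<theta> by simp
  have "inner_auto F \<subseteq> ?M"
  proof
    fix h assume h: "h \<in> inner_auto F"
    have "\<theta> \<odot> h \<odot> inv\<^sub>A \<theta> \<in> M" using I.inv_op_closed2[OF \<theta>A h] M(3) by blast
    then show "h \<in> ?M" using h I.subset by blast
  qed
  then have "\<phi> \<in> ?M"
    using \<phi> A.maximal_subgroup_conj[OF M(1) \<theta>A] M(2) unfolding core_def by blast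
  then show "\<theta> \<odot> \<phi> \<odot> inv\<^sub>A \<theta> \<in> M" by simp
qed

lemma conj_apply:
  assumes "\<theta> \<in> auto F" "\<phi> \<in> auto F" "w \<in> carrier F"
  shows "(\<theta> \<odot> \<phi> \<odot> inv\<^sub>A \<theta>) (\<theta> w) = \<theta> (\<phi> w)"
proof -
  have c: "\<theta> w \<in> carrier F" using aut_apply[OF assms(1,3)] .
  have "(\<theta> \<odot> \<phi> \<odot> inv\<^sub>A \<theta>) (\<theta> w) = (\<theta> \<odot> \<phi>) ((inv\<^sub>A \<theta>) (\<theta> w))"
    by (rule aut_mult_apply) (use assms c in auto)
  then show ?thesis using assms by (simp add: F.AutoGroup_inv aut_mult_apply)
qed

text \<open>Maximality of a stabiliser requires a basis element in the kernel. Some \<open>u\<close>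
  avoiding \<open>x_2\<close> inverts the image of \<open>x_2\<close> modulo \<open>p\<close>;
  precomposing with x_2 to x_2 u puts \<open>x_2\<close> into the kernel, and invariance of
  \<open>core\<close> under conjugation undoes the change.\<close>

lemma core_pker:
  assumes \<phi>: "\<phi> \<in> core" and rep: "unipotent_rep n \<rho> p t" and w: "w \<in> carrier F"
  shows "\<phi> w \<in> pker p \<rho> \<longleftrightarrow> w \<in> pker p \<rho>"
proof -
  interpret R: unipotent_rep n \<rho> p t by fact
  have l: "2 < n" using R.n3 by simp
  have "p dvd mdet (madj (\<rho> (gen 2))) - 1" using l by (simp add: R.rho_simps)
  then obtain u where u: "avoids 2 u" "mcong p (\<rho> u) (madj (\<rho> (gen 2)))"
    using R.rho_surj[of 2] by blast
  note uF = avoidsD[OF u(1)]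
  note one = avoids_one(1)[of 2]
  define T where "T = transv 2 [] u"
  have Ta: "T \<in> auto F" unfolding T_def using transv_auto[OF l one u(1)] .
  have TF: "T v \<in> carrier F" if "v \<in> carrier F" for v using aut_apply[OF Ta that] .
  have Tg: "T (gen 2) = gen 2 \<cdot> u"
    unfolding T_def using transv_gen[OF l one u(1)] F.l_one[of "gen 2"] l by (simp add: free_group_simps(3))
  define \<rho>' where "\<rho>' = \<rho> \<circ> T"
  have "unipotent_rep n \<rho>' p t"
  proof
    show "\<rho>' \<in> hom F SL2" unfolding \<rho>'_def using hom_compose[OF F.autoD(1)[OF Ta] R.rho] .
    show "\<rho>' (gen 0) = upper t" "\<rho>' (gen 1) = lower t"
      using transv_gen_other[OF l one u(1)] R.rho0 R.rho1 R.n3 by (simp_all add: \<rho>'_def T_def)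
  qed (use R.p R.pt R.n3 in auto)
  then interpret R': unipotent_rep n \<rho>' p t .
  have "mcong p (mmul (\<rho> (gen 2)) (\<rho> u)) (mmul (\<rho> (gen 2)) (madj (\<rho> (gen 2))))"
    using mcong_mmul[OF mcong_refl u(2)] .
  then have "mcong p (\<rho>' (gen 2)) (Mat 1 0 0 1)"
    using l uF by (simp add: \<rho>'_def Tg R.rho_simps mmul_madj)
  then have g2: "gen 2 \<in> pker p \<rho>'" using l by (simp add: pker_def)
  note max = R'.stab_pker_maximal[OF l g2]
  have inner: "inner_auto F \<subseteq> stab (pker p \<rho>')"
    using inner_auto_stab[OF R'.K_normal] F.inn_auto by (auto simp: F.inner_auto_eq)
  have pk: "v \<in> pker p \<rho>' \<longleftrightarrow> T v \<in> pker p \<rho>" if "v \<in> carrier F" for v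
    using that TF by (simp add: pker_def \<rho>'_def)
  \<comment> \<open>The new kernel is the preimage of the old one under \<open>T\<close>; its
    inverse \<open>S\<close> carries the conclusion back.\<close>
  define S where "S = inv\<^sub>A T"
  have Sa: "S \<in> auto F" using Ta by (simp add: S_def)
  have TS: "T (S v) = v" if "v \<in> carrier F" for v using F.AutoGroup_inv(1)[OF Ta that] by (simp add: S_def)
  have "S \<odot> \<phi> \<odot> inv\<^sub>A S \<in> stab (pker p \<rho>')"
    using core_conj[OF \<phi> Sa] max inner by (simp add: core_def)
  then have "(S \<odot> \<phi> \<odot> inv\<^sub>A S) (S w) \<in> pker p \<rho>' \<longleftrightarrow> S w \<in> pker p \<rho>'"
    using aut_apply[OF Sa w] by (simp add: stab_def)
  then have "S (\<phi> w) \<in> pker p \<rho>' \<longleftrightarrow> S w \<in> pker p \<rho>'"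
    using conj_apply[OF Sa core_auto[OF \<phi>] w] by simp
  moreover have "\<phi> w \<in> carrier F" using aut_apply[OF core_auto[OF \<phi>] w] .
  ultimately show ?thesis using pk aut_apply[OF Sa] w TS by simp
qed

section \<open>The trace bound for the image of the first generator\<close>

lemma mtr_square:
  fixes M :: "int mat2"
  shows "mdet M = 1 \<Longrightarrow> mtr (mmul M M) = mtr M * mtr M - 2"
  by (cases M) (simp add: algebra_simps)

text \<open>Modulo \<open>p\<close> the image of the first generator is conjugate to its fourth power. Up to
  sign, the automorphism \<open>\<phi>\<close> preserves this relation, which bounds the trace of the image of the generator.\<close>

lemma core_mtr:
  fixes \<rho> :: "letter list \<Rightarrow> int mat2"
  assumes \<phi>: "\<phi> \<in> core" and n3: "n \<ge> 3" and rho: "\<rho> \<in> hom F SL2" and t: "t \<noteq> 0"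
    and rho0: "\<rho> (gen 0) = upper t" and rho1: "\<rho> (gen 1) = lower t"
  shows "\<bar>mtr (\<rho> (\<phi> (gen 0)))\<bar> \<le> 2"
proof -
  define A where "A = \<rho> (\<phi> (gen 0))"
  define \<tau> where "\<tau> = mtr A"
  \<comment> \<open>The trace of the fourth power of a matrix of determinant 1 and trace
    \<open>\<tau>\<close>.\<close>
  define \<sigma> where "\<sigma> = (\<tau> * \<tau> - 2) * (\<tau> * \<tau> - 2) - 2"
  \<comment> \<open>The prime is chosen after \<open>\<phi>\<close> and \<open>\<rho>\<close> and
    exceeds all differences to be compared, so congruences become equalities.\<close>
  obtain q :: nat where q: "prime q" "q > nat (\<bar>\<sigma>\<bar> + \<bar>\<tau>\<bar> + \<bar>t\<bar> + 5)" using bigger_prime by blast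
  define p where "p = int q"
  have p: "prime p" "p > \<bar>\<sigma>\<bar> + \<bar>\<tau>\<bar> + \<bar>t\<bar> + 5" using q by (auto simp: p_def)
  have small: "m = 0" if "p dvd m" "\<bar>m\<bar> < p" for m
    using that zdvd_imp_le[of p "\<bar>m\<bar>"] by (cases "m = 0") auto
  have rep: "unipotent_rep n \<rho> p t"
  proof
    have "\<bar>t\<bar> < p" using p(2) by linarith
    then show "\<not> p dvd t" using small[of t] t by blast
  qed (use rho rho0 rho1 p n3 in auto)
  then interpret R: unipotent_rep n \<rho> p t .
  have "\<bar>2\<bar> < p" using p(2) by linarith
  then have "\<not> p dvd 2" using small[of 2] by auto
  then obtain h where h: "p dvd 2 * h - 1" using prime_inverse[OF p(1)] by blast
  then have "p dvd mdet (Mat 2 0 0 h) - 1" by simp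
  \<comment> \<open>Conjugation by diag(2, 1/2) multiplies the entry of an upper unipotent by
    4.\<close>
  then obtain d where d: "avoids 2 d" "mcong p (\<rho> d) (Mat 2 0 0 h)" using R.rho_surj[of 2] by blast
  note dF = avoidsD[OF d(1)]
  define a where "a = gen 0"
  have aF: "a \<in> carrier F" using n3 by (simp add: a_def)
  \<comment> \<open>The relator saying that \<open>d\<close> conjugates \<open>a\<close> to its
    fourth power, valid modulo \<open>p\<close>.\<close>
  define e where "e = (d \<cdot> a \<cdot> inv\<^sub>F d) \<cdot> inv\<^sub>F ((a \<cdot> a) \<cdot> (a \<cdot> a))"
  have eF: "e \<in> carrier F" using aF dF by (simp add: e_def)
  have U4: "mmul (mmul (upper t) (upper t)) (mmul (upper t) (upper t)) = upper (4 * t)"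
    by (simp add: unip_defs)
  have "\<rho> e = mmul (mmul (mmul (\<rho> d) (upper t)) (madj (\<rho> d))) (madj (upper (4 * t)))"
    using aF dF by (simp add: e_def R.rho_simps a_def rho0 U4)
  moreover have "mcong p (mmul (mmul (mmul (\<rho> d) (upper t)) (madj (\<rho> d))) (madj (upper (4 * t))))
      (mmul (mmul (mmul (Mat 2 0 0 h) (upper t)) (madj (Mat 2 0 0 h))) (madj (upper (4 * t))))"
    using d(2) by (intro mcong_mmul mcong_madj mcong_refl)
  moreover have "mcong p (mmul (mmul (mmul (Mat 2 0 0 h) (upper t)) (madj (Mat 2 0 0 h))) (madj (upper (4 * t))))
      (Mat 1 0 0 1)"
    using h dvd_comb1[OF h, of "- (8 * h * t) + 4 * t" "- 4 * t"]
    by (simp add: unip_defs mcong_def algebra_simps)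
  ultimately have "mcong p (\<rho> e) (Mat 1 0 0 1)" using mcong_trans by metis
  then have "e \<in> pker p \<rho>" using eF by (simp add: pker_def)
  then have "\<phi> e \<in> pker p \<rho>" using core_pker[OF \<phi> rep eF] by simp
  then have ee: "mcong p (\<rho> (\<phi> e)) (Mat 1 0 0 1) \<or> mcong p (\<rho> (\<phi> e)) (Mat (- 1) 0 0 (- 1))"
    by (simp add: pker_def)
  note D = F.autoD(4,5,7)[OF core_auto[OF \<phi>]]
  define B where "B = \<rho> (\<phi> d)"
  define A4 where "A4 = mmul (mmul A A) (mmul A A)"
  have dets: "mdet A = 1" "mdet B = 1" "mdet A4 = 1"
    using aF dF D by (simp_all add: A_def B_def A4_def R.rho_simps mdet_mmul a_def)
  have \<rho>e: "\<rho> (\<phi> e) = mmul (mmul (mmul B A) (madj B)) (madj A4)"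
    using aF dF by (simp add: e_def D R.rho_simps A_def B_def A4_def a_def)
  have 1: "mmul (\<rho> (\<phi> e)) A4 = mmul (mmul B A) (madj B)"
    unfolding \<rho>e mmul_assoc[of _ "madj A4"] using dets by (simp add: mmul_madj)
  have tr1: "mtr (mmul (\<rho> (\<phi> e)) A4) = \<tau>" using 1 dets by (simp add: mtr_conj \<tau>_def)
  have tr4: "mtr A4 = \<sigma>"
    using mtr_square[of "mmul A A"] mtr_square[of A] dets by (simp add: A4_def \<sigma>_def \<tau>_def mdet_mmul)
  have "mmul (Mat (- 1) 0 0 (- 1)) A4 = Mat (- m11 A4) (- m12 A4) (- m21 A4) (- m22 A4)"
    by (cases A4) simp
  then have trn: "mtr (mmul (Mat (- 1) 0 0 (- 1)) A4) = - \<sigma>" using tr4 by (simp add: mtr_sel)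
  \<comment> \<open>The kernel forgets signs, so the relation between the images holds only up to
    sign.\<close>
  from ee have "\<tau> = \<sigma> \<or> \<tau> = - \<sigma>"
  proof
    assume "mcong p (\<rho> (\<phi> e)) (Mat 1 0 0 1)"
    then have "p dvd \<tau> - \<sigma>" using mcong_mtr[OF mcong_mmul[OF _ mcong_refl[of p A4]]] tr1 tr4 by fastforce
    moreover have "\<bar>\<tau> - \<sigma>\<bar> < p" using p(2) by linarith
    ultimately show ?thesis using small[of "\<tau> - \<sigma>"] by linarith
  next
    assume "mcong p (\<rho> (\<phi> e)) (Mat (- 1) 0 0 (- 1))"
    then have "p dvd \<tau> - - \<sigma>" using mcong_mtr[OF mcong_mmul[OF _ mcong_refl[of p A4]]] tr1 trn by fastforce
    moreover have "\<bar>\<tau> - - \<sigma>\<bar> < p" using p(2) by linarith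
    ultimately show ?thesis using small[of "\<tau> - - \<sigma>"] by linarith
  qed
  then have abs: "\<bar>\<sigma>\<bar> = \<bar>\<tau>\<bar>" by auto
  show ?thesis
  proof (rule ccontr)
    assume "\<not> ?thesis"
    \<comment> \<open>Beyond 2 the fourth power has strictly larger trace: the estimates below give
      at least 21 |\<tau>| - 16.\<close>
    then have "\<bar>\<tau>\<bar> \<ge> 3" by (simp add: \<tau>_def A_def)
    then have "\<tau> * \<tau> \<ge> 3 * \<bar>\<tau>\<bar>" by (metis abs_mult_self_eq abs_ge_zero mult_right_mono)
    then have s: "\<tau> * \<tau> - 2 \<ge> 3 * \<bar>\<tau>\<bar> - 2" "3 * \<bar>\<tau>\<bar> - 2 \<ge> 7" using \<open>\<bar>\<tau>\<bar> \<ge> 3\<close> by auto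
    then have "(\<tau> * \<tau> - 2) * (\<tau> * \<tau> - 2) \<ge> 7 * (3 * \<bar>\<tau>\<bar> - 2)" by (intro mult_mono) auto
    then show False using abs \<open>\<bar>\<tau>\<bar> \<ge> 3\<close> by (simp add: \<sigma>_def)
  qed
qed

text \<open>Mutually inverse ends are removed by a conjugation that shortens the word. If both ends
  are the same letter, rotating the maximal initial run of its generator to the other end makes the
  end generators differ, unless the run is the whole word.\<close>

lemma conj_normal_form:
  assumes "y \<in> carrier F" "y \<noteq> []"
  shows "\<exists>g w. g \<in> carrier F \<and> w \<in> carrier F \<and> w \<noteq> [] \<and> y = g \<cdot> w \<cdot> inv\<^sub>F g \<and>
    ((\<exists>a. w = replicate (length w) a) \<or> fst (hd w) \<noteq> fst (last w))"
  using assms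
proof (induction "length y" arbitrary: y rule: less_induct)
  case less
  have triv: ?case if "(\<exists>a. y = replicate (length y) a) \<or> fst (hd y) \<noteq> fst (last y)"
    using that less.prems by (intro exI[of _ "\<one>\<^bsub>F\<^esub>"] exI[of _ y]) simp
  obtain a y' where y: "y = a # y'" using less.prems(2) by (cases y) auto
  show ?case
  proof (cases "fst (hd y) \<noteq> fst (last y) \<or> y' = []")
    case True
    then show ?thesis
    proof
      assume "y' = []"
      then have "y = replicate (length y) a" using y by simp
      then show ?thesis using triv by blast
    qed (use triv in blast)
  next
    case False
    then obtain m b where y': "y' = m @ [b]" by (metis rev_exhaust)
    have ab: "fst a = fst b" using False y y' by simp
    show ?thesis
    proof (cases "b = a")
      case False
      then have b: "b = letter_inv a" using letter_cases[of b a] ab by simp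
      have mF: "m \<in> carrier F" "[a] \<in> carrier F" "[b] \<in> carrier F"
        using less.prems(1) y y' by (auto simp: free_group_simps(1) reduced_Cons_iff reduced_append_iff)
      have "m \<noteq> []" using less.prems(1) y y' b by (auto simp: free_group_simps(1))
      then obtain g w where gw: "g \<in> carrier F" "w \<in> carrier F" "w \<noteq> []" "m = g \<cdot> w \<cdot> inv\<^sub>F g"
        "(\<exists>a. w = replicate (length w) a) \<or> fst (hd w) \<noteq> fst (last w)"
        using less.hyps[of m] mF y y' by auto
      have "y = [a] \<cdot> (m \<cdot> [b])"
        using append_eq_mult[of "[a]" "m @ [b]"] append_eq_mult[of m "[b]"] append_closed[of "[a]" "m @ [b]"]
          less.prems(1) y y' by simp
      moreover have "[b] = inv\<^sub>F [a]" using b mF by (simp add: inv_free_group)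
      ultimately have "y = ([a] \<cdot> g) \<cdot> w \<cdot> inv\<^sub>F ([a] \<cdot> g)"
        using gw mF by (simp add: F.m_assoc F.inv_mult_group)
      then show ?thesis using gw mF by (metis F.m_closed)
    next
      case True
      define u where "u = takeWhile (\<lambda>x. fst x = fst a) y"
      define v where "v = dropWhile (\<lambda>x. fst x = fst a) y"
      have uv: "y = u @ v" "u \<noteq> []" by (simp_all add: u_def v_def y)
      show ?thesis
      proof (cases "v = []")
        case True
        then have "\<forall>x\<in>set y. fst x = fst a" by (simp add: v_def dropWhile_eq_Nil_conv)
        have "\<forall>x\<in>set w. fst x = fst a \<Longrightarrow> reduced w \<Longrightarrow> w = replicate (length w) (hd w)" for w
        proof (induction w)
          case (Cons x w)
          show ?case
          proof (cases w)
            case (Cons z w')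
            then have "z = x" using Cons.prems letter_cases[of z x] by auto
            then show ?thesis using Cons.IH Cons.prems Cons by (auto simp: reduced_Cons_iff)
          qed simp
        qed simp
        then have "y = replicate (length y) (hd y)"
          using \<open>\<forall>x\<in>set y. fst x = fst a\<close> less.prems(1) by (simp add: free_group_simps(1))
        then show ?thesis using triv by blast
      next
        case False
        have lu: "fst (last u) = fst a"
          using set_takeWhileD[OF last_in_set[OF uv(2)[unfolded u_def]]] by (simp add: u_def)
        have hv: "fst (hd v) \<noteq> fst a" using hd_dropWhile[of "\<lambda>x. fst x = fst a" y] False by (simp add: v_def)
        \<comment> \<open>Both sides of the new junction carry the letter \<open>a\<close>, so
          nothing cancels there.\<close>
        have "last v = a" using uv y y' \<open>b = a\<close> False by (metis last_appendR last_ConsR last_snoc append_is_Nil_conv list.distinct(1))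
        moreover have "hd u = a" using uv y by (metis hd_append2 list.sel(1))
        ultimately have "v @ u \<in> carrier F"
          using less.prems(1) uv by (auto simp: free_group_simps(1) reduced_append_iff)
        have c: "u \<in> carrier F" "v \<in> carrier F" using less.prems(1) uv append_closed by blast+
        have "y = u \<cdot> (v @ u) \<cdot> inv\<^sub>F u"
          using append_eq_mult[OF \<open>v @ u \<in> carrier F\<close>] append_eq_mult[of u v] less.prems(1) uv c
          by (simp add: F.m_assoc)
        moreover have "fst (hd (v @ u)) \<noteq> fst (last (v @ u))" using False uv(2) lu hv by simp
        ultimately show ?thesis using c \<open>v @ u \<in> carrier F\<close> uv(2)
          by (intro exI[of _ u] exI[of _ "v @ u"]) simp
      qed
    qed
  qed
qed

section \<open>Exponent sums and the image of the first generator\<close>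

definition int_add :: "int monoid" where
  "int_add = \<lparr>carrier = UNIV, monoid.mult = (+), one = 0\<rparr>"

lemma int_add_simps [simp]:
  "carrier int_add = UNIV" "x \<otimes>\<^bsub>int_add\<^esub> y = x + y" "\<one>\<^bsub>int_add\<^esub> = 0"
  by (simp_all add: int_add_def)

lemma group_int_add: "group int_add"
  by (rule groupI) (auto intro: exI[of _ "- x" for x])

text \<open>The k-th coordinate of the abelianisation, used where conjugation must be
  ignored.\<close>

definition esum :: "nat \<Rightarrow> letter list \<Rightarrow> int" where
  "esum k = word_val int_add (\<lambda>i. if i = k then 1 else 0)"

lemma esum_hom: "esum k \<in> hom F int_add"
  unfolding esum_def by (rule group.word_val_hom[OF group_int_add]) simp

lemma esum_simps:
  "u \<in> carrier F \<Longrightarrow> v \<in> carrier F \<Longrightarrow> esum k (u \<cdot> v) = esum k u + esum k v"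
  "u \<in> carrier F \<Longrightarrow> esum k (inv\<^sub>F u) = - esum k u"
  "esum k (gen i) = (if i = k then 1 else 0)"
proof -
  interpret e: group_hom F int_add "esum k"
    by (simp add: group_hom_def group_hom_axioms_def esum_hom group_int_add group_free_group)
  show m: "esum k (u \<cdot> v) = esum k u + esum k v" if "u \<in> carrier F" "v \<in> carrier F" for u v
    using e.hom_mult[OF that] by simp
  show "esum k (inv\<^sub>F u) = - esum k u" if "u \<in> carrier F"
    using m[of "inv\<^sub>F u" u] that e.hom_one by simp
  show "esum k (gen i) = (if i = k then 1 else 0)"
    by (simp add: esum_def gen_def letter_val_def)
qed

lemma letter_eq_gen: "fst a < n \<Longrightarrow> [a] = (if snd a then gen (fst a) else inv\<^sub>F gen (fst a))"
  by (cases a) (auto simp: gen_def inv_free_group letter_closed letter_inv_def)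

lemma esum_letter: "fst a < n \<Longrightarrow> esum k [a] = (if fst a = k then if snd a then 1 else - 1 else 0)"
  by (subst letter_eq_gen) (auto simp: esum_simps)

text \<open>Traces exclude conjugates of words with different end generators, leaving a power of a
  letter. A letter of another index is excluded by conjugating \<open>\<phi>\<close> with a
  transvection that fixes \<open>x_0\<close> and produces such ends; a proper power is excluded
  because \<open>x_0\<close> has exponent sum 1.\<close>

lemma core_gen0:
  assumes \<phi>: "\<phi> \<in> core" and n3: "n \<ge> 3"
  shows "\<exists>g b. g \<in> carrier F \<and> \<phi> (gen 0) = g \<cdot> [(0, b)] \<cdot> inv\<^sub>F g"
proof -
  have \<phi>a: "\<phi> \<in> auto F" using core_auto[OF \<phi>] .
  have g0: "gen 0 \<in> carrier F" using n3 by simp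
  have tr: "\<bar>mtr (parab_rep t (\<psi> (gen 0)))\<bar> \<le> 2" if "\<psi> \<in> core" "t \<noteq> 0" for t :: int and \<psi>
    by (rule core_mtr[OF that(1) n3 parab_rep_hom that(2)]) (simp_all add: parab_rep_gen parab_simps)
  have tr_conj: "mtr (parab_rep t (g \<cdot> w \<cdot> inv\<^sub>F g)) = mtr (parab_rep t w)"
    if gw: "g \<in> carrier F" "w \<in> carrier F" for g w and t :: int
  proof -
    interpret P: group_hom F SL2 "parab_rep t"
      by (simp add: group_hom_def group_hom_axioms_def parab_rep_hom group_SL2 group_free_group)
    have "mdet (parab_rep t g) = 1" using P.hom_closed[OF gw(1)] by (simp add: SL2_simps)
    then show ?thesis using gw by (simp add: SL2_simps inv_SL2 mtr_conj)
  qed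
  have no: "fst (hd w) = fst (last w)"
    if a: "\<psi> \<in> core" "g \<in> carrier F" "w \<in> carrier F" "w \<noteq> []" "\<psi> (gen 0) = g \<cdot> w \<cdot> inv\<^sub>F g" for \<psi> g w
  proof (rule ccontr)
    assume "fst (hd w) \<noteq> fst (last w)"
    then obtain t :: int where "t \<noteq> 0" "\<bar>mtr (parab_rep t w)\<bar> > 2"
      using unbounded_mtr_parab_rep[OF reduced_closed[OF a(3)] a(4)] by blast
    then show False using tr[OF a(1)] tr_conj[OF a(2,3)] a(5) by fastforce
  qed
  have "\<phi> (gen 0) \<noteq> []" using aut_eq_Nil[OF \<phi>a g0] by (auto simp: gen_def)
  then obtain g w where g: "g \<in> carrier F" and w: "w \<in> carrier F" "w \<noteq> []"
    and \<phi>0: "\<phi> (gen 0) = g \<cdot> w \<cdot> inv\<^sub>F g"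
    and alt: "(\<exists>a. w = replicate (length w) a) \<or> fst (hd w) \<noteq> fst (last w)"
    using conj_normal_form[OF aut_apply[OF \<phi>a g0]] by blast
  obtain a where a: "w = replicate (length w) a" using no[OF \<phi> g w \<phi>0] alt by blast
  define m where "m = length w"
  have m: "w = replicate m a" "m > 0" using a w by (auto simp: m_def)
  have an: "fst a < n" using w m by (auto simp: free_group_simps(1))
  have rep: "replicate k a \<in> carrier F" for k
  proof (induction k)
    case (Suc k)
    then show ?case using an by (cases k) (auto simp: free_group_simps(1))
  qed (simp add: free_group_simps(1))
  have repS: "replicate (Suc k) a = [a] \<cdot> replicate k a" for k
    using Cons_eq_mult[of a "replicate k a"] rep[of "Suc k"] by simp
  have a0: "fst a = 0"
  proof (rule ccontr)
    assume j: "fst a \<noteq> 0"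
    note one = avoids_one(1)[of "fst a"]
    have av: "avoids (fst a) (gen 0)" using n3 j by (intro avoids_gen) auto
    define T where "T = transv (fst a) [] (gen 0)"
    have Ta: "T \<in> auto F" unfolding T_def using transv_auto[OF an one av] .
    note D = F.autoD(4,5,7)[OF Ta]
    have T0: "T (gen 0) = gen 0" unfolding T_def using transv_fixes[OF an one av av] .
    have Tj: "T (gen (fst a)) = gen (fst a) \<cdot> gen 0"
      unfolding T_def using transv_gen[OF an one av] F.l_one[of "gen (fst a)"] an
      by (simp add: free_group_simps(3))
    \<comment> \<open>The image of the letter \<open>a\<close> under \<open>T\<close>: its ends
      involve different generators, and this persists in all powers.\<close>
    define B where "B = (if snd a then [a, (0, True)] else [(0, False), a])"
    have B: "T [a] = B" "B \<noteq> []" "fst (hd B) \<noteq> fst (last B)" "B \<in> carrier F"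
      "hd B \<noteq> letter_inv (last B)"
    proof -
      show "B \<noteq> []" "fst (hd B) \<noteq> fst (last B)" using j by (simp_all add: B_def)
      then show "hd B \<noteq> letter_inv (last B)" by auto
      show Bc: "B \<in> carrier F" using j an n3 by (auto simp: B_def free_group_simps(1) letter_inv_def)
      show "T [a] = B"
      proof (cases "snd a")
        case True
        then have "[a] = gen (fst a)" by (simp add: gen_def prod_eq_iff)
        then show ?thesis using Tj append_eq_mult[of "[a]" "gen 0"] Bc True by (simp add: B_def gen_def)
      next
        case False
        then have "[a] = inv\<^sub>F gen (fst a)" using letter_eq_gen[OF an] by simp
        then have "T [a] = inv\<^sub>F gen 0 \<cdot> [a]" using D an Tj n3 by (simp add: F.inv_mult_group)
        also have "inv\<^sub>F gen 0 = [(0, False)]" using n3 by (simp add: inv_free_group) (simp add: gen_def letter_inv_def)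
        finally show ?thesis using append_eq_mult[of "[(0, False)]" "[a]"] Bc False by (simp add: B_def)
      qed
    qed
    have Tk: "T (replicate k a) = concat (replicate k B) \<and> concat (replicate k B) \<in> carrier F \<and>
        (k > 0 \<longrightarrow> hd (concat (replicate k B)) = hd B \<and> last (concat (replicate k B)) = last B)" for k
    proof (induction k)
      case 0
      then show ?case using F.autoD(6)[OF Ta] by (simp add: free_group_simps)
    next
      case (Suc k)
      have cc: "B @ concat (replicate k B) \<in> carrier F"
        using Suc B by (cases k) (auto simp: free_group_simps(1) reduced_append_iff)
      have "T (replicate (Suc k) a) = B \<cdot> concat (replicate k B)"
        unfolding repS using D rep[of k] letter_closed[OF an] Suc B by simp
      moreover have "hd (B @ concat (replicate k B)) = hd B \<and> last (B @ concat (replicate k B)) = last B"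
        using Suc B(2) by (cases k) auto
      ultimately show ?case using append_eq_mult[OF cc] cc by simp
    qed
    have "(T \<odot> \<phi> \<odot> inv\<^sub>A T) (gen 0) = T (\<phi> (gen 0))"
      using conj_apply[OF Ta \<phi>a g0] T0 by simp
    also have "\<dots> = T g \<cdot> concat (replicate m B) \<cdot> inv\<^sub>F (T g)"
      using \<phi>0 g w D Tk[of m] m by simp
    finally have eq: "(T \<odot> \<phi> \<odot> inv\<^sub>A T) (gen 0) = T g \<cdot> concat (replicate m B) \<cdot> inv\<^sub>F (T g)" .
    have "concat (replicate m B) \<noteq> []" using m(2) B(2) by (cases m) auto
    then have "fst (hd (concat (replicate m B))) = fst (last (concat (replicate m B)))"
      using no[OF core_conj[OF \<phi> Ta] _ _ _ eq] D g Tk[of m] by blast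
    then show False using Tk[of m] m(2) B(3) by simp
  qed
  have "m = 1"
  proof -
    \<comment> \<open>Under the inverse automorphism \<open>x_0\<close> is conjugate to an m-th
      power, so \<open>m\<close> divides its exponent sum 1.\<close>
    define \<theta> where "\<theta> = inv\<^sub>A \<phi>"
    have \<theta>: "\<theta> \<in> auto F" using \<phi>a by (simp add: \<theta>_def)
    note D = F.autoD(4,5,7)[OF \<theta>]
    have "esum 0 (\<theta> (replicate k a)) = int k * esum 0 (\<theta> [a])" for k
    proof (induction k)
      case 0
      then show ?case using F.autoD(6)[OF \<theta>] by (simp add: free_group_simps(3) esum_def)
    next
      case (Suc k)
      then show ?case unfolding repS using D rep[of k] letter_closed[OF an]
        by (simp add: esum_simps algebra_simps)
    qed
    moreover have gen0: "gen 0 = \<theta> g \<cdot> \<theta> w \<cdot> inv\<^sub>F (\<theta> g)"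
    proof -
      have "\<theta> (\<phi> (gen 0)) = gen 0" using F.AutoGroup_inv(2)[OF \<phi>a g0] by (simp add: \<theta>_def)
      then show ?thesis using \<phi>0 D g w by simp
    qed
    moreover have "esum 0 (\<theta> g \<cdot> \<theta> w \<cdot> inv\<^sub>F (\<theta> g)) = esum 0 (\<theta> w)"
      using D(1) g w(1) by (simp add: esum_simps(1,2))
    then have "esum 0 (gen 0) = esum 0 (\<theta> w)" by (simp only: gen0[symmetric])
    ultimately have "int m * esum 0 (\<theta> [a]) = 1" using m(1) esum_simps(3)[of 0 0] by simp
    then show ?thesis using m(2) pos_zmult_eq_1_iff[of "int m"] by simp
  qed
  then have "\<phi> (gen 0) = g \<cdot> [(0, snd a)] \<cdot> inv\<^sub>F g" using \<phi>0 m a0 by (cases a) simp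
  then show ?thesis using g by blast
qed

section \<open>From the first generator to all basis elements, and rigidity\<close>

definition conj_pm :: "(letter list \<Rightarrow> letter list) \<Rightarrow> letter list \<Rightarrow> bool" where
  "conj_pm \<phi> z \<longleftrightarrow> (\<exists>g \<in> carrier F. \<phi> z = g \<cdot> z \<cdot> inv\<^sub>F g \<or> \<phi> z = g \<cdot> inv\<^sub>F z \<cdot> inv\<^sub>F g)"

text \<open>Conjugating \<open>\<phi>\<close> by \<open>\<theta>\<close> moves the question to
  \<open>x_0\<close>; this covers every element that belongs to some basis, in particular products
  of distinct generators.\<close>

lemma core_conj_pm:
  assumes \<phi>: "\<phi> \<in> core" and n3: "n \<ge> 3" and \<theta>: "\<theta> \<in> auto F"
  shows "conj_pm \<phi> (\<theta> (gen 0))"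
proof -
  have g0: "gen 0 \<in> carrier F" using n3 by simp
  note D = F.autoD(4,5,7)[OF \<theta>]
  have i: "inv\<^sub>A \<theta> \<in> auto F" using \<theta> by simp
  let ?\<phi> = "inv\<^sub>A \<theta> \<odot> \<phi> \<odot> inv\<^sub>A (inv\<^sub>A \<theta>)"
  obtain g b where g: "g \<in> carrier F" "?\<phi> (gen 0) = g \<cdot> [(0, b)] \<cdot> inv\<^sub>F g"
    using core_gen0[OF core_conj[OF \<phi> i] n3] by blast
  have z: "\<theta> (gen 0) \<in> carrier F" using D g0 by simp
  have "?\<phi> (gen 0) = (inv\<^sub>A \<theta>) (\<phi> (\<theta> (gen 0)))"
    using conj_apply[OF i core_auto[OF \<phi>] z] F.AutoGroup_inv(2)[OF \<theta> g0] by simp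
  then have "\<theta> (?\<phi> (gen 0)) = \<phi> (\<theta> (gen 0))"
    using F.AutoGroup_inv(1)[OF \<theta> aut_apply[OF core_auto[OF \<phi>] z]] by simp
  then have "\<phi> (\<theta> (gen 0)) = \<theta> g \<cdot> \<theta> [(0, b)] \<cdot> inv\<^sub>F (\<theta> g)"
    using g D n3 letter_closed[of "(0, b)"] by simp
  moreover have "\<theta> [(0, b)] = (if b then \<theta> (gen 0) else inv\<^sub>F (\<theta> (gen 0)))"
    using letter_eq_gen[of "(0, b)"] n3 D g0 by simp
  ultimately show ?thesis unfolding conj_pm_def
    by (intro bexI[of _ "\<theta> g"]) (use D g in auto)
qed

lemma length_mult_le: "length (u \<cdot> v) \<le> length u + length v"
proof -
  have "length (reduce w) \<le> length w" for w
  proof (induction w)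
    case (Cons a w)
    then show ?case by (cases "reduce w") (auto simp: reduce_def)
  qed (simp add: reduce_def)
  from this[of "u @ v"] show ?thesis by (simp add: free_group_simps)
qed

text \<open>Compare the lengths of \<open>z^m\<close> and of the \<open>m\<close>-th power of a conjugate as \<open>m\<close> grows.\<close>

lemma cyclically_reduced_length:
  assumes z: "z \<in> carrier F" "fst (hd z) \<noteq> fst (last z)" and g: "g \<in> carrier F"
  shows "length z \<le> length (g \<cdot> z \<cdot> inv\<^sub>F g)"
proof -
  define u where "u = g \<cdot> z \<cdot> inv\<^sub>F g"
  have uF: "u \<in> carrier F" using z g by (simp add: u_def)
  have "\<exists>y. concat (replicate m z) \<in> carrier F \<and> y \<in> carrier F \<and> length y \<le> m * length u \<and>
      concat (replicate m z) = inv\<^sub>F g \<cdot> y \<cdot> g \<and>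
      (m > 0 \<longrightarrow> z \<noteq> [] \<longrightarrow> hd (concat (replicate m z)) = hd z)" for m
  proof (induction m)
    case 0
    have "[] = inv\<^sub>F g \<cdot> [] \<cdot> g" using g by (metis F.inv_closed F.l_inv F.r_one free_group_simps(3))
    then show ?case by (intro exI[of _ "[]"]) (simp add: free_group_simps(1))
  next
    case (Suc m)
    then obtain y where y: "concat (replicate m z) \<in> carrier F" "y \<in> carrier F" "length y \<le> m * length u"
      "concat (replicate m z) = inv\<^sub>F g \<cdot> y \<cdot> g"
      "m > 0 \<longrightarrow> z \<noteq> [] \<longrightarrow> hd (concat (replicate m z)) = hd z" by blast
    have "hd z \<noteq> letter_inv (last z)" using z(2) by auto
    then have c: "z @ concat (replicate m z) \<in> carrier F"
      using y(1,5) z(1) by (cases m) (auto simp: free_group_simps(1) reduced_append_iff)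
    have "z @ concat (replicate m z) = z \<cdot> (inv\<^sub>F g \<cdot> y \<cdot> g)" using append_eq_mult[OF c] y(4) by simp
    also have "\<dots> = inv\<^sub>F g \<cdot> (u \<cdot> y) \<cdot> g" using z g y(2) by (simp add: u_def F.m_assoc F.inv_mult_cancel)
    finally have e: "concat (replicate (Suc m) z) = inv\<^sub>F g \<cdot> (u \<cdot> y) \<cdot> g" by simp
    have "concat (replicate (Suc m) z) \<in> carrier F" using c by simp
    moreover have "length (u \<cdot> y) \<le> Suc m * length u" using length_mult_le[of u y] y(3) by simp
    moreover have "z \<noteq> [] \<longrightarrow> hd (concat (replicate (Suc m) z)) = hd z" by (cases z) simp_all
    moreover have "u \<cdot> y \<in> carrier F" using uF y(2) by simp
    ultimately show ?case using e by blast
  qed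
  \<comment> \<open>With exponent 2 |g| + 1, the overhead 2 |g| caused by the conjugators cannot
    make up for one missing letter per factor.\<close>
  then obtain y where y: "length y \<le> (2 * length g + 1) * length u"
    "concat (replicate (2 * length g + 1) z) = inv\<^sub>F g \<cdot> y \<cdot> g" by blast
  have "length (inv\<^sub>F g) = length g" using g by (simp add: inv_free_group)
  then have "length (inv\<^sub>F g \<cdot> y \<cdot> g) \<le> length y + 2 * length g"
    using length_mult_le[of "inv\<^sub>F g \<cdot> y" g] length_mult_le[of "inv\<^sub>F g" y] by linarith
  moreover have "length (concat (replicate m z)) = m * length z" for m by (induction m) auto
  ultimately have le: "(2 * length g + 1) * length z \<le> (2 * length g + 1) * length u + 2 * length g"
    using y by (metis (no_types, lifting) add_le_mono1 le_trans)
  show ?thesis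
  proof (rule ccontr)
    assume "\<not> ?thesis"
    then have "length z \<ge> Suc (length u)" by (simp add: u_def)
    then have "(2 * length g + 1) * length z \<ge> (2 * length g + 1) * Suc (length u)" by (rule mult_le_mono2)
    then show False using le by simp
  qed
qed

lemma strip_conjugator:
  assumes "g \<in> carrier F" "fst x < n"
  shows "\<exists>g'. g' \<in> carrier F \<and> g \<cdot> [x] \<cdot> inv\<^sub>F g = g' \<cdot> [x] \<cdot> inv\<^sub>F g' \<and> (g' = [] \<or> fst (last g') \<noteq> fst x)"
  using assms(1)
proof (induction g rule: rev_induct)
  case Nil
  then show ?case by blast
next
  case (snoc y g)
  show ?case
  proof (cases "fst y = fst x")
    case False
    then show ?thesis using snoc.prems by (intro exI[of _ "g @ [y]"]) simp
  next
    case True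
    have c: "g \<in> carrier F" "[y] \<in> carrier F" "[x] \<in> carrier F"
      using append_closed[OF snoc.prems] assms letter_closed by auto
    have yx: "[y] \<cdot> [x] = [x] \<cdot> [y]"
    proof (cases "y = x")
      case False
      then have "y = letter_inv x" using True letter_cases by blast
      then have "[y] = inv\<^sub>F [x]" using c by (simp add: inv_free_group)
      then show ?thesis using c by simp
    qed simp
    have "(g @ [y]) \<cdot> [x] \<cdot> inv\<^sub>F (g @ [y]) = g \<cdot> ([y] \<cdot> [x]) \<cdot> (inv\<^sub>F [y] \<cdot> inv\<^sub>F g)"
      using append_eq_mult[OF snoc.prems] c by (simp add: F.m_assoc F.inv_mult_group)
    also have "\<dots> = g \<cdot> [x] \<cdot> inv\<^sub>F g" unfolding yx using c by (simp add: F.m_assoc F.inv_mult_cancel)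
    finally show ?thesis using snoc.IH[OF c(1)] by metis
  qed
qed

lemma single_letter_commute:
  assumes "w \<in> carrier F" "fst ` set w \<subseteq> {fst x}" "fst x < n"
  shows "w \<cdot> [x] = [x] \<cdot> w"
  using assms(1,2)
proof (induction w)
  case Nil
  then show ?case using letter_closed[OF assms(3)] F.l_one F.r_one by (metis free_group_simps(3))
next
  case (Cons y w)
  have c: "[y] \<in> carrier F" "w \<in> carrier F" "[x] \<in> carrier F"
    using Cons_closed[OF Cons.prems(1)] letter_closed assms(3) by auto
  have yx: "[y] \<cdot> [x] = [x] \<cdot> [y]"
  proof (cases "y = x")
    case False
    then have "y = letter_inv x" using Cons.prems(2) letter_cases[of y x] by auto
    then have "[y] = inv\<^sub>F [x]" using c by (simp add: inv_free_group)
    then show ?thesis using c by simp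
  qed simp
  have "(y # w) \<cdot> [x] = [y] \<cdot> (w \<cdot> [x])" using Cons_eq_mult[OF Cons.prems(1)] c by (simp add: F.m_assoc)
  also have "\<dots> = ([y] \<cdot> [x]) \<cdot> w" using Cons c by (simp add: F.m_assoc)
  also have "\<dots> = [x] \<cdot> (y # w)" unfolding yx Cons_eq_mult[OF Cons.prems(1)] using c by (simp add: F.m_assoc)
  finally show ?case .
qed

text \<open>Let \<open>w\<close> be the initial run of \<open>x_i\<close> in the conjugator. If
  anything followed it, the image of x_i x_j would be conjugate to a word of length at least 4 with
  different end generators, which no conjugation can shorten to length 2.\<close>

lemma pair_rigidity:
  assumes \<phi>: "\<phi> \<in> auto F" and ij: "i < n" "j < n" "i \<noteq> j" and \<phi>i: "\<phi> (gen i) = [(i, b)]"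
    and cj: "conj_pm \<phi> (gen j)" and cij: "conj_pm \<phi> (gen i \<cdot> gen j)"
  shows "\<exists>w c. w \<in> carrier F \<and> fst ` set w \<subseteq> {i} \<and> \<phi> (gen j) = w \<cdot> [(j, c)] \<cdot> inv\<^sub>F w"
proof -
  have gF: "gen i \<in> carrier F" "gen j \<in> carrier F" using ij by simp_all
  obtain g0 c where g0: "g0 \<in> carrier F" "\<phi> (gen j) = g0 \<cdot> [(j, c)] \<cdot> inv\<^sub>F g0"
  proof -
    obtain g where g: "g \<in> carrier F"
      "\<phi> (gen j) = g \<cdot> gen j \<cdot> inv\<^sub>F g \<or> \<phi> (gen j) = g \<cdot> inv\<^sub>F (gen j) \<cdot> inv\<^sub>F g"
      using cj by (auto simp: conj_pm_def)
    have "[(j, True)] = gen j" "[(j, False)] = inv\<^sub>F (gen j)"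
      using letter_eq_gen[of "(j, True)"] letter_eq_gen[of "(j, False)"] ij by simp_all
    then show thesis using that g by metis
  qed
  have jn: "fst (j, c) < n" using ij by simp
  obtain g where g: "g \<in> carrier F" "\<phi> (gen j) = g \<cdot> [(j, c)] \<cdot> inv\<^sub>F g" "g = [] \<or> fst (last g) \<noteq> j"
    using strip_conjugator[OF g0(1) jn] g0(2) by auto
  define w where "w = takeWhile (\<lambda>x. fst x = i) g"
  define h where "h = dropWhile (\<lambda>x. fst x = i) g"
  have wh: "g = w @ h" by (simp add: w_def h_def)
  have c: "w \<in> carrier F" "h \<in> carrier F" "[(j, c)] \<in> carrier F" "[(i, b)] \<in> carrier F"
    using append_closed[of w h] g(1) wh letter_closed ij by auto
  have wi: "fst ` set w \<subseteq> {i}" by (auto simp: w_def dest: set_takeWhileD)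
  have "h = []"
  proof (rule ccontr)
    assume h: "h \<noteq> []"
    have hi: "fst (hd h) \<noteq> i" using hd_dropWhile[of "\<lambda>x. fst x = i" g] h by (simp add: h_def)
    have lj: "fst (last h) \<noteq> j" using g(3) h wh by auto
    define z where "z = [(i, b)] @ h @ [(j, c)] @ winv h"
    have zF: "z \<in> carrier F"
    proof -
      have a: "(j, c) \<noteq> letter_inv (last h)" "hd (winv h) \<noteq> letter_inv (j, c)" "hd h \<noteq> letter_inv (i, b)"
        using lj hi h by (auto simp: hd_winv letter_inv_def)
      have "reduced z" using a h c(2) by (auto simp: z_def reduced_append_iff reduced_Cons_iff free_group_simps(1))
      moreover have "fst ` set z \<subseteq> {..<n}" using ij c(2) by (auto simp: z_def image_Un free_group_simps(1))
      ultimately show ?thesis by (simp add: free_group_simps(1))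
    qed
    have "z = [(i, b)] \<cdot> (h \<cdot> ([(j, c)] \<cdot> winv h))"
      using zF append_eq_mult[of "[(i, b)]"] append_eq_mult[of h] append_eq_mult[of "[(j, c)]"] append_closed
      unfolding z_def by metis
    then have z: "z = [(i, b)] \<cdot> (h \<cdot> ([(j, c)] \<cdot> inv\<^sub>F h))" using c by (simp add: inv_free_group)
    \<comment> \<open>\<open>w\<close> commutes with the image of \<open>x_i\<close>, so it can be
      pulled out as a conjugator of the whole product.\<close>
    have comm: "w \<cdot> [(i, b)] = [(i, b)] \<cdot> w" using single_letter_commute[OF c(1), of "(i, b)"] wi ij by simp
    have \<phi>ij: "\<phi> (gen i \<cdot> gen j) = w \<cdot> z \<cdot> inv\<^sub>F w"
    proof -
      have "\<phi> (gen i \<cdot> gen j) = [(i, b)] \<cdot> (w \<cdot> h \<cdot> [(j, c)] \<cdot> inv\<^sub>F (w \<cdot> h))"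
        using F.autoD(5)[OF \<phi> gF] \<phi>i g append_eq_mult[of w h] wh by simp
      also have "\<dots> = ([(i, b)] \<cdot> w) \<cdot> (h \<cdot> ([(j, c)] \<cdot> inv\<^sub>F h)) \<cdot> inv\<^sub>F w"
        using c by (simp add: F.m_assoc F.inv_mult_group)
      also have "\<dots> = w \<cdot> z \<cdot> inv\<^sub>F w" unfolding comm[symmetric] z using c by (simp add: F.m_assoc)
      finally show ?thesis .
    qed
    obtain k v where k: "k \<in> carrier F" "v \<in> carrier F" "length v \<le> 2" "\<phi> (gen i \<cdot> gen j) = k \<cdot> v \<cdot> inv\<^sub>F k"
    proof -
      have l: "length (gen i \<cdot> gen j) \<le> 2" using length_mult_le[of "gen i" "gen j"] by (simp add: gen_def)
      then have l': "length (inv\<^sub>F (gen i \<cdot> gen j)) \<le> 2" using gF inv_free_group[of "gen i \<cdot> gen j"] by simp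
      have m: "gen i \<cdot> gen j \<in> carrier F" "inv\<^sub>F (gen i \<cdot> gen j) \<in> carrier F" using gF by simp_all
      obtain k where "k \<in> carrier F" "\<phi> (gen i \<cdot> gen j) = k \<cdot> (gen i \<cdot> gen j) \<cdot> inv\<^sub>F k \<or>
          \<phi> (gen i \<cdot> gen j) = k \<cdot> inv\<^sub>F (gen i \<cdot> gen j) \<cdot> inv\<^sub>F k"
        using cij unfolding conj_pm_def by blast
      then show thesis using that l l' m by metis
    qed
    have "v = (inv\<^sub>F k \<cdot> w) \<cdot> z \<cdot> inv\<^sub>F (inv\<^sub>F k \<cdot> w)"
    proof -
      have "v = inv\<^sub>F k \<cdot> (k \<cdot> v \<cdot> inv\<^sub>F k) \<cdot> k" using k by (simp add: F.m_assoc F.inv_mult_cancel)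
      also have "\<dots> = inv\<^sub>F k \<cdot> (w \<cdot> z \<cdot> inv\<^sub>F w) \<cdot> k" using k(4) \<phi>ij by simp
      finally show ?thesis using k c zF by (simp add: F.m_assoc F.inv_mult_group)
    qed
    moreover have "fst (hd z) \<noteq> fst (last z)"
      using h hi last_winv[OF h] by (simp add: z_def)
    ultimately have "length z \<le> 2"
      using cyclically_reduced_length[OF zF, of "inv\<^sub>F k \<cdot> w"] k c by simp
    then show False using h by (simp add: z_def)
  qed
  then show ?thesis using g c wi wh by auto
qed

text \<open>Two inner corrections send \<open>x_0\<close> and then \<open>x_1\<close> to single
  letters. Any other basis element is then conjugated both by a word in \<open>x_0\<close> and by a
  word in \<open>x_1\<close>, hence by the empty word. Only signs remain.\<close>

lemma core_inner:
  assumes \<phi>: "\<phi> \<in> core" and n3: "n \<ge> 3"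
  shows "\<phi> \<in> inner_auto F"
proof -
  interpret I: normal "inner_auto F" A by (rule F.inner_auto_normal)
  have idx: "0 < n" "1 < n" "2 < n" using n3 by auto
  have pm1: "conj_pm \<psi> (gen i)" if "\<psi> \<in> core" "i < n" for \<psi> i
    using core_conj_pm[OF that(1) n3 swap_auto[OF idx(1) that(2)]] swap_gen[OF idx(1) that(2) idx(1)] by simp
  have pm2: "conj_pm \<psi> (gen i \<cdot> gen j)" if \<psi>: "\<psi> \<in> core" and ij: "i < n" "j < n" "i \<noteq> j" for \<psi> i j
  proof -
    note one = avoids_one(1)[of i]
    have av: "avoids i (gen j)" using ij by (simp add: avoids_gen)
    have "(transv i [] (gen j) \<odot> swap 0 i) (gen 0) = gen i \<cdot> gen j"
      using transv_auto[OF ij(1) one av] swap_auto[OF idx(1) ij(1)] transv_gen[OF ij(1) one av] idx ij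
        F.l_one[of "gen i"]
      by (simp add: aut_mult_apply swap_gen free_group_simps(3))
    then show ?thesis
      using core_conj_pm[OF \<psi> n3, of "transv i [] (gen j) \<odot> swap 0 i"]
        transv_auto[OF ij(1) one av] swap_auto[OF idx(1) ij(1)] by simp
  qed
  have pm3: "conj_pm \<psi> (gen 0 \<cdot> (gen 1 \<cdot> gen 2))" if "\<psi> \<in> core" for \<psi>
  proof -
    note one = avoids_one(1)[of 0]
    have av: "avoids 0 (gen 1 \<cdot> gen 2)" using idx by (intro avoids_mult avoids_gen) auto
    show ?thesis
      using core_conj_pm[OF that n3 transv_auto[OF idx(1) one av]] transv_gen[OF idx(1) one av]
        F.l_one[of "gen 0"] idx by (simp add: free_group_simps(3))
  qed
  obtain g b0 where g: "g \<in> carrier F" "\<phi> (gen 0) = g \<cdot> [(0, b0)] \<cdot> inv\<^sub>F g"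
    using core_gen0[OF \<phi> n3] by blast
  have l0: "[(0, b0)] \<in> carrier F" using letter_closed idx by simp
  define \<phi>1 where "\<phi>1 = F.inn (inv\<^sub>F g) \<odot> \<phi>"
  have \<phi>1: "\<phi>1 \<in> core" unfolding \<phi>1_def using core_mult[OF inn_core \<phi>] g(1) by simp
  have inn_app: "(F.inn u \<odot> \<psi>) w = u \<cdot> \<psi> w \<cdot> inv\<^sub>F u"
    if "u \<in> carrier F" "\<psi> \<in> auto F" "w \<in> carrier F" for u \<psi> w
    using that aut_mult_apply[OF F.inn_auto[OF that(1)] that(2,3)] aut_apply[OF that(2,3)] by (simp add: F.inn_def)
  have \<phi>10: "\<phi>1 (gen 0) = [(0, b0)]"
    using inn_app[of "inv\<^sub>F g" \<phi> "gen 0"] g core_auto[OF \<phi>] idx l0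
    by (simp add: \<phi>1_def F.m_assoc F.inv_mult_cancel)
  obtain w b1 where w: "w \<in> carrier F" "fst ` set w \<subseteq> {0}" "\<phi>1 (gen 1) = w \<cdot> [(1, b1)] \<cdot> inv\<^sub>F w"
    using pair_rigidity[OF core_auto[OF \<phi>1] idx(1,2) _ \<phi>10 pm1[OF \<phi>1 idx(2)] pm2[OF \<phi>1 idx(1,2)]] by auto
  have l1: "[(1, b1)] \<in> carrier F" using letter_closed idx by simp
  \<comment> \<open>\<open>w\<close> is a word in \<open>x_0\<close>, so this correction leaves the
    image of \<open>x_0\<close> alone.\<close>
  define \<phi>2 where "\<phi>2 = F.inn (inv\<^sub>F w) \<odot> \<phi>1"
  have \<phi>2: "\<phi>2 \<in> core" unfolding \<phi>2_def using core_mult[OF inn_core \<phi>1] w(1) by simp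
  note \<phi>2a = core_auto[OF \<phi>2]
  have comm: "w \<cdot> [(0, b0)] = [(0, b0)] \<cdot> w" using single_letter_commute[OF w(1), of "(0, b0)"] w(2) idx by simp
  have \<phi>20: "\<phi>2 (gen 0) = [(0, b0)]"
    using inn_app[of "inv\<^sub>F w" \<phi>1 "gen 0"] w(1) core_auto[OF \<phi>1] idx l0 \<phi>10
    by (simp add: \<phi>2_def F.m_assoc comm[symmetric] F.inv_mult_cancel)
  have \<phi>21: "\<phi>2 (gen 1) = [(1, b1)]"
    using inn_app[of "inv\<^sub>F w" \<phi>1 "gen 1"] w core_auto[OF \<phi>1] idx l1
    by (simp add: \<phi>2_def F.m_assoc F.inv_mult_cancel)
  have letters: "\<exists>c. \<phi>2 (gen j) = [(j, c)]" if j: "j < n" for j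
  proof -
    consider "j = 0" | "j = 1" | "j \<noteq> 0" "j \<noteq> 1" by blast
    then show ?thesis
    proof cases
      case 3
      obtain u c where u: "u \<in> carrier F" "fst ` set u \<subseteq> {0}" "\<phi>2 (gen j) = u \<cdot> [(j, c)] \<cdot> inv\<^sub>F u"
        using pair_rigidity[OF \<phi>2a idx(1) j 3(1)[symmetric] \<phi>20 pm1[OF \<phi>2 j] pm2[OF \<phi>2 idx(1) j 3(1)[symmetric]]]
        by blast
      obtain v d where v: "v \<in> carrier F" "fst ` set v \<subseteq> {1}" "\<phi>2 (gen j) = v \<cdot> [(j, d)] \<cdot> inv\<^sub>F v"
        using pair_rigidity[OF \<phi>2a idx(2) j 3(2)[symmetric] \<phi>21 pm1[OF \<phi>2 j] pm2[OF \<phi>2 idx(2) j 3(2)[symmetric]]]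
        by blast
      \<comment> \<open>The conjugator avoids the generator of the middle letter, so nothing cancels
        and the two expressions can be compared as lists.\<close>
      have list: "y \<cdot> [(j, e)] \<cdot> inv\<^sub>F y = y @ [(j, e)] @ winv y"
        if y: "y \<in> carrier F" "fst ` set y \<subseteq> {k}" "k \<noteq> j" for y e k
      proof -
        have a: "(j, e) \<noteq> letter_inv (last y)" "hd (winv y) \<noteq> letter_inv (j, e)" if "y \<noteq> []"
        proof -
          have "fst (last y) = k" using y(2) last_in_set[OF that] by auto
          then show "(j, e) \<noteq> letter_inv (last y)" "hd (winv y) \<noteq> letter_inv (j, e)"
            using y(3) hd_winv[OF that] by (auto simp: letter_inv_def)
        qed
        have "reduced (y @ [(j, e)] @ winv y)"
          using a y(1) by (auto simp: reduced_append_iff reduced_Cons_iff free_group_simps(1))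
        moreover have "fst ` set (y @ [(j, e)] @ winv y) \<subseteq> {..<n}"
          using y(1) j by (auto simp: image_Un free_group_simps(1))
        ultimately have c: "y @ [(j, e)] @ winv y \<in> carrier F" by (simp add: free_group_simps(1))
        have "y @ [(j, e)] @ winv y = y \<cdot> ([(j, e)] \<cdot> winv y)"
          using c append_eq_mult append_closed by metis
        then show ?thesis using y(1) letter_closed[of "(j, e)"] j by (simp add: inv_free_group F.m_assoc)
      qed
      have eq: "u @ [(j, c)] @ winv u = v @ [(j, d)] @ winv v"
        using list[OF u(1,2)] list[OF v(1,2)] u(3) v(3) 3 by simp
      have "u = []"
      proof (rule ccontr)
        assume "u \<noteq> []"
        then have "fst (hd (u @ [(j, c)] @ winv u)) = 0" using u(2) by (cases u) auto
        moreover have "fst (hd (v @ [(j, d)] @ winv v)) \<noteq> 0" using v(2) 3(1) by (cases v) auto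
        ultimately show False using eq by simp
      qed
      then show ?thesis using u(3) list[OF u(1,2)] 3 by auto
    qed (use \<phi>20 \<phi>21 in auto)
  qed
  then obtain b where b: "\<And>j. j < n \<Longrightarrow> \<phi>2 (gen j) = [(j, b j)]" by metis
  \<comment> \<open>Conjugates of x_0 x_j, or of its inverse, have equal exponent sums in both
    indices, so the signs agree.\<close>
  have sign: "b j = b 0" if j: "j < n" for j
  proof (cases "j = 0")
    case False
    have gF: "gen 0 \<in> carrier F" "gen j \<in> carrier F" using idx j by simp_all
    have e: "esum k (\<phi>2 (gen 0 \<cdot> gen j)) = esum k [(0, b 0)] + esum k [(j, b j)]" for k
      using F.autoD(5)[OF \<phi>2a gF] b[OF idx(1)] b[OF j] letter_closed idx j by (simp add: esum_simps)
    obtain h where h: "h \<in> carrier F" "\<phi>2 (gen 0 \<cdot> gen j) = h \<cdot> (gen 0 \<cdot> gen j) \<cdot> inv\<^sub>F h \<or>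
        \<phi>2 (gen 0 \<cdot> gen j) = h \<cdot> inv\<^sub>F (gen 0 \<cdot> gen j) \<cdot> inv\<^sub>F h"
      using pm2[OF \<phi>2 idx(1) j False[symmetric]] unfolding conj_pm_def by blast
    have "(\<forall>k. esum k (\<phi>2 (gen 0 \<cdot> gen j)) = esum k (gen 0) + esum k (gen j)) \<or>
        (\<forall>k. esum k (\<phi>2 (gen 0 \<cdot> gen j)) = - (esum k (gen 0) + esum k (gen j)))"
      using h(2) h(1) gF by (auto simp: esum_simps(1,2))
    then have "esum 0 (\<phi>2 (gen 0 \<cdot> gen j)) = esum j (\<phi>2 (gen 0 \<cdot> gen j))"
      using False by (auto simp: esum_simps(3))
    then show ?thesis using False e[of 0] e[of j] idx j by (auto simp: esum_letter split: if_splits)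
  qed simp
  have "b 0"
  proof (rule ccontr)
    assume neg: "\<not> b 0"
    have gF: "gen 0 \<in> carrier F" "gen 1 \<in> carrier F" "gen 2 \<in> carrier F" using idx by simp_all
    have inv: "\<phi>2 (gen j) = inv\<^sub>F (gen j)" if "j < n" for j
      using b[OF that] sign[OF that] neg letter_eq_gen[of "(j, False)"] that by simp
    \<comment> \<open>Two letters cannot detect the simultaneous inversion of all generators: a
      two-letter word and its reversal are cyclic rotations of each other.\<close>
    let ?z = "gen 0 \<cdot> (gen 1 \<cdot> gen 2)"
    have zF: "?z \<in> carrier F" using gF by simp
    have \<phi>z: "\<phi>2 ?z = inv\<^sub>F (gen 0) \<cdot> (inv\<^sub>F (gen 1) \<cdot> inv\<^sub>F (gen 2))"
      using F.autoD(5)[OF \<phi>2a] gF inv idx by simp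
    obtain h where h: "h \<in> carrier F" "\<phi>2 ?z = h \<cdot> ?z \<cdot> inv\<^sub>F h \<or> \<phi>2 ?z = h \<cdot> inv\<^sub>F ?z \<cdot> inv\<^sub>F h"
      using pm3[OF \<phi>2] unfolding conj_pm_def by blast
    have "esum 0 (\<phi>2 ?z) = - 1" unfolding \<phi>z using gF by (simp add: esum_simps)
    moreover have "esum 0 (h \<cdot> ?z \<cdot> inv\<^sub>F h) = 1" using gF h(1) by (simp add: esum_simps)
    ultimately have z: "\<phi>2 ?z = h \<cdot> inv\<^sub>F ?z \<cdot> inv\<^sub>F h" using h(2) by auto
    interpret P: group_hom F SL2 "parab_rep (1 :: int)"
      by (simp add: group_hom_def group_hom_axioms_def parab_rep_hom group_SL2 group_free_group)
    have det: "mdet (parab_rep 1 x) = (1 :: int)" if "x \<in> carrier F" for x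
      using P.hom_closed[OF that] by (simp add: SL2_simps)
    \<comment> \<open>Traces are invariant under conjugation and inversion, yet at parameter 1 they
      are 4 for the word and 2 for its image.\<close>
    have "mtr (parab_rep (1 :: int) (\<phi>2 ?z)) = mtr (parab_rep (1 :: int) ?z)"
      unfolding z using h(1) zF det by (simp add: SL2_simps inv_SL2 mtr_conj)
    moreover have "mtr (parab_rep (1 :: int) ?z) = 4"
      using gF by (simp add: SL2_simps parab_rep_gen parab_def vs_def vx_def vy_def)
    moreover have "mtr (parab_rep (1 :: int) (\<phi>2 ?z)) = 2"
      unfolding \<phi>z using gF det by (simp add: SL2_simps inv_SL2 parab_rep_gen parab_def vs_def vx_def vy_def)
    ultimately show False by simp
  qed
  have "\<phi>2 = \<one>\<^bsub>A\<^esub>"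
  proof (rule aut_eqI[OF \<phi>2a])
    show "\<one>\<^bsub>A\<^esub> \<in> auto F" using A.one_closed by simp
    fix i assume i: "i < n"
    have "b i" using \<open>b 0\<close> sign[OF i] by simp
    then show "\<phi>2 (gen i) = \<one>\<^bsub>A\<^esub> (gen i)" using b[OF i] i by (simp add: F.AutoGroup_one) (simp add: gen_def)
  qed
  have "\<phi>1 = F.inn w"
  proof -
    have "F.inn w \<odot> (F.inn (inv\<^sub>F w) \<odot> \<phi>1) = \<phi>1"
      using w(1) core_auto[OF \<phi>1] F.inn_auto by (simp add: F.inn_mult F.inn_one flip: A.m_assoc)
    then show ?thesis using \<open>\<phi>2 = \<one>\<^bsub>A\<^esub>\<close> w(1) F.inn_auto by (simp add: \<phi>2_def)
  qed
  moreover have "F.inn g \<odot> (F.inn (inv\<^sub>F g) \<odot> \<phi>) = \<phi>"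
    using g(1) core_auto[OF \<phi>] F.inn_auto by (simp add: F.inn_mult F.inn_one flip: A.m_assoc)
  ultimately have "\<phi> = F.inn (g \<cdot> w)" using g(1) w(1) by (simp add: \<phi>1_def F.inn_mult)
  then show ?thesis using g(1) w(1) by (simp add: F.inner_auto_eq)
qed

text \<open>Otherwise \<open>core\<close> would be the whole group and the inversion of
  \<open>x_0\<close> would be inner, although it changes an exponent sum. Existence matters because
  both Frattini subgroups default to the whole group.\<close>

lemma exists_maximal_finite_index:
  assumes "n \<ge> 3"
  shows "\<exists>M. maximal_subgroup M A \<and> finite (rcosets\<^bsub>A\<^esub> M) \<and> inner_auto F \<subseteq> M"
proof (rule ccontr)
  assume "\<not> ?thesis"
  then have "flip 0 \<in> core" using flip_auto assms by (auto simp: core_def)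
  then obtain g where g: "g \<in> carrier F" "flip 0 = F.inn g"
    using core_inner assms by (auto simp: F.inner_auto_eq)
  have "flip 0 (gen 0) = inv\<^sub>F (gen 0)" using flip_gen assms by simp
  then have "inv\<^sub>F (gen 0) = g \<cdot> gen 0 \<cdot> inv\<^sub>F g" using g assms by (simp add: F.inn_def)
  then have "esum 0 (inv\<^sub>F (gen 0)) = esum 0 (g \<cdot> gen 0 \<cdot> inv\<^sub>F g)" by simp
  then show False using g assms by (simp add: esum_simps)
qed

end

theorem theorem1p3:
  fixes n :: nat
  assumes "n \<ge> 3"
  shows "Frattini (OutGroup (free_group n)) = {\<one>\<^bsub>OutGroup (free_group n)\<^esub>}
       \<and> Frattini_f (OutGroup (free_group n)) = {\<one>\<^bsub>OutGroup (free_group n)\<^esub>}"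
proof -
  interpret free_group_rank n .
  let ?I = "inner_auto F"
  interpret I: normal ?I A by (rule F.inner_auto_normal)
  let ?O = "OutGroup F"
  have O: "?O = A Mod ?I" by (simp add: OutGroup_def)
  have oneO: "\<one>\<^bsub>?O\<^esub> = ?I" by (simp add: O)
  let ?P = "\<lambda>H. maximal_subgroup H ?O \<and> finite (rcosets\<^bsub>?O\<^esub> H)"
  let ?img = "\<lambda>M. (\<lambda>x. ?I #>\<^bsub>A\<^esub> x) ` M"
  have img: "?P (?img M)" if "maximal_subgroup M A \<and> finite (rcosets\<^bsub>A\<^esub> M) \<and> ?I \<subseteq> M" for M
    using A.maximal_subgroup_quotient(1,2)[OF F.inner_auto_normal, of M] that by (simp add: O)
  obtain M0 where M0: "maximal_subgroup M0 A \<and> finite (rcosets\<^bsub>A\<^esub> M0) \<and> ?I \<subseteq> M0"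
    using exists_maximal_finite_index[OF assms] by blast
  have sub: "\<Inter>{H. ?P H} \<subseteq> {\<one>\<^bsub>?O\<^esub>}"
  proof
    fix y assume y: "y \<in> \<Inter>{H. ?P H}"
    then have "y \<in> ?img M0" using img[OF M0] by blast
    moreover have "M0 \<subseteq> auto F" using M0 subgroup.subset by (fastforce simp: maximal_subgroup_def)
    ultimately obtain \<phi> where \<phi>: "\<phi> \<in> auto F" "y = ?I #>\<^bsub>A\<^esub> \<phi>" by blast
    \<comment> \<open>Membership in a maximal subgroup above the inner automorphisms is read off the
      coset \<open>y\<close>, so the choice of representative is harmless.\<close>
    have "\<phi> \<in> core" unfolding core_def
    proof (intro CollectI conjI allI impI \<phi>(1))
      fix M assume M: "maximal_subgroup M A" "finite (rcosets\<^bsub>A\<^esub> M)" "?I \<subseteq> M"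
      have "?P (?img M)" using img M by blast
      then have "?I #>\<^bsub>A\<^esub> \<phi> \<in> ?img M" using y \<phi>(2) by blast
      then show "\<phi> \<in> M"
        using A.maximal_subgroup_quotient(3)[OF F.inner_auto_normal M(1,3)] \<phi>(1) by simp
    qed
    then have "\<phi> \<in> ?I" using core_inner assms by blast
    then have "y = ?I" using A.coset_join2[OF _ I.subgroup_axioms] \<phi> by simp
    then show "y \<in> {\<one>\<^bsub>?O\<^esub>}" using oneO by simp
  qed
  have one: "\<one>\<^bsub>?O\<^esub> \<in> H" if "maximal_subgroup H ?O" for H
    using that subgroup.one_closed by (auto simp: maximal_subgroup_def)
  have ex: "\<exists>H. ?P H" using img[OF M0] by blast
  have "Frattini_f ?O = {\<one>\<^bsub>?O\<^esub>}"
    unfolding Frattini_f_def using ex sub one by auto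
  moreover have "Frattini ?O = {\<one>\<^bsub>?O\<^esub>}"
  proof -
    \<comment> \<open>A maximal subgroup exists, so the default branch does not apply; intersecting
      over more subgroups only shrinks the result.\<close>
    have "Frattini ?O = \<Inter>{H. maximal_subgroup H ?O}" using ex by (auto simp: Frattini_def)
    moreover have "\<dots> \<subseteq> \<Inter>{H. ?P H}" by blast
    ultimately show ?thesis using sub one by blast
  qed
  ultimately show ?thesis by simp
qed

end
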